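(* Let $\mathcal Q$ be a logic on a Hilbert space $\mathcal H$. The relations (i) $E^A(\lambda)=\bigwedge_{\lambda<r\in\mathbf Q}u(\check r)$ for all $\lambda\in\mathbf Q$, (ii) $u(\check r)=E^A(r)$ for all $r\in\mathbf Q$, between $u\in\mathbf R^{(\mathcal Q)}$ and self-adjoint operators $A$ affiliated with $\mathcal Q''$ set up a one-to-one correspondence between $\mathbf R^{(\mathcal Q)}$ and the set of self-adjoint operators affiliated with $\mathcal Q''$: for each $u\in\mathbf R^{(\mathcal Q)}$ there is a unique such $A$ satisfying (i) and (ii), for each such $A$ there is a unique $u\in\mathbf R^{(\mathcal Q)}$ satisfying (i) and (ii), and the resulting map is a bijection.
   Context: $\mathcal Q(\mathcal H)$ is the lattice of orthogonal projections on $\mathcal H$ (order by inclusion of ranges, $\wedge,\vee$ = projections onto intersection / closed span of union of ranges, $P^\perp=1-P$). For $\mathcal A\subseteq\mathcal Q(\mathcal H)$, $\mathcal A^!$ is the set of projections commuting with all elements of $\mathcal A$; a logic is $\mathcal Q\subseteq\mathcal Q(\mathcal H)$ with $\mathcal Q=\mathcal Q^{!!}$; $\mathcal Q''$ is the von Neumann algebra (double commutant) generated by $\mathcal Q$. A densely defined closed operator $A$ is affiliated with a von Neumann algebra $\mathcal M$ iff $U^*AU=A$ for every unitary $U\in\mathcal M'$. For a self-adjoint $A$, $\{E^A(\lambda)\}_{\lambda\in\mathbb R}$ is its resolution of the identity (spectral projection of $(-\infty,\lambda]$). $P\Rightarrow Q=P^\perp\vee(P\wedge Q)$. $V^{(\mathcal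 Q)}=\bigcup_\alpha V^{(\mathcal Q)}_\alpha$, where $V^{(\mathcal Q)}_\alpha$ is the set of functions $u$ with values in $\mathcal Q$ and $\mathrm{dom}(u)\subseteq\bigcup_{\beta<\alpha}V^{(\mathcal Q)}_\beta$. For a set $v$ of the ZFC universe, $\check v=\{(\check w,1): w\in v\}$ (by $\in$-recursion). $\mathbf Q$ is the set of rationals. Truth values are defined recursively: $[\![u=v]\!]=\bigwedge_{u'\in\mathrm{dom}(u)}(u(u')\Rightarrow[\![u'\in v]\!])\wedge\bigwedge_{v'\in\mathrm{dom}(v)}(v(v')\Rightarrow[\![v'\in u]\!])$, $[\![u\in v]\!]=\bigvee_{v'\in\mathrm{dom}(v)}(v(v')\wedge[\![u=v']\!])$, $[\![\neg\phi]\!]=[\![\phi]\!]^\perp$, connectives by lattice operations, $[\![(\forall x\in u)\phi]\!]=\bigwedge_{u'\in\mathrm{dom}(u)}(u(u')\Rightarrow[\![\phi(u')]\!])$, $[\![(\exists x\in u)\phi]\!]=\bigvee_{u'\in\mathrm{dom}(u)}(u(u')\wedge[\![\phi(u')]\!])$. $\mathbf R(x)$ is the formula $x\subseteq\check{\mathbf Q}\wedge\exists y\in\check{\mathbf Q}(y\in x)\wedge\exists y\in\check{\mathbf Q}(y\notin x)\wedge\forall y\in\check{\mathbf Q}(y\in x\Leftrightarrow\forall z\in\check{\mathbf Q}(y<z\Rightarrow z\in x))$, where $x\subseteq y$ abbreviates $\forall z\in x(z\in y)$ and $<$ is the order of rationals (so $[\![\check r<\check s]\!]$ is $1$ if $r<s$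 and $0$ otherwise). $\mathbf R^{(\mathcal Q)}=\{u\in V^{(\mathcal Q)}:\mathrm{dom}(u)=\{\check r:r\in\mathbf Q\},\ [\![\mathbf R(u)]\!]=1\}$. *)

theory Defs
  imports
    "HOL-Analysis.Analysis"
    "HOL-Library.Complemented_Lattices"
    "HOL-Library.Countable_Set_Type"
    "HOL-Library.Multiset"
begin

unbundle lattice_syntax

section \<open>Complex Hilbert spaces\<close>

text \<open>The underlying real Hilbert space, whose inner product is the real part of the complex one,
  supplies norm, topology and completeness.  The complex inner product is linear in its first
  argument.\<close>

class complex_hilbert_space = real_inner + complete_space +
  fixes scaleC :: "complex \<Rightarrow> 'a \<Rightarrow> 'a"  (infixr "*\<^sub>C" 75)
    and cinner :: "'a \<Rightarrow> 'a \<Rightarrow> complex"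
  assumes scaleC_add_right: "a *\<^sub>C (x + y) = a *\<^sub>C x + a *\<^sub>C y"
    and scaleC_add_left: "(a + b) *\<^sub>C x = a *\<^sub>C x + b *\<^sub>C x"
    and scaleC_scaleC: "a *\<^sub>C (b *\<^sub>C x) = (a * b) *\<^sub>C x"
    and scaleC_of_real: "complex_of_real r *\<^sub>C x = r *\<^sub>R x"
    and cinner_commute: "cinner x y = cnj (cinner y x)"
    and cinner_add_left: "cinner (x + y) z = cinner x z + cinner y z"
    and cinner_scaleC_left: "cinner (a *\<^sub>C x) y = a * cinner x y"
    and inner_eq_Re_cinner: "inner x y = Re (cinner x y)"

instantiation complex :: complex_hilbert_space
begin
definition "scaleC_complex a (z :: complex) = a * z"
definition "cinner_complex z (w :: complex) = z * cnj w"
instance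
  by standard (auto simp: scaleC_complex_def cinner_complex_def algebra_simps scaleR_conv_of_real
      inner_complex_def)
end

definition csubspace :: "'a::complex_hilbert_space set \<Rightarrow> bool" where
  "csubspace M \<longleftrightarrow> 0 \<in> M \<and> (\<forall>x\<in>M. \<forall>y\<in>M. x + y \<in> M) \<and> (\<forall>c. \<forall>x\<in>M. c *\<^sub>C x \<in> M)"

definition bounded_clinear :: "('a::complex_hilbert_space \<Rightarrow> 'a) \<Rightarrow> bool" where
  "bounded_clinear T \<longleftrightarrow> bounded_linear T \<and> (\<forall>c x. T (c *\<^sub>C x) = c *\<^sub>C T x)"

definition cadjoint :: "('a::complex_hilbert_space \<Rightarrow> 'a) \<Rightarrow> ('a \<Rightarrow> 'a)" where
  "cadjoint T = (THE S. \<forall>x y. cinner (T x) y = cinner x (S y))"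

definition unitary :: "('a::complex_hilbert_space \<Rightarrow> 'a) \<Rightarrow> bool" where
  "unitary U \<longleftrightarrow> bounded_clinear U \<and> cadjoint U \<circ> U = id \<and> U \<circ> cadjoint U = id"

definition commutant :: "('a::complex_hilbert_space \<Rightarrow> 'a) set \<Rightarrow> ('a \<Rightarrow> 'a) set" where
  "commutant M = {T. bounded_clinear T \<and> (\<forall>S\<in>M. T \<circ> S = S \<circ> T)}"

lemma cinner_add_right: "cinner x (y + z) = cinner x y + cinner x z"
  by (metis cinner_add_left cinner_commute complex_cnj_add)

lemma cinner_scaleC_right: "cinner x (a *\<^sub>C y) = cnj a * cinner x y"
  by (metis cinner_scaleC_left cinner_commute complex_cnj_mult)

lemma scaleC_minus_one: "(-1) *\<^sub>C x = - (x::'a::complex_hilbert_space)"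
  using scaleC_of_real[of "-1" x] by simp

lemma cinner_minus_left: "cinner (- x) y = - cinner x y"
  by (metis cinner_scaleC_left mult_minus1 scaleC_minus_one)

lemma cinner_diff_left: "cinner (x - y) z = cinner x z - cinner y z"
  using cinner_add_left[of x "- y" z] by (simp add: cinner_minus_left)

lemma cinner_diff_right: "cinner x (y - z) = cinner x y - cinner x z"
  by (metis cinner_diff_left cinner_commute complex_cnj_diff)

lemma cinner_eq_zero: "(\<And>y. cinner x y = 0) \<Longrightarrow> x = 0"
  by (metis inner_eq_Re_cinner inner_eq_zero_iff zero_complex.simps(1))

lemma scaleC_diff_right: "a *\<^sub>C (x - y) = a *\<^sub>C x - a *\<^sub>C (y::'a::complex_hilbert_space)"
  by (metis add_diff_cancel_right' diff_add_cancel scaleC_add_right)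

lemma scaleC_zero_right: "a *\<^sub>C 0 = (0::'a::complex_hilbert_space)"
  using scaleC_diff_right[of a 0 0] by simp

lemma cinner_zero_left: "cinner 0 x = 0"
  using cinner_diff_left[of 0 0 x] by simp

lemma norm_scaleC: "norm (a *\<^sub>C x) = cmod a * norm (x::'a::complex_hilbert_space)"
proof -
  have "(norm (a *\<^sub>C x))\<^sup>2 = Re (a * cnj a * cinner x x)"
    by (simp add: power2_norm_eq_inner inner_eq_Re_cinner cinner_scaleC_left cinner_scaleC_right
        mult.assoc mult.left_commute)
  also have "\<dots> = (cmod a)\<^sup>2 * Re (cinner x x)"
    by (simp add: complex_mult_cnj cmod_power2 flip: of_real_power of_real_add)
  also have "\<dots> = (cmod a * norm x)\<^sup>2"
    by (simp add: power_mult_distrib power2_norm_eq_inner[of x] inner_eq_Re_cinner)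
  finally show ?thesis by (simp add: power2_eq_iff_nonneg)
qed

lemma csubspace_imp_subspace: "csubspace M \<Longrightarrow> subspace M"
  unfolding csubspace_def subspace_def by (metis scaleC_of_real)

lemma csubspace_diff: "csubspace M \<Longrightarrow> x \<in> M \<Longrightarrow> y \<in> M \<Longrightarrow> x - y \<in> M"
  using csubspace_imp_subspace subspace_diff by blast

lemma orthogonal_projection_exists:
  fixes M :: "'a::{real_inner,complete_space} set"
  assumes "closed M" "subspace M"
  shows "\<exists>y\<in>M. \<forall>z\<in>M. inner (x - y) z = 0"
proof -
  define D where "D = (INF z\<in>M. (norm (x - z))\<^sup>2)"
  have ne: "M \<noteq> {}" using assms(2) subspace_0 by blast
  have bdd: "bdd_below ((\<lambda>z. (norm (x - z))\<^sup>2) ` M)"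
    by (rule bdd_belowI[of _ 0]) auto
  have D_le: "D \<le> (norm (x - z))\<^sup>2" if "z \<in> M" for z
    unfolding D_def using bdd that by (rule cINF_lower)
  have "\<exists>z\<in>M. (norm (x - z))\<^sup>2 < D + 1 / real (Suc n)" for n
  proof -
    have "D < D + 1 / real (Suc n)" by simp
    then show ?thesis unfolding D_def using cINF_less_iff[OF ne bdd] by blast
  qed
  then obtain y where yM: "\<And>n. y n \<in> M"
    and yD: "\<And>n. (norm (x - y n))\<^sup>2 < D + 1 / real (Suc n)" by metis
  have par: "(norm (y m - y n))\<^sup>2 \<le> 2 / real (Suc m) + 2 / real (Suc n)" for m n
  proof -
    have "(1/2) *\<^sub>R (y m + y n) \<in> M"
      using assms(2) yM by (simp add: subspace_add subspace_scale)
    from D_le[OF this] have "4 * D \<le> 4 * (norm (x - (1/2) *\<^sub>R (y m + y n)))\<^sup>2" by simp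
    also have "\<dots> = 2 * (norm (x - y m))\<^sup>2 + 2 * (norm (x - y n))\<^sup>2 - (norm (y m - y n))\<^sup>2"
      by (simp add: power2_norm_eq_inner inner_simps inner_commute algebra_simps)
    finally show ?thesis using yD[of m] yD[of n] by (simp add: algebra_simps)
  qed
  have "Cauchy y"
  proof (rule CauchyI)
    fix e :: real assume "0 < e"
    then obtain N where N: "1 / real (Suc N) < e\<^sup>2 / 4"
      using nat_approx_posE[of "e\<^sup>2 / 4"] by (metis divide_pos_pos zero_less_numeral zero_less_power)
    show "\<exists>N. \<forall>m\<ge>N. \<forall>n\<ge>N. norm (y m - y n) < e"
    proof (intro exI allI impI)
      fix m n assume "N \<le> m" "N \<le> n"
      then have "1 / real (Suc m) \<le> 1 / real (Suc N)" "1 / real (Suc n) \<le> 1 / real (Suc N)"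
        by (auto simp: divide_simps)
      with N par[of m n] have "(norm (y m - y n))\<^sup>2 < e\<^sup>2" by simp
      then show "norm (y m - y n) < e" using \<open>0 < e\<close> by (simp add: power2_less_imp_less)
    qed
  qed
  then obtain l where l: "y \<longlonglongrightarrow> l" using Cauchy_convergent convergent_def by blast
  have lM: "l \<in> M" using assms(1) yM l closed_sequentially by blast
  have "(\<lambda>n. (norm (x - y n))\<^sup>2) \<longlonglongrightarrow> (norm (x - l))\<^sup>2"
    by (intro tendsto_intros l)
  moreover have "(\<lambda>n. D + 1 / real (Suc n)) \<longlonglongrightarrow> D + 0"
    by (intro tendsto_intros LIMSEQ_Suc lim_1_over_n)
  ultimately have le: "(norm (x - l))\<^sup>2 \<le> D"
    using yD by (intro LIMSEQ_le[where Y = "\<lambda>n. D + 1 / real (Suc n)"]) (auto intro: less_imp_le)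
  show ?thesis
  proof (intro bexI[OF _ lM] ballI)
    fix z assume z: "z \<in> M"
    show "inner (x - l) z = 0"
    proof (rule ccontr)
      assume nz: "inner (x - l) z \<noteq> 0"
      then have zz: "inner z z > 0" by auto
      define t where "t = inner (x - l) z / inner z z"
      have "l + t *\<^sub>R z \<in> M" using assms(2) lM z by (simp add: subspace_add subspace_scale)
      from order_trans[OF le D_le[OF this]]
      have "inner (x - l) (x - l) \<le> inner (x - l - t *\<^sub>R z) (x - l - t *\<^sub>R z)"
        by (simp add: power2_norm_eq_inner algebra_simps)
      also have "\<dots> = inner (x - l) (x - l) - 2 * t * inner (x - l) z + t * t * inner z z"
        by (simp add: inner_diff_left[of "x-l"] inner_diff_right[of _ "x-l"] inner_commute
            algebra_simps)
      also have "\<dots> = inner (x - l) (x - l) - (inner (x - l) z)\<^sup>2 / inner z z"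
        using zz by (simp add: t_def power2_eq_square field_simps)
      finally have "(inner (x - l) z)\<^sup>2 / inner z z \<le> 0" by simp
      moreover have "(inner (x - l) z)\<^sup>2 / inner z z > 0" using nz zz by simp
      ultimately show False by simp
    qed
  qed
qed

section \<open>The lattice of orthogonal projections\<close>

definition is_projection :: "('a::complex_hilbert_space \<Rightarrow> 'a) \<Rightarrow> bool" where
  "is_projection P \<longleftrightarrow>
     bounded_clinear P \<and> P \<circ> P = P \<and> (\<forall>x y. cinner (P x) y = cinner x (P y))"

lemma is_projection_id: "is_projection (\<lambda>x. x)"
  by (auto simp: is_projection_def bounded_clinear_def bounded_linear_ident)

typedef (overloaded) 'a proj = "{P :: 'a::complex_hilbert_space \<Rightarrow> 'a. is_projection P}"
  morphisms proj_apply Abs_proj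
  using is_projection_id by auto

abbreviation proj_range :: "'a::complex_hilbert_space proj \<Rightarrow> 'a set" where
  "proj_range P \<equiv> range (proj_apply P)"

definition proj_onto :: "'a::complex_hilbert_space set \<Rightarrow> 'a proj" where
  "proj_onto M = (THE P. proj_range P = M)"

context
  fixes P :: "'a::complex_hilbert_space proj"
begin

lemma is_projection_proj: "is_projection (proj_apply P)"
  using proj_apply by blast

lemma proj_bounded_linear: "bounded_linear (proj_apply P)"
  using is_projection_proj by (simp add: is_projection_def bounded_clinear_def)

lemma proj_scaleC: "proj_apply P (c *\<^sub>C x) = c *\<^sub>C proj_apply P x"
  using is_projection_proj by (simp add: is_projection_def bounded_clinear_def)

lemma proj_idem: "proj_apply P (proj_apply P x) = proj_apply P x"
  using is_projection_proj by (simp add: is_projection_def fun_eq_iff)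

lemma proj_cinner: "cinner (proj_apply P x) y = cinner x (proj_apply P y)"
  using is_projection_proj by (simp add: is_projection_def)

lemmas proj_linear = bounded_linear.linear[OF proj_bounded_linear]

lemma proj_range_iff: "x \<in> proj_range P \<longleftrightarrow> proj_apply P x = x"
  by (metis proj_idem rangeE rangeI)

lemma csubspace_proj_range: "csubspace (proj_range P)"
  unfolding csubspace_def proj_range_iff
  by (auto simp: linear_0[OF proj_linear] linear_add[OF proj_linear] proj_scaleC proj_idem)

lemma closed_proj_range: "closed (proj_range P)"
proof -
  have "proj_range P = {x. proj_apply P x = x}" using proj_range_iff by blast
  moreover have "closed \<dots>"
    by (intro closed_Collect_eq continuous_intros bounded_linear.continuous_on[OF proj_bounded_linear])
  ultimately show ?thesis by simp
qed

end

lemma proj_range_inject: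
  assumes "proj_range P = proj_range R"
  shows "P = R"
proof -
  have "proj_apply P x = proj_apply R x" for x
  proof -
    have 1: "proj_apply P (proj_apply R y) = proj_apply R y" for y
      using assms proj_range_iff by blast
    have 2: "proj_apply R (proj_apply P y) = proj_apply P y" for y
      using assms proj_range_iff by blast
    have "cinner (proj_apply P x - proj_apply R x) y = 0" for y
    proof -
      have "cinner (proj_apply P x) y = cinner (proj_apply R (proj_apply P x)) y" using 2 by simp
      also have "\<dots> = cinner x (proj_apply P (proj_apply R y))" by (simp only: proj_cinner)
      also have "\<dots> = cinner (proj_apply R x) y" using 1 by (simp add: proj_cinner)
      finally show ?thesis by (simp add: cinner_diff_left)
    qed
    then show ?thesis using cinner_eq_zero by (metis eq_iff_diff_eq_0)
  qed
  then show ?thesis by (metis proj_apply_inject ext)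
qed

lemma proj_exists:
  assumes M: "closed M" "csubspace (M :: 'a::complex_hilbert_space set)"
  shows "\<exists>P. proj_range P = M"
proof -
  have "\<exists>y\<in>M. \<forall>z\<in>M. inner (x - y) z = 0" for x
    using orthogonal_projection_exists csubspace_imp_subspace M by blast
  then obtain p where pM: "\<And>x. p x \<in> M" and "\<And>x z. z \<in> M \<Longrightarrow> inner (x - p x) z = 0"
    by metis
  note Re0 = this(2)
  have po: "cinner (x - p x) z = 0" if "z \<in> M" for x z
  proof (rule complex_eqI)
    show "Re (cinner (x - p x) z) = Re 0" using Re0[OF that] inner_eq_Re_cinner by (metis zero_complex.simps(1))
    have "\<i> *\<^sub>C z \<in> M" using M(2) that by (simp add: csubspace_def)
    from Re0[OF this, of x] show "Im (cinner (x - p x) z) = Im 0"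
      by (simp add: inner_eq_Re_cinner cinner_scaleC_right)
  qed
  have uniq: "p x = y" if "y \<in> M" "\<And>z. z \<in> M \<Longrightarrow> cinner (x - y) z = 0" for x y
  proof -
    have "p x - y \<in> M" using pM that(1) csubspace_diff[OF M(2)] by blast
    then have "cinner (x - y) (p x - y) - cinner (x - p x) (p x - y) = 0" using that(2) po by simp
    then have "cinner (p x - y) (p x - y) = 0" by (simp flip: cinner_diff_left)
    then show ?thesis using inner_eq_Re_cinner
      by (metis eq_iff_diff_eq_0 inner_eq_zero_iff zero_complex.simps(1))
  qed
  have add: "p (x + y) = p x + p y" for x y
  proof (rule uniq)
    show "p x + p y \<in> M" using pM M(2) by (simp add: csubspace_def)
    show "cinner (x + y - (p x + p y)) z = 0" if "z \<in> M" for z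
      using po[OF that, of x] po[OF that, of y] by (simp add: cinner_diff_left cinner_add_left)
  qed
  have scale: "p (c *\<^sub>C x) = c *\<^sub>C p x" for c x
  proof (rule uniq)
    show "c *\<^sub>C p x \<in> M" using pM M(2) by (simp add: csubspace_def)
    show "cinner (c *\<^sub>C x - c *\<^sub>C p x) z = 0" if "z \<in> M" for z
      using po[OF that, of x] by (simp flip: scaleC_diff_right add: cinner_scaleC_left)
  qed
  have fixM: "p x = x" if "x \<in> M" for x
    using that by (intro uniq) (auto simp: cinner_zero_left)
  have "bounded_linear p"
  proof (rule bounded_linear_intro[where K = 1])
    show "p (r *\<^sub>R x) = r *\<^sub>R p x" for r x using scale by (metis scaleC_of_real)
    show "norm (p x) \<le> norm x * 1" for x
    proof -
      have "(norm (p x))\<^sup>2 = inner x (p x)"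
        using Re0[OF pM, of x x] by (simp add: power2_norm_eq_inner inner_diff_left)
      also have "\<dots> \<le> norm x * norm (p x)" by (rule norm_cauchy_schwarz)
      finally show ?thesis by (cases "norm (p x) = 0") (auto simp: power2_eq_square)
    qed
  qed (rule add)
  moreover have "cinner (p x) y = cinner x (p y)" for x y
  proof -
    have "cinner x (p y) = cinner (p x) (p y)"
      using po[OF pM, of x y] by (simp add: cinner_diff_left)
    moreover have "cinner y (p x) = cinner (p y) (p x)"
      using po[OF pM, of y x] by (simp add: cinner_diff_left)
    ultimately show ?thesis by (metis cinner_commute)
  qed
  ultimately have "is_projection p"
    using scale fixM pM by (auto simp: is_projection_def bounded_clinear_def)
  moreover have "range p = M" using fixM pM by (metis rangeI subsetI subset_antisym image_subset_iff)
  ultimately show ?thesis by (metis Abs_proj_inverse mem_Collect_eq)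
qed

lemma proj_range_proj_onto:
  assumes "closed M" "csubspace M"
  shows "proj_range (proj_onto M) = M"
  unfolding proj_onto_def
  by (rule theI') (use proj_exists[OF assms] proj_range_inject in metis)

lemma csubspace_Inter: "(\<And>M. M \<in> \<M> \<Longrightarrow> csubspace M) \<Longrightarrow> csubspace (\<Inter>\<M>)"
  by (auto simp: csubspace_def)

lemma subspace_closure:
  assumes "subspace (S :: 'a::real_normed_vector set)"
  shows "subspace (closure S)"
  unfolding subspace_def
proof (intro conjI ballI allI)
  show "0 \<in> closure S" using assms subspace_0 closure_subset by blast
next
  fix x y assume "x \<in> closure S" "y \<in> closure S"
  then obtain f g where "\<And>n. f n \<in> S" "f \<longlonglongrightarrow> x" "\<And>n. g n \<in> S" "g \<longlonglongrightarrow> y"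
    unfolding closure_sequential by blast
  then have "(\<lambda>n. f n + g n) \<longlonglongrightarrow> x + y" "\<And>n. f n + g n \<in> S"
    using assms by (auto intro: tendsto_add subspace_add)
  then show "x + y \<in> closure S"
    unfolding closure_sequential by (intro exI[of _ "\<lambda>n. f n + g n"]) simp
next
  fix c x assume "x \<in> closure S"
  then obtain f where "\<And>n. f n \<in> S" "f \<longlonglongrightarrow> x"
    unfolding closure_sequential by blast
  then have "(\<lambda>n. c *\<^sub>R f n) \<longlonglongrightarrow> c *\<^sub>R x" "\<And>n. c *\<^sub>R f n \<in> S"
    using assms by (auto intro: tendsto_scaleR subspace_scale)
  then show "c *\<^sub>R x \<in> closure S"
    unfolding closure_sequential by (intro exI[of _ "\<lambda>n. c *\<^sub>R f n"]) simp
qed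

lemma csubspace_closure_span:
  assumes "\<And>M. M \<in> \<M> \<Longrightarrow> csubspace M"
  shows "csubspace (closure (span (\<Union>\<M>)))"
proof -
  have sub: "subspace (closure (span (\<Union>\<M>)))" by (intro subspace_closure subspace_span)
  have lin: "linear ((*\<^sub>C) c :: 'a \<Rightarrow> 'a)" for c
    by (rule linearI)
      (auto simp: scaleC_add_right scaleC_scaleC mult.commute simp flip: scaleC_of_real)
  have bl: "bounded_linear ((*\<^sub>C) c :: 'a \<Rightarrow> 'a)" for c
    by (rule bounded_linear_intro[where K = "cmod c"])
      (auto simp: linear_add[OF lin] linear_scale[OF lin] norm_scaleC)
  have "c *\<^sub>C x \<in> closure (span (\<Union>\<M>))" if "x \<in> closure (span (\<Union>\<M>))" for c x
  proof -
    have "(*\<^sub>C) c ` span (\<Union>\<M>) = span ((*\<^sub>C) c ` \<Union>\<M>)"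
      using linear_span_image[OF lin] by simp
    also have "\<dots> \<subseteq> span (\<Union>\<M>)"
      by (rule span_mono) (use assms in \<open>auto simp: csubspace_def\<close>)
    finally have "(*\<^sub>C) c ` closure (span (\<Union>\<M>)) \<subseteq> closure (span (\<Union>\<M>))"
      by (intro image_closure_subset bounded_linear.continuous_on[OF bl] continuous_on_id)
        (use closure_subset in auto)
    with that show ?thesis by blast
  qed
  with sub show ?thesis by (auto simp: csubspace_def subspace_def)
qed

lemma is_projection_compl: "is_projection (\<lambda>x. x - proj_apply P x)"
  unfolding is_projection_def bounded_clinear_def
  by (auto intro!: bounded_linear_sub bounded_linear_ident proj_bounded_linear
      simp: proj_scaleC scaleC_diff_right fun_eq_iff linear_diff[OF proj_linear] proj_idem
        cinner_diff_left cinner_diff_right proj_cinner)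

text \<open>The ranges are complex subspaces, hence so is the real linear span of their union, which
  therefore is also its complex linear span.\<close>

instantiation proj :: (complex_hilbert_space) complete_orthomodular_lattice
begin

definition less_eq_proj :: "'a proj \<Rightarrow> 'a proj \<Rightarrow> bool" where
  "P \<le> R \<longleftrightarrow> proj_range P \<subseteq> proj_range R"
definition less_proj :: "'a proj \<Rightarrow> 'a proj \<Rightarrow> bool" where
  "(P::'a proj) < R \<longleftrightarrow> P \<le> R \<and> \<not> R \<le> P"
definition inf_proj :: "'a proj \<Rightarrow> 'a proj \<Rightarrow> 'a proj" where
  "P \<sqinter> R = proj_onto (proj_range P \<inter> proj_range R)"
definition sup_proj :: "'a proj \<Rightarrow> 'a proj \<Rightarrow> 'a proj" where
  "P \<squnion> R = proj_onto (closure (span (proj_range P \<union> proj_range R)))"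
definition Inf_proj :: "'a proj set \<Rightarrow> 'a proj" where
  "\<Sqinter>F = proj_onto (\<Inter>P\<in>F. proj_range P)"
definition Sup_proj :: "'a proj set \<Rightarrow> 'a proj" where
  "\<Squnion>F = proj_onto (closure (span (\<Union>P\<in>F. proj_range P)))"
definition top_proj :: "'a proj" where
  "\<top> = Abs_proj (\<lambda>x. x)"
definition bot_proj :: "'a proj" where
  "\<bottom> = proj_onto {0}"
definition uminus_proj :: "'a proj \<Rightarrow> 'a proj" where
  "- P = Abs_proj (\<lambda>x. x - proj_apply P x)"
definition minus_proj :: "'a proj \<Rightarrow> 'a proj \<Rightarrow> 'a proj" where
  "(P::'a proj) - R = P \<sqinter> - R"

lemma apply_uminus: "proj_apply (- P) x = x - proj_apply P x"
  unfolding uminus_proj_def using is_projection_compl by (metis Abs_proj_inverse mem_Collect_eq)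

lemma range_uminus: "proj_range (- P) = {x. proj_apply P x = 0}"
  using proj_range_iff[of _ "- P"] by (auto simp: apply_uminus)

lemma range_Inf: "proj_range (\<Sqinter>F) = (\<Inter>P\<in>F. proj_range P)"
  unfolding Inf_proj_def
  by (intro proj_range_proj_onto closed_INT ballI closed_proj_range csubspace_Inter)
    (auto simp: csubspace_proj_range)

lemma range_Sup: "proj_range (\<Squnion>F) = closure (span (\<Union>P\<in>F. proj_range P))"
  unfolding Sup_proj_def
  by (intro proj_range_proj_onto closed_closure csubspace_closure_span)
    (auto simp: csubspace_proj_range)

lemma range_inf: "proj_range (P \<sqinter> R) = proj_range P \<inter> proj_range R"
proof -
  have "P \<sqinter> R = \<Sqinter>{P, R}" by (simp add: inf_proj_def Inf_proj_def)
  then show ?thesis by (simp add: range_Inf)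
qed

lemma range_sup: "proj_range (P \<squnion> R) = closure (span (proj_range P \<union> proj_range R))"
proof -
  have "P \<squnion> R = \<Squnion>{P, R}" by (simp add: sup_proj_def Sup_proj_def)
  then show ?thesis by (simp add: range_Sup)
qed

lemma range_top: "proj_range (\<top> :: 'a proj) = UNIV"
  unfolding top_proj_def by (simp add: Abs_proj_inverse is_projection_id)

lemma range_bot: "proj_range (\<bottom> :: 'a proj) = {0}"
  unfolding bot_proj_def
  by (rule proj_range_proj_onto) (auto simp: csubspace_def scaleC_zero_right)

lemma closure_span_least:
  "S \<subseteq> proj_range P \<Longrightarrow> closure (span S) \<subseteq> proj_range (P :: 'a proj)"
  by (intro closure_minimal span_minimal closed_proj_range csubspace_imp_subspace
      csubspace_proj_range)

lemma closure_span_superset: "S \<subseteq> closure (span (S :: 'a set))"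
  using closure_subset span_superset by blast

instance
proof
  fix P R S :: "'a proj" and F :: "'a proj set"
  show "(P < R) = (P \<le> R \<and> \<not> R \<le> P)" by (rule less_proj_def)
  show "P \<le> P" by (simp add: less_eq_proj_def)
  show "P \<le> R \<Longrightarrow> R \<le> S \<Longrightarrow> P \<le> S" by (auto simp: less_eq_proj_def)
  show "P \<le> R \<Longrightarrow> R \<le> P \<Longrightarrow> P = R"
    using proj_range_inject unfolding less_eq_proj_def by blast
  show "P \<sqinter> R \<le> P" "P \<sqinter> R \<le> R" by (auto simp: less_eq_proj_def range_inf)
  show "P \<le> R \<Longrightarrow> P \<le> S \<Longrightarrow> P \<le> R \<sqinter> S" by (auto simp: less_eq_proj_def range_inf)
  show "P \<le> P \<squnion> R" "R \<le> P \<squnion> R"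
    using closure_span_superset[of "proj_range P \<union> proj_range R"]
    by (auto simp: less_eq_proj_def range_sup)
  show "R \<le> P \<Longrightarrow> S \<le> P \<Longrightarrow> R \<squnion> S \<le> P"
    unfolding less_eq_proj_def range_sup by (intro closure_span_least) auto
  show "P \<in> F \<Longrightarrow> \<Sqinter>F \<le> P" by (auto simp: less_eq_proj_def range_Inf)
  show "(\<And>P. P \<in> F \<Longrightarrow> R \<le> P) \<Longrightarrow> R \<le> \<Sqinter>F" by (force simp: less_eq_proj_def range_Inf)
  show "P \<in> F \<Longrightarrow> P \<le> \<Squnion>F"
    using closure_span_superset[of "\<Union>P\<in>F. proj_range P"]
    unfolding less_eq_proj_def range_Sup by blast
  show "(\<And>P. P \<in> F \<Longrightarrow> P \<le> R) \<Longrightarrow> \<Squnion>F \<le> R"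
    unfolding less_eq_proj_def range_Sup by (intro closure_span_least) blast
  show "\<Sqinter>{} = (\<top> :: 'a proj)" by (rule proj_range_inject) (simp add: range_Inf range_top)
  show "\<Squnion>{} = (\<bottom> :: 'a proj)" by (rule proj_range_inject) (simp add: range_Sup range_bot)
  show "\<bottom> \<le> P"
    using csubspace_proj_range[of P] by (simp add: less_eq_proj_def range_bot csubspace_def)
  show "P \<le> \<top>" by (simp add: less_eq_proj_def range_top)
  show "P \<sqinter> - P = \<bottom>"
  proof (rule proj_range_inject)
    show "proj_range (P \<sqinter> - P) = proj_range (\<bottom> :: 'a proj)"
      unfolding range_inf range_uminus range_bot
      by (auto simp: proj_range_iff proj_idem linear_0[OF proj_linear])
  qed
  show "P \<squnion> - P = \<top>"
  proof (rule proj_range_inject)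
    have "x \<in> proj_range (P \<squnion> - P)" for x
    proof -
      have "proj_apply P x + proj_apply (- P) x \<in> span (proj_range P \<union> proj_range (- P))"
        by (intro span_add span_base) auto
      then show ?thesis unfolding range_sup using closure_subset by (auto simp: apply_uminus)
    qed
    then show "proj_range (P \<squnion> - P) = proj_range (\<top> :: 'a proj)" by (auto simp: range_top)
  qed
  show "P - R = P \<sqinter> - R" by (rule minus_proj_def)
  show "- (- P) = P"
    by (rule proj_range_inject) (auto simp: range_uminus apply_uminus proj_range_iff)
  show "- R \<le> - P" if "P \<le> R"
  proof -
    have "proj_apply P x = 0" if x: "proj_apply R x = 0" for x
    proof -
      have "proj_apply R (proj_apply P x) = proj_apply P x"
        using \<open>P \<le> R\<close> by (metis less_eq_proj_def proj_range_iff rangeI subsetD)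
      then have "cinner (proj_apply P x) (proj_apply P x) = cinner (proj_apply R x) (proj_apply P x)"
        by (metis proj_cinner proj_idem)
      also have "\<dots> = 0"
        using x by (metis cinner_diff_left diff_self)
      finally show ?thesis using inner_eq_Re_cinner by (metis inner_eq_zero_iff zero_complex.simps(1))
    qed
    then show ?thesis by (auto simp: less_eq_proj_def range_uminus)
  qed
  show "P \<squnion> - P \<sqinter> R = R" if "P \<le> R"
  proof (rule proj_range_inject, rule subset_antisym)
    show "proj_range (P \<squnion> - P \<sqinter> R) \<subseteq> proj_range R"
      using that unfolding range_sup less_eq_proj_def by (intro closure_span_least) (auto simp: range_inf)
    show "proj_range R \<subseteq> proj_range (P \<squnion> - P \<sqinter> R)"
    proof
      fix x assume x: "x \<in> proj_range R"
      have "proj_apply P x \<in> proj_range R" using that by (auto simp: less_eq_proj_def)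
      with x have "x - proj_apply P x \<in> proj_range R"
        using csubspace_diff csubspace_proj_range by blast
      then have "x - proj_apply P x \<in> proj_range (- P \<sqinter> R)"
        by (simp add: range_inf range_uminus linear_diff[OF proj_linear] proj_idem)
      then have "proj_apply P x + (x - proj_apply P x) \<in> span (proj_range P \<union> proj_range (- P \<sqinter> R))"
        by (intro span_add span_base) auto
      then show "x \<in> proj_range (P \<squnion> - P \<sqinter> R)" unfolding range_sup using closure_subset by auto
    qed
  qed
qed

end

section \<open>Logics and affiliated operators\<close>

definition proj_commutant :: "'a::complex_hilbert_space proj set \<Rightarrow> 'a proj set"  ("_\<^sup>!" [1000] 1000) where
  "F\<^sup>! = {P. \<forall>R\<in>F. proj_apply P \<circ> proj_apply R = proj_apply R \<circ> proj_apply P}"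

definition logic :: "'a::complex_hilbert_space proj set \<Rightarrow> bool" where
  "logic Q \<longleftrightarrow> Q = Q\<^sup>!\<^sup>!"

definition vN_algebra :: "'a::complex_hilbert_space proj set \<Rightarrow> ('a \<Rightarrow> 'a) set" where
  "vN_algebra Q = commutant (commutant (proj_apply ` Q))"

text \<open>A possibly unbounded operator is a partial function; its domain is \<^const>\<open>dom\<close>.\<close>

definition linear_operator :: "('a::complex_hilbert_space \<rightharpoonup> 'a) \<Rightarrow> bool" where
  "linear_operator A \<longleftrightarrow> csubspace (dom A) \<and>
     (\<forall>x\<in>dom A. \<forall>y\<in>dom A. the (A (x + y)) = the (A x) + the (A y)) \<and>
     (\<forall>c. \<forall>x\<in>dom A. the (A (c *\<^sub>C x)) = c *\<^sub>C the (A x))"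

definition densely_defined :: "('a::complex_hilbert_space \<rightharpoonup> 'a) \<Rightarrow> bool" where
  "densely_defined A \<longleftrightarrow> closure (dom A) = UNIV"

definition closed_operator :: "('a::complex_hilbert_space \<rightharpoonup> 'a) \<Rightarrow> bool" where
  "closed_operator A \<longleftrightarrow> closed (Map.graph A)"

definition operator_adjoint :: "('a::complex_hilbert_space \<rightharpoonup> 'a) \<Rightarrow> ('a \<rightharpoonup> 'a)" where
  "operator_adjoint A y =
     (if \<exists>z. \<forall>x\<in>dom A. cinner (the (A x)) y = cinner x z
      then Some (THE z. \<forall>x\<in>dom A. cinner (the (A x)) y = cinner x z)
      else None)"

definition self_adjoint :: "('a::complex_hilbert_space \<rightharpoonup> 'a) \<Rightarrow> bool" where
  "self_adjoint A \<longleftrightarrow> linear_operator A \<and> densely_defined A \<and> operator_adjoint A = A"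

text \<open>The partial function \<open>\<lambda>x. map_option (cadjoint U) (A (U x))\<close> is \<open>U* A U\<close>.\<close>

definition affiliated :: "('a::complex_hilbert_space \<rightharpoonup> 'a) \<Rightarrow> ('a \<Rightarrow> 'a) set \<Rightarrow> bool" where
  "affiliated A M \<longleftrightarrow> linear_operator A \<and> densely_defined A \<and> closed_operator A \<and>
     (\<forall>U. U \<in> commutant M \<and> unitary U \<longrightarrow> (\<lambda>x. map_option (cadjoint U) (A (U x))) = A)"

definition spectral_family :: "(real \<Rightarrow> 'a::complex_hilbert_space proj) \<Rightarrow> bool" where
  "spectral_family E \<longleftrightarrow> mono E \<and> (\<forall>t. E t = (\<Sqinter>s\<in>{t<..}. E s)) \<and>
     (\<Sqinter>t. E t) = \<bottom> \<and> (\<Squnion>t. E t) = \<top>"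

text \<open>The Lebesgue--Stieltjes measure of \<open>t \<mapsto> \<parallel>E(t)x\<parallel>\<^sup>2 = \<langle>E(t)x, x\<rangle>\<close>.\<close>

definition spectral_measure ::
    "(real \<Rightarrow> 'a::complex_hilbert_space proj) \<Rightarrow> 'a \<Rightarrow> real measure" where
  "spectral_measure E x = interval_measure (\<lambda>t. (norm (proj_apply (E t) x))\<^sup>2)"

text \<open>\<open>A = \<integral> t dE(t)\<close>: the domain consists of the \<open>x\<close> with \<open>\<integral> t\<^sup>2 d\<langle>E(t)x, x\<rangle> < \<infinity>\<close>, and
  \<open>\<langle>A x, x\<rangle> = \<integral> t d\<langle>E(t)x, x\<rangle>\<close> there, which by polarization determines \<open>\<langle>A x, y\<rangle>\<close>.\<close>

definition resolution_of_identity ::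
    "('a::complex_hilbert_space \<rightharpoonup> 'a) \<Rightarrow> (real \<Rightarrow> 'a proj) \<Rightarrow> bool" where
  "resolution_of_identity A E \<longleftrightarrow> spectral_family E \<and>
     dom A = {x. integrable (spectral_measure E x) (\<lambda>t. t\<^sup>2)} \<and>
     (\<forall>x\<in>dom A. cinner (the (A x)) x = complex_of_real (LINT t|spectral_measure E x. t))"

text \<open>By the spectral theorem a self-adjoint operator has exactly one resolution of the identity.\<close>

definition spectral_projection ::
    "('a::complex_hilbert_space \<rightharpoonup> 'a) \<Rightarrow> real \<Rightarrow> 'a proj" where
  "spectral_projection A = (THE E. resolution_of_identity A E)"

definition affiliated_self_adjoint ::
    "'a::complex_hilbert_space proj set \<Rightarrow> ('a \<rightharpoonup> 'a) set" where
  "affiliated_self_adjoint Q = {A. self_adjoint A \<and> affiliated A (vN_algebra Q)}"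

section \<open>The lattice-valued universe\<close>

text \<open>Sets and names are taken hereditarily countable.  This loses nothing for the real numbers
  below: their domain is the countable set of the \<open>\<check>r\<close>, and the truth values of names only
  depend on the elements of their transitive closures.\<close>

datatype hset = HSet "hset cset"

datatype 'q name = Name (name_graph: "('q name \<times> 'q) cset")

definition name_dom :: "'q name \<Rightarrow> 'q name set" where
  "name_dom u = fst ` rcset (name_graph u)"

definition name_app :: "'q name \<Rightarrow> 'q name \<Rightarrow> 'q" where
  "name_app u x = (THE p. (x, p) \<in> rcset (name_graph u))"

text \<open>The union of the stages is the least class closed under forming functions into \<open>Q\<close>.\<close>

inductive_set name_universe :: "'q set \<Rightarrow> 'q name set" for Q where
  "single_valued (rcset (name_graph u)) \<Longrightarrow> snd ` rcset (name_graph u) \<subseteq> Q \<Longrightarrow>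
   (\<And>x. x \<in> name_dom u \<Longrightarrow> x \<in> name_universe Q) \<Longrightarrow> u \<in> name_universe Q"

primrec check :: "hset \<Rightarrow> 'q::top name" where
  "check (HSet X) = Name (cimage (\<lambda>w. (w, \<top>)) (cimage check X))"

definition sasaki :: "'q \<Rightarrow> 'q \<Rightarrow> 'q::complete_orthomodular_lattice"  (infixr "\<leadsto>" 60) where
  "p \<leadsto> q = - p \<squnion> (p \<sqinter> q)"

definition sasaki_iff :: "'q \<Rightarrow> 'q \<Rightarrow> 'q::complete_orthomodular_lattice" where
  "sasaki_iff p q = (p \<leadsto> q) \<sqinter> (q \<leadsto> p)"

lemma wf_name_dom: "wf {(x, u :: 'q name). x \<in> name_dom u}"
proof (rule wfUNIVI)
  fix P :: "'q name \<Rightarrow> bool" and u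
  assume "\<forall>u. (\<forall>x. (x, u) \<in> {(x, u). x \<in> name_dom u} \<longrightarrow> P x) \<longrightarrow> P u"
  then have step: "\<And>u. (\<And>x. x \<in> name_dom u \<Longrightarrow> P x) \<Longrightarrow> P u" by blast
  show "P u"
  proof (induction u)
    case (Name G)
    show ?case
    proof (rule step)
      fix x assume "x \<in> name_dom (Name G)"
      then obtain p where "(x, p) \<in> rcset G" by (auto simp: name_dom_def)
      then show "P x" using Name.IH by (fastforce simp: cin.rep_eq)
    qed
  qed
qed

function eq_val mem_val :: "'q name \<Rightarrow> 'q name \<Rightarrow> 'q::complete_orthomodular_lattice" where
  "eq_val u v =
     (\<Sqinter>u'\<in>name_dom u. name_app u u' \<leadsto> mem_val u' v) \<sqinter>
     (\<Sqinter>v'\<in>name_dom v. name_app v v' \<leadsto> mem_val v' u)"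
| "mem_val u v = (\<Squnion>v'\<in>name_dom v. name_app v v' \<sqinter> eq_val u v')"
  by pat_completeness auto
termination
proof -
  let ?m = "\<lambda>(u, v). {#u, v#} :: 'q name multiset"
  let ?r = "{(x, u :: 'q name). x \<in> name_dom u}"
  have dec: "({#x, v#}, {#u, v#}) \<in> mult ?r" if "x \<in> name_dom u" for x u v
    using one_step_implies_mult[of "{#u#}" "{#x#}" ?r "{#v#}"] that by (simp add: add_mset_commute)
  have perm: "({#v, x#}, {#u, v#}) \<in> mult ?r" "({#v, x#}, {#v, u#}) \<in> mult ?r"
      "({#x, v#}, {#v, u#}) \<in> mult ?r"
    if "x \<in> name_dom u" for x u v
    using dec[OF that, of v] by (simp_all add: add_mset_commute)
  show ?thesis
    by (relation "inv_image (mult ?r) (case_sum ?m ?m)")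
      (auto intro!: wf_mult wf_name_dom dec perm)
qed

declare eq_val.simps [simp del] mem_val.simps [simp del]

text \<open>Truth values of formulas are given by a shallow embedding: a formula with a free variable
  is the function from names to its truth values.\<close>

definition forall_in :: "'q name \<Rightarrow> ('q name \<Rightarrow> 'q) \<Rightarrow> 'q::complete_orthomodular_lattice" where
  "forall_in u \<phi> = (\<Sqinter>u'\<in>name_dom u. name_app u u' \<leadsto> \<phi> u')"

definition exists_in :: "'q name \<Rightarrow> ('q name \<Rightarrow> 'q) \<Rightarrow> 'q::complete_orthomodular_lattice" where
  "exists_in u \<phi> = (\<Squnion>u'\<in>name_dom u. name_app u u' \<sqinter> \<phi> u')"

definition subset_val :: "'q name \<Rightarrow> 'q name \<Rightarrow> 'q::complete_orthomodular_lattice" where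
  "subset_val x y = forall_in x (\<lambda>z. mem_val z y)"

text \<open>The parameter \<open>\<iota>\<close> is the encoding of rational numbers as sets; nothing but its injectivity
  is ever assumed.\<close>

definition rationals :: "(rat \<Rightarrow> hset) \<Rightarrow> hset" where
  "rationals \<iota> = HSet (acset (range \<iota>))"

definition less_val ::
    "(rat \<Rightarrow> hset) \<Rightarrow> 'q name \<Rightarrow> 'q name \<Rightarrow> 'q::complete_orthomodular_lattice" where
  "less_val \<iota> y z = (if \<exists>r s. y = check (\<iota> r) \<and> z = check (\<iota> s) \<and> r < s then \<top> else \<bottom>)"

definition real_val :: "(rat \<Rightarrow> hset) \<Rightarrow> 'q name \<Rightarrow> 'q::complete_orthomodular_lattice" where
  "real_val \<iota> x = (let RAT = check (rationals \<iota>) in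
     subset_val x RAT \<sqinter>
     exists_in RAT (\<lambda>y. mem_val y x) \<sqinter>
     exists_in RAT (\<lambda>y. - mem_val y x) \<sqinter>
     forall_in RAT (\<lambda>y. sasaki_iff (mem_val y x)
       (forall_in RAT (\<lambda>z. less_val \<iota> y z \<leadsto> mem_val z x))))"

definition real_names :: "(rat \<Rightarrow> hset) \<Rightarrow> 'q set \<Rightarrow> 'q::complete_orthomodular_lattice name set" where
  "real_names \<iota> Q =
     {u \<in> name_universe Q. name_dom u = (\<lambda>r. check (\<iota> r)) ` UNIV \<and> real_val \<iota> u = \<top>}"

definition corresponds ::
    "(rat \<Rightarrow> hset) \<Rightarrow> 'a::complex_hilbert_space proj name \<Rightarrow> ('a \<rightharpoonup> 'a) \<Rightarrow> bool" where
  "corresponds \<iota> u A \<longleftrightarrow>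
     (\<forall>l::rat. spectral_projection A (of_rat l) = (\<Sqinter>r\<in>{l<..}. name_app u (check (\<iota> r)))) \<and>
     (\<forall>r::rat. name_app u (check (\<iota> r)) = spectral_projection A (of_rat r))"

end

theory Submission
  imports Defs "HOL-Probability.Distribution_Functions"
    "HOL-Computational_Algebra.Formal_Power_Series"
begin

text \<open>Since \<open>p \<leadsto> q\<close> is \<open>\<top>\<close> exactly when \<open>p \<le> q\<close>, a name \<open>u\<close> over the rationals is a real number with
  truth value \<open>\<top>\<close> iff its values \<open>u(r)\<close> have supremum \<open>\<top>\<close>, infimum \<open>\<bottom>\<close> and satisfy
  \<open>u(r) = (\<Sqinter>s>r. u(s))\<close>, that is, iff they are the restriction of a unique spectral family to the
  rationals.  What remains is the spectral theorem for unbounded operators.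

  For a self-adjoint \<open>A\<close> and real \<open>t\<close> let \<open>R = (A - t + \<i>)\<^sup>-\<^sup>1\<close> and let \<open>Z\<close> be the real part of \<open>R\<close>.
  The projection onto the kernel of \<open>\<bar>Z\<bar> + Z\<close> cuts \<open>A\<close> at \<open>t\<close>: the form of \<open>A\<close> is at most \<open>t\<close> on
  its range and strictly above \<open>t\<close> on the orthogonal complement.  It commutes with every projection
  that commutes with \<open>A\<close>, and this makes the cuts of \<open>A\<close> at all \<open>t\<close> the only spectral family of cuts.
  Conversely, a spectral family \<open>E\<close> consists of the cuts of the strong limit of the bounded operators
  \<open>(n - \<integral>\<^bsub>-n\<^esub>\<^bsup>n\<^esup> E(s) ds) (E(n) - E(-n))\<close>.  Comparing Riemann sums, a family of cuts of \<open>A\<close> is the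
  resolution of the identity of \<open>A\<close>.  Affiliation with the algebra of \<open>Q\<close> is tested on the symmetries
  \<open>1 - 2P\<close> with \<open>P\<close> commuting with \<open>Q\<close>.\<close>

\<comment> \<open>\<open>spectral_projection\<close> is a definite description, so existence and
  uniqueness of the resolution of the identity are both owed before any value E(r) can be used.
  Stieltjes integrals enter only through that notion; elsewhere operators are handled by
  inequalities between quadratic forms on subspaces. This is why cuts are the working notion: they
  can be compared with one another without measure theory. The real part of R is the function (s -
  t) / ((s - t)^2 + 1) of A. It is bounded and has the sign of s - t, so an unbounded sign problem
  becomes a bounded one, and |Z| = sqrt (1 - (1 - Z^2)) is a power series in 1 - Z^2. The kernel of
  |Z| + Z contains the kernel of Z; hence eigenvectors for t fall below the cut, as the closed
  half-line belonging to E(t) demands. Uniqueness of the resolution goes through the converse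
  construction: a resolution E of A is also the resolution of the operator built from E, and a
  resolution determines its operator by polarization, so E consists of cuts of A.\<close>
subclass (in complex_hilbert_space) banach ..

section \<open>Orthogonal projections\<close>

notation proj_apply (infixr "\<cdot>" 82)

lemma inner_scaleC_i: "inner (\<i> *\<^sub>C x) y = - inner x (\<i> *\<^sub>C (y::'a::complex_hilbert_space))"
  by (simp add: inner_eq_Re_cinner cinner_scaleC_left cinner_scaleC_right)

lemma cinner_eq_inner: "cinner x y = Complex (inner x y) (inner x (\<i> *\<^sub>C y))"
  by (rule complex_eqI) (simp_all add: inner_eq_Re_cinner cinner_scaleC_right)

lemma scaleC_eq: "c *\<^sub>C x = Re c *\<^sub>R x + Im c *\<^sub>R \<i> *\<^sub>C (x::'a::complex_hilbert_space)"
proof -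
  have "c *\<^sub>C x = (of_real (Re c) + of_real (Im c) * \<i>) *\<^sub>C x"
    by (simp add: complex_eq[of c, symmetric] mult.commute)
  then show ?thesis
    by (simp only: scaleC_add_left scaleC_scaleC[symmetric] scaleC_of_real)
qed

lemma bounded_linear_scaleC: "bounded_linear ((*\<^sub>C) c :: 'a::complex_hilbert_space \<Rightarrow> 'a)"
  by (rule bounded_linear_intro[where K = "cmod c"])
    (auto simp: norm_scaleC scaleC_add_right scaleC_scaleC mult.commute simp flip: scaleC_of_real)

lemmas proj_add = linear_add[OF proj_linear]
  and proj_diff = linear_diff[OF proj_linear]
  and proj_scaleR = linear_scale[OF proj_linear]
  and proj_zero = linear_0[OF proj_linear]

lemma proj_inner: "inner (P \<cdot> x) y = inner x (P \<cdot> y)"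
  by (simp add: inner_eq_Re_cinner proj_cinner)

lemma inner_proj_self: "inner (P \<cdot> x) x = (norm (P \<cdot> x))\<^sup>2"
  by (metis power2_norm_eq_inner proj_idem proj_inner)

lemma norm_proj_le: "norm (P \<cdot> x) \<le> norm x"
proof -
  have "(norm (P \<cdot> x))\<^sup>2 \<le> norm (P \<cdot> x) * norm x"
    by (metis inner_proj_self norm_cauchy_schwarz)
  then show ?thesis
    by (cases "norm (P \<cdot> x) = 0") (auto simp: power2_eq_square)
qed

lemma proj_eqI: "(\<And>x. P \<cdot> x = R \<cdot> x) \<Longrightarrow> P = R"
  by (metis ext proj_apply_inject)

lemma proj_le_iff: "P \<le> R \<longleftrightarrow> (\<forall>x. R \<cdot> P \<cdot> x = P \<cdot> x)"
  unfolding less_eq_proj_def by (metis proj_range_iff rangeE rangeI subsetD subsetI)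

lemma proj_le_absorb:
  assumes "P \<le> R"
  shows "R \<cdot> P \<cdot> x = P \<cdot> x" "P \<cdot> R \<cdot> x = P \<cdot> x"
proof -
  show 1: "R \<cdot> P \<cdot> x = P \<cdot> x" for x using assms by (simp add: proj_le_iff)
  have "inner (P \<cdot> R \<cdot> x - P \<cdot> x) y = 0" for y
    by (simp add: inner_diff_left proj_inner 1)
  then show "P \<cdot> R \<cdot> x = P \<cdot> x"
    by (metis eq_iff_diff_eq_0 inner_eq_zero_iff)
qed

lemma norm_proj_mono: "P \<le> R \<Longrightarrow> norm (P \<cdot> x) \<le> norm (R \<cdot> x)"
  by (metis norm_proj_le proj_le_absorb(2))

lemma norm_proj_diff:
  assumes "P \<le> R"
  shows "(norm (R \<cdot> x - P \<cdot> x))\<^sup>2 = (norm (R \<cdot> x))\<^sup>2 - (norm (P \<cdot> x))\<^sup>2"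
proof -
  have "inner (P \<cdot> x) (R \<cdot> x) = (norm (P \<cdot> x))\<^sup>2"
    by (metis assms inner_proj_self proj_inner proj_le_absorb(1))
  then show ?thesis
    by (simp add: power2_norm_eq_inner inner_diff inner_commute)
qed

lemma proj_top: "\<top> \<cdot> x = x" and proj_bot: "\<bottom> \<cdot> x = 0"
  using range_top range_bot by (metis UNIV_I proj_range_iff, metis rangeI singletonD)

text \<open>\<open>P \<cdot> (x - y)\<close> lies in the range of \<open>P\<close>, so
  \<open>x - y\<close> is orthogonal to it, which makes its norm vanish. The real inner product is
  enough for this.\<close>

lemma proj_apply_eqI:
  assumes "y \<in> proj_range P" "\<And>z. z \<in> proj_range P \<Longrightarrow> inner (x - y) z = 0"
  shows "P \<cdot> x = y"
proof -
  have "inner (P \<cdot> (x - y)) (P \<cdot> (x - y)) = 0"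
    using assms(2)[of "P \<cdot> (x - y)"] by (simp add: proj_inner proj_idem)
  then show ?thesis
    using assms(1) by (simp add: proj_diff proj_range_iff)
qed

text \<open>Invariance of the range under the adjoint \<open>S'\<close> means that \<open>S\<close>
  preserves the orthogonal complement; with invariance under \<open>S\<close> itself,
  \<open>S\<close> splits along \<open>P\<close>.\<close>

lemma proj_commute_of_invariant:
  assumes "\<And>x y. inner (S x) y = inner x (S' y)" "linear S"
    and "\<And>x. P \<cdot> x = x \<Longrightarrow> P \<cdot> S x = S x" "\<And>x. P \<cdot> x = x \<Longrightarrow> P \<cdot> S' x = S' x"
  shows "S (P \<cdot> x) = P \<cdot> S x"
proof (rule sym, rule proj_apply_eqI)
  show "S (P \<cdot> x) \<in> proj_range P"
    using assms(3) by (simp add: proj_range_iff proj_idem)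
  fix z assume "z \<in> proj_range P"
  then have z: "P \<cdot> z = z" "P \<cdot> S' z = S' z"
    using assms(4) by (auto simp: proj_range_iff)
  have "inner (S x - S (P \<cdot> x)) z = inner (x - P \<cdot> x) (P \<cdot> S' z)"
    by (simp add: assms(1) z linear_diff[OF assms(2), symmetric])
  then show "inner (S x - S (P \<cdot> x)) z = 0"
    by (simp flip: proj_inner add: proj_diff proj_idem)
qed

text \<open>For comparable projections \<open>norm_proj_diff\<close> turns convergence of the
  decreasing numbers \<open>(norm (P n \<cdot> x))\<^sup>2\<close> into the Cauchy property of the
  vectors. The limit lies in every range, and its difference from \<open>x\<close> is orthogonal to
  their intersection.\<close>

lemma decreasing_proj_tendsto:
  assumes "decseq P"
  shows "(\<lambda>n. P n \<cdot> x) \<longlonglongrightarrow> (\<Sqinter>n. P n) \<cdot> x"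
proof -
  have le: "P n \<le> P m" if "m \<le> n" for m n using assms that by (simp add: decseqD)
  have "decseq (\<lambda>n. (norm (P n \<cdot> x))\<^sup>2)"
    by (simp add: decseq_def le norm_proj_mono power_mono)
  then have "convergent (\<lambda>n. (norm (P n \<cdot> x))\<^sup>2)"
    by (rule decseq_convergent[of _ 0]) (auto simp: convergent_def)
  then have C: "Cauchy (\<lambda>n. (norm (P n \<cdot> x))\<^sup>2)"
    by (rule convergent_Cauchy)
  have "Cauchy (\<lambda>n. P n \<cdot> x)"
  proof (rule CauchyI')
    fix e :: real assume "e > 0"
    then obtain M where M: "\<And>m n. M \<le> m \<Longrightarrow> M \<le> n \<Longrightarrow>
        norm ((norm (P m \<cdot> x))\<^sup>2 - (norm (P n \<cdot> x))\<^sup>2) < e\<^sup>2"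
      using CauchyD[OF C, of "e\<^sup>2"] by auto
    have "norm (P m \<cdot> x - P n \<cdot> x) < e" if "M \<le> m" "m < n" for m n
    proof -
      have "(norm (P m \<cdot> x - P n \<cdot> x))\<^sup>2 < e\<^sup>2"
        using M[of m n] that by (simp add: norm_proj_diff le)
      then show ?thesis using \<open>e > 0\<close> by (intro power2_less_imp_less[of _ e]) auto
    qed
    then show "\<exists>M. \<forall>m\<ge>M. \<forall>n>m. dist (P m \<cdot> x) (P n \<cdot> x) < e"
      unfolding dist_norm by blast
  qed
  then obtain y where y: "(\<lambda>n. P n \<cdot> x) \<longlonglongrightarrow> y"
    using Cauchy_convergent convergent_def by blast
  have "(\<Sqinter>n. P n) \<cdot> x = y"
  proof (rule proj_apply_eqI)
    have "y \<in> proj_range (P m)" for m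
    proof (rule closed_sequentially[OF closed_proj_range])
      show "(\<lambda>n. P (n + m) \<cdot> x) \<longlonglongrightarrow> y" using y by (rule LIMSEQ_ignore_initial_segment)
      show "P (n + m) \<cdot> x \<in> proj_range (P m)" for n
        by (simp add: proj_range_iff proj_le_absorb le)
    qed
    then show "y \<in> proj_range (\<Sqinter>n. P n)" by (auto simp: range_Inf)
    fix z assume "z \<in> proj_range (\<Sqinter>n. P n)"
    then have z: "P n \<cdot> z = z" for n
      by (metis INF_lower UNIV_I proj_le_absorb(1) proj_range_iff)
    have "(\<lambda>n. inner (x - P n \<cdot> x) z) \<longlonglongrightarrow> inner (x - y) z"
      by (intro tendsto_intros y)
    moreover have "inner (x - P n \<cdot> x) z = 0" for n
      by (simp add: inner_diff_left proj_inner z)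
    ultimately show "inner (x - y) z = 0"
      by (simp add: LIMSEQ_const_iff)
  qed
  with y show ?thesis by simp
qed

lemma compl_SUP_proj: "- (\<Squnion>n. P n) = (\<Sqinter>n. - (P n :: 'a::complex_hilbert_space proj))"
proof (rule antisym)
  show "- (\<Squnion>n. P n) \<le> (\<Sqinter>n. - P n)"
    by (meson INF_greatest SUP_upper UNIV_I ortho_antimono)
  show "(\<Sqinter>n. - P n) \<le> - (\<Squnion>n. P n)"
    by (rule compl_le_swap1) (meson INF_lower SUP_least UNIV_I compl_le_swap1)
qed

lemma increasing_proj_tendsto:
  assumes "incseq P"
  shows "(\<lambda>n. P n \<cdot> x) \<longlonglongrightarrow> (\<Squnion>n. P n) \<cdot> x"
proof -
  have "decseq (\<lambda>n. - P n)"
    using assms by (simp add: decseq_def incseq_def)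
  then have "(\<lambda>n. (- P n) \<cdot> x) \<longlonglongrightarrow> (- (\<Squnion>n. P n)) \<cdot> x"
    unfolding compl_SUP_proj by (rule decreasing_proj_tendsto)
  then have "(\<lambda>n. x - (x - P n \<cdot> x)) \<longlonglongrightarrow> x - (x - (\<Squnion>n. P n) \<cdot> x)"
    unfolding apply_uminus by (rule tendsto_diff[OF tendsto_const])
  moreover have "x - (x - y) = y" for y by simp
  ultimately show ?thesis by (simp only:)
qed

lemma proj_leI:
  assumes "\<And>x. P \<cdot> x - R \<cdot> P \<cdot> x = 0"
  shows "P \<le> R"
  using assms by (simp add: proj_le_iff)

subsection \<open>Spectral families\<close>

lemma spectral_family_mono: "spectral_family E \<Longrightarrow> s \<le> t \<Longrightarrow> E s \<le> E t"
  unfolding spectral_family_def by (blast dest: monoD)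

lemma spectral_family_Inf: "spectral_family E \<Longrightarrow> (\<Sqinter>t. E t) = \<bottom>"
  and spectral_family_Sup: "spectral_family E \<Longrightarrow> (\<Squnion>t. E t) = \<top>"
  and spectral_family_right: "spectral_family E \<Longrightarrow> E t = (\<Sqinter>s\<in>{t<..}. E s)"
  unfolding spectral_family_def by blast+

text \<open>The infimum over all s > t is already the infimum along t + 1/(n+1). Since the norm of
  \<open>E s \<cdot> x - E t \<cdot> x\<close> increases with s, the limit along this sequence is
  the full right limit.\<close>

lemma spectral_family_tendsto_right:
  assumes E: "spectral_family E"
  shows "((\<lambda>s. E s \<cdot> x) \<longlongrightarrow> E t \<cdot> x) (at_right t)"
proof -
  let ?s = "\<lambda>n. t + inverse (real (Suc n))"
  note mono = spectral_family_mono[OF E]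
  have dec: "decseq (\<lambda>n. E (?s n))"
    by (rule decseq_SucI, rule mono) simp
  have "(\<Sqinter>n. E (?s n)) = E t"
  proof (rule antisym)
    have "(\<Sqinter>n. E (?s n)) \<le> E s" if st: "s > t" for s
    proof -
      obtain n where "inverse (real (Suc n)) < s - t"
        using reals_Archimedean[of "s - t"] st by auto
      then have "E (?s n) \<le> E s" by (intro mono) auto
      then show ?thesis by (meson INF_lower UNIV_I order_trans)
    qed
    then have "(\<Sqinter>n. E (?s n)) \<le> (\<Sqinter>s\<in>{t<..}. E s)"
      by (intro INF_greatest) auto
    then show "(\<Sqinter>n. E (?s n)) \<le> E t"
      by (simp flip: spectral_family_right[OF E])
    show "E t \<le> (\<Sqinter>n. E (?s n))" by (intro INF_greatest mono) auto
  qed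
  then have lim: "(\<lambda>n. E (?s n) \<cdot> x) \<longlonglongrightarrow> E t \<cdot> x"
    using decreasing_proj_tendsto[OF dec, of x] by simp
  show ?thesis
  proof (rule tendstoI)
    fix e :: real assume "e > 0"
    then obtain n where n: "dist (E (?s n) \<cdot> x) (E t \<cdot> x) < e"
      using lim by (metis LIMSEQ_def order_refl)
    have "dist (E s \<cdot> x) (E t \<cdot> x) < e" if "t < s" "s < ?s n" for s
    proof -
      have "(norm (E s \<cdot> x - E t \<cdot> x))\<^sup>2 \<le> (norm (E (?s n) \<cdot> x - E t \<cdot> x))\<^sup>2"
        using that by (subst (1 2) norm_proj_diff) (auto intro!: mono power_mono norm_proj_mono)
      then have "norm (E s \<cdot> x - E t \<cdot> x) \<le> norm (E (?s n) \<cdot> x - E t \<cdot> x)"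
        by (rule power2_le_imp_le) simp
      with n show ?thesis by (simp add: dist_norm)
    qed
    then show "\<forall>\<^sub>F s in at_right t. dist (E s \<cdot> x) (E t \<cdot> x) < e"
      unfolding eventually_at_right_field by (intro exI[of _ "?s n"]) auto
  qed
qed

lemma spectral_family_tendsto_bot:
  assumes E: "spectral_family E"
  shows "((\<lambda>s. E s \<cdot> x) \<longlongrightarrow> 0) at_bot"
proof -
  note mono = spectral_family_mono[OF E]
  have dec: "decseq (\<lambda>n. E (- real n))"
    by (intro decseq_SucI mono) simp
  have "(\<Sqinter>n. E (- real n)) \<le> (\<Sqinter>t. E t)"
  proof (intro INF_greatest)
    fix t
    obtain n where "- t \<le> real n" using real_arch_simple by blast
    then have "E (- real n) \<le> E t" by (intro mono) auto
    then show "(\<Sqinter>n. E (- real n)) \<le> E t" by (meson INF_lower UNIV_I order_trans)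
  qed
  then have "(\<Sqinter>n. E (- real n)) = \<bottom>"
    by (simp add: spectral_family_Inf[OF E] bot_unique)
  then have lim: "(\<lambda>n. E (- real n) \<cdot> x) \<longlonglongrightarrow> 0"
    using decreasing_proj_tendsto[OF dec, of x] by (simp add: proj_bot)
  show ?thesis
  proof (rule tendstoI)
    fix e :: real assume "e > 0"
    then obtain n where n: "norm (E (- real n) \<cdot> x) < e"
      using lim by (metis LIMSEQ_def order_refl dist_0_norm dist_commute)
    have "dist (E s \<cdot> x) 0 < e" if "s \<le> - real n" for s
      using norm_proj_mono[OF mono[OF that], of x] n by simp
    then show "\<forall>\<^sub>F s in at_bot. dist (E s \<cdot> x) 0 < e"
      unfolding eventually_at_bot_linorder by blast
  qed
qed

lemma spectral_family_tendsto_top: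
  assumes E: "spectral_family E"
  shows "((\<lambda>s. E s \<cdot> x) \<longlongrightarrow> x) at_top"
proof -
  note mono = spectral_family_mono[OF E]
  have inc: "incseq (\<lambda>n. E (real n))"
    by (intro incseq_SucI mono) simp
  have "(\<Squnion>t. E t) \<le> (\<Squnion>n. E (real n))"
  proof (intro SUP_least)
    fix t
    obtain n where "t \<le> real n" using real_arch_simple by blast
    then have "E t \<le> E (real n)" by (intro mono) auto
    then show "E t \<le> (\<Squnion>n. E (real n))" by (meson SUP_upper UNIV_I order_trans)
  qed
  then have "(\<Squnion>n. E (real n)) = \<top>"
    by (simp add: spectral_family_Sup[OF E] top_unique)
  then have lim: "(\<lambda>n. E (real n) \<cdot> x) \<longlonglongrightarrow> x"
    using increasing_proj_tendsto[OF inc, of x] by (simp add: proj_top)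
  show ?thesis
  proof (rule tendstoI)
    fix e :: real assume "e > 0"
    then obtain n where n: "norm (x - E (real n) \<cdot> x) < e"
      using lim by (metis LIMSEQ_def order_refl dist_norm dist_commute)
    have "dist (E s \<cdot> x) x < e" if "real n \<le> s" for s
    proof -
      have "norm ((- E s) \<cdot> x) \<le> norm ((- E (real n)) \<cdot> x)"
        using that by (intro norm_proj_mono) (simp add: mono)
      with n show ?thesis by (simp add: dist_norm apply_uminus norm_minus_commute)
    qed
    then show "\<forall>\<^sub>F s in at_top. dist (E s \<cdot> x) x < e"
      unfolding eventually_at_top_linorder by blast
  qed
qed

section \<open>The absolute value of a bounded symmetric operator\<close>

text \<open>The Taylor coefficients of \<open>sqrt (1 - z)\<close> at \<open>0\<close>.\<close>

definition sqrt_coeff :: "nat \<Rightarrow> real" where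
  "sqrt_coeff n = (- 1) ^ n * ((1/2) gchoose n)"

text \<open>These are the Taylor coefficients of (1 - z)^(-1/2). They govern both the derivative and
  the partial sums of the series with coefficients \<open>sqrt_coeff\<close>.\<close>

lemma neg_half_gchoose_nonneg: "0 \<le> (- 1) ^ n * ((- 1/2 :: real) gchoose n)"
proof -
  have "0 \<le> pochhammer (1/2::real) n"
    by (rule pochhammer_nonneg) simp
  moreover have "(- 1) ^ n * ((- 1/2) gchoose n) = pochhammer (1/2::real) n / fact n"
    by (simp add: gbinomial_pochhammer flip: mult.assoc power_mult_distrib)
  ultimately show ?thesis by simp
qed

lemma sqrt_coeff_0: "sqrt_coeff 0 = 1"
  by (simp add: sqrt_coeff_def)

text \<open>Comparison of coefficients in d/dz sqrt (1 - z) = - (1/2) (1 - z)^(-1/2).\<close>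

lemma sqrt_coeff_Suc_nonpos: "sqrt_coeff (Suc n) \<le> 0"
proof -
  have "real (Suc n) * sqrt_coeff (Suc n) = - (1/2) * ((- 1) ^ n * ((- 1/2) gchoose n))"
    using arg_cong[OF gbinomial_absorption[of n "1/2::real"], of "\<lambda>y. - ((- 1) ^ n * y)"]
    by (simp add: sqrt_coeff_def algebra_simps)
  also have "\<dots> \<le> 0"
    using neg_half_gchoose_nonneg[of n] by simp
  finally show ?thesis
    by (simp add: mult_le_0_iff del: of_nat_Suc)
qed

text \<open>Partial sums of the coefficients of sqrt (1 - z) are the coefficients of sqrt (1 - z) /
  (1 - z) = (1 - z)^(-1/2), hence nonnegative, and only the zeroth summand, 1, is positive. So the
  series converges absolutely up to |z| = 1, which admits every contraction, and the exact bound 1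
  yields positivity in \<open>op_sqrt_nonneg\<close>.\<close>

lemma sqrt_coeff_sum_abs: "(\<Sum>k\<le>n. \<bar>sqrt_coeff (Suc k)\<bar>) \<le> 1"
proof -
  have "(\<Sum>k\<le>n. \<bar>sqrt_coeff (Suc k)\<bar>) = (\<Sum>k\<le>n. - sqrt_coeff (Suc k))"
    by (intro sum.cong) (simp_all add: abs_of_nonpos sqrt_coeff_Suc_nonpos)
  also have "\<dots> = 1 - (\<Sum>k\<le>Suc n. sqrt_coeff k)"
    by (subst sum.atMost_Suc_shift) (simp add: sqrt_coeff_0 sum_negf)
  also have "(\<Sum>k\<le>Suc n. sqrt_coeff k) = (- 1) ^ Suc n * ((- 1/2) gchoose Suc n)"
    using gbinomial_sum_lower_neg[of "1/2::real" "Suc n"] by (simp only: sqrt_coeff_def mult.commute) simp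
  also have "1 - \<dots> \<le> 1"
    using neg_half_gchoose_nonneg[of "Suc n"] by linarith
  finally show ?thesis .
qed

lemma summable_sqrt_coeff_Suc: "summable (\<lambda>n. \<bar>sqrt_coeff (Suc n)\<bar>)"
  by (rule bounded_imp_summable[of _ 1]) (auto simp: sqrt_coeff_sum_abs)

lemma suminf_sqrt_coeff_Suc: "(\<Sum>n. \<bar>sqrt_coeff (Suc n)\<bar>) \<le> 1"
  by (rule suminf_le_const[OF summable_sqrt_coeff_Suc])
    (metis (no_types, lifting) abs_ge_zero order_trans sqrt_coeff_sum_abs sum_mono2 finite_atMost lessThan_subset_iff
      lessThan_Suc_atMost le_SucI order_refl)

lemma summable_sqrt_coeff: "summable (\<lambda>n. \<bar>sqrt_coeff n\<bar>)"
  using summable_sqrt_coeff_Suc summable_Suc_iff[of "\<lambda>n. \<bar>sqrt_coeff n\<bar>"] by simp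

text \<open>Vandermonde's identity for 1/2 + 1/2 = 1: the square of the series is 1 - z.\<close>

lemma sqrt_coeff_convolution:
  "(\<Sum>i\<le>n. sqrt_coeff i * sqrt_coeff (n - i)) = (if n = 0 then 1 else if n = 1 then - 1 else 0)"
proof -
  have "(\<Sum>i\<le>n. sqrt_coeff i * sqrt_coeff (n - i)) =
      (- 1) ^ n * (\<Sum>i\<le>n. ((1/2::real) gchoose i) * ((1/2) gchoose (n - i)))"
    unfolding sum_distrib_left
  proof (intro sum.cong refl)
    fix i assume "i \<in> {..n}"
    then have "(- 1::real) ^ n = (- 1) ^ i * (- 1) ^ (n - i)"
      by (simp flip: power_add)
    then show "sqrt_coeff i * sqrt_coeff (n - i) =
        (- 1) ^ n * (((1/2) gchoose i) * ((1/2) gchoose (n - i)))"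
      by (simp add: sqrt_coeff_def)
  qed
  also have "\<dots> = (- 1) ^ n * ((1::real) gchoose n)"
    using gbinomial_Vandermonde[of "1/2::real" "1/2" n] by (simp add: atMost_atLeast0)
  also have "\<dots> = (if n = 0 then 1 else if n = 1 then - 1 else 0)"
    using binomial_gbinomial[of 1 n, where 'a = real] by (cases n) (auto simp: binomial_eq_0)
  finally show ?thesis .
qed

text \<open>The square root of 1 - X, not of X, for a symmetric contraction X.\<close>

definition op_sqrt :: "('a::{real_inner,banach} \<Rightarrow> 'a) \<Rightarrow> 'a \<Rightarrow> 'a" where
  "op_sqrt X x = (\<Sum>n. sqrt_coeff n *\<^sub>R (X ^^ n) x)"

context
  fixes X :: "'a::{real_inner,banach} \<Rightarrow> 'a"
  assumes bl: "bounded_linear X"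
    and symm: "\<And>x y. inner (X x) y = inner x (X y)"
    and contr: "\<And>x. norm (X x) \<le> norm x"
begin

lemma bounded_linear_pow: "bounded_linear (X ^^ n)"
  by (induction n) (auto simp: o_def id_def intro: bounded_linear_ident bounded_linear_compose[OF bl])

lemma norm_pow_le: "norm ((X ^^ n) x) \<le> norm x"
  by (induction n) (auto intro: order_trans[OF contr])

lemma symm_pow: "inner ((X ^^ n) x) y = inner x ((X ^^ n) y)"
proof (induction n arbitrary: y)
  case (Suc n)
  have "inner ((X ^^ Suc n) x) y = inner ((X ^^ n) x) (X y)"
    by (simp add: symm)
  then show ?case by (simp add: Suc funpow_swap1)
qed simp

lemma norm_term_le: "norm (sqrt_coeff n *\<^sub>R (X ^^ n) x) \<le> \<bar>sqrt_coeff n\<bar> * norm x"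
  by (simp add: mult_left_mono norm_pow_le)

lemma summable_norm_term: "summable (\<lambda>n. norm (sqrt_coeff n *\<^sub>R (X ^^ n) x))"
  by (rule summable_comparison_test'[OF summable_mult2[OF summable_sqrt_coeff, of "norm x"], of 0])
    (use norm_term_le in auto)

lemma sums_op_sqrt: "(\<lambda>n. sqrt_coeff n *\<^sub>R (X ^^ n) x) sums op_sqrt X x"
  unfolding op_sqrt_def by (intro summable_sums summable_norm_cancel[OF summable_norm_term])

lemma op_sqrt_commute:
  assumes T: "bounded_linear T" and comm: "\<And>x. T (X x) = X (T x)"
  shows "T (op_sqrt X x) = op_sqrt X (T x)"
proof -
  interpret T: bounded_linear T by (rule T)
  have "T ((X ^^ n) x) = (X ^^ n) (T x)" for n
    by (induction n) (simp_all add: comm)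
  then have "(\<lambda>n. sqrt_coeff n *\<^sub>R (X ^^ n) (T x)) sums T (op_sqrt X x)"
    using T.sums[OF sums_op_sqrt[of x]] by (simp add: T.scaleR)
  then show ?thesis
    using sums_op_sqrt[of "T x"] sums_unique2 by blast
qed

lemma bounded_linear_op_sqrt: "bounded_linear (op_sqrt X)"
proof (rule bounded_linear_intro[where K = "\<Sum>n. \<bar>sqrt_coeff n\<bar>"])
  interpret Xn: bounded_linear "X ^^ n" for n by (rule bounded_linear_pow)
  show "op_sqrt X (x + y) = op_sqrt X x + op_sqrt X y" for x y
    using sums_unique2[OF sums_op_sqrt[of "x + y"]]
      sums_add[OF sums_op_sqrt[of x] sums_op_sqrt[of y]]
    by (simp add: Xn.add scaleR_add_right)
  show "op_sqrt X (r *\<^sub>R x) = r *\<^sub>R op_sqrt X x" for r x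
    using sums_unique2[OF sums_op_sqrt[of "r *\<^sub>R x"]] sums_scaleR_right[OF sums_op_sqrt[of x], of r]
    by (simp add: Xn.scaleR mult.commute)
  show "norm (op_sqrt X x) \<le> norm x * (\<Sum>n. \<bar>sqrt_coeff n\<bar>)" for x
  proof -
    have "norm (op_sqrt X x) \<le> (\<Sum>n. norm (sqrt_coeff n *\<^sub>R (X ^^ n) x))"
      unfolding op_sqrt_def by (rule summable_norm[OF summable_norm_term])
    also have "\<dots> \<le> (\<Sum>n. \<bar>sqrt_coeff n\<bar> * norm x)"
      by (intro suminf_le norm_term_le summable_norm_term summable_mult2 summable_sqrt_coeff)
    also have "\<dots> = norm x * (\<Sum>n. \<bar>sqrt_coeff n\<bar>)"
      by (subst suminf_mult2[OF summable_sqrt_coeff, symmetric]) (rule mult.commute)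
    finally show ?thesis .
  qed
qed

lemma op_sqrt_symm: "inner (op_sqrt X x) y = inner x (op_sqrt X y)"
proof -
  have "(\<lambda>n. inner (sqrt_coeff n *\<^sub>R (X ^^ n) x) y) sums inner (op_sqrt X x) y"
    by (rule bounded_linear.sums[OF bounded_linear_inner_left sums_op_sqrt])
  moreover have "(\<lambda>n. inner x (sqrt_coeff n *\<^sub>R (X ^^ n) y)) sums inner x (op_sqrt X y)"
    by (rule bounded_linear.sums[OF bounded_linear_inner_right sums_op_sqrt])
  ultimately show ?thesis
    using sums_unique2 by (simp add: symm_pow)
qed

text \<open>All terms after the zeroth have total norm at most \<open>norm x\<close>. Thus
  \<open>op_sqrt X x\<close> lies in the ball of radius \<open>norm x\<close> about
  \<open>x\<close>, and Cauchy-Schwarz bounds its inner product with \<open>x\<close> below by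
  0.\<close>

lemma op_sqrt_nonneg: "0 \<le> inner (op_sqrt X x) x"
proof -
  let ?f = "\<lambda>n. sqrt_coeff n *\<^sub>R (X ^^ n) x"
  have s: "(\<lambda>n. ?f (Suc n)) sums (op_sqrt X x - x)"
    using sums_op_sqrt[of x] by (subst sums_Suc_iff) (simp add: sqrt_coeff_0)
  have sn: "summable (\<lambda>n. norm (?f (Suc n)))"
    using summable_norm_term by (subst summable_Suc_iff)
  have "norm (op_sqrt X x - x) \<le> (\<Sum>n. norm (?f (Suc n)))"
    using summable_norm[OF sn] s by (simp add: sums_iff)
  also have "\<dots> \<le> (\<Sum>n. \<bar>sqrt_coeff (Suc n)\<bar> * norm x)"
    by (intro suminf_le norm_term_le sn summable_mult2 summable_sqrt_coeff_Suc)
  also have "\<dots> = (\<Sum>n. \<bar>sqrt_coeff (Suc n)\<bar>) * norm x"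
    by (rule suminf_mult2[OF summable_sqrt_coeff_Suc, symmetric])
  also have "\<dots> \<le> norm x"
    using suminf_sqrt_coeff_Suc by (simp add: mult_left_le_one_le suminf_nonneg summable_sqrt_coeff_Suc)
  finally have "norm (op_sqrt X x - x) * norm x \<le> norm x * norm x"
    by (simp add: mult_right_mono)
  moreover have "- inner (op_sqrt X x - x) x \<le> norm (op_sqrt X x - x) * norm x"
    using norm_cauchy_schwarz[of "x - op_sqrt X x" x] by (simp add: norm_minus_commute inner_diff_left)
  ultimately show ?thesis
    by (simp add: inner_diff_left power2_norm_eq_inner flip: power2_eq_square)
qed

text \<open>The Cauchy product as an absolutely summable family over pairs of exponents: summed by
  rows it is the iterated operator, summed along antidiagonals it has the coefficients of 1 -
  z.\<close>

lemma op_sqrt_square: "op_sqrt X (op_sqrt X x) = x - X x"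
proof -
  let ?a = sqrt_coeff
  let ?T = "\<lambda>(i, j). (?a i * ?a j) *\<^sub>R (X ^^ (i + j)) x"
  have suma: "?a summable_on UNIV" "(\<lambda>n. \<bar>?a n\<bar>) summable_on UNIV"
    using norm_summable_imp_summable_on[of ?a] norm_summable_imp_summable_on[of "\<lambda>n. \<bar>?a n\<bar>"]
      summable_sqrt_coeff by simp_all
  have "(\<lambda>p. norm (case p of (i, j) \<Rightarrow> ?a i * ?a j)) summable_on UNIV \<times> UNIV"
  proof (subst Infinite_Sum.abs_summable_on_Sigma_iff, intro conjI ballI)
    show "(\<lambda>j. norm (case (i, j) of (i, j) \<Rightarrow> ?a i * ?a j)) summable_on UNIV" for i
      using suma(2) by (simp add: abs_mult summable_on_cmult_right)
    show "(\<lambda>i. norm (\<Sum>\<^sub>\<infinity>j. norm (case (i, j) of (i, j) \<Rightarrow> ?a i * ?a j))) summable_on UNIV"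
      using suma(2)
      by (simp add: abs_mult infsum_cmult_right' summable_on_cmult_left infsum_nonneg)
  qed
  then have "(\<lambda>p. norm (case p of (i, j) \<Rightarrow> ?a i * ?a j) * norm x) summable_on UNIV \<times> UNIV"
    by (rule summable_on_cmult_left)
  then have "(\<lambda>p. norm (?T p)) summable_on UNIV \<times> UNIV"
    by (rule Infinite_Sum.abs_summable_on_comparison_test') (auto simp: abs_mult intro!: mult_left_mono norm_pow_le)
  then have "?T summable_on UNIV \<times> UNIV"
    by (rule abs_summable_summable)
  then obtain L where L: "(?T has_sum L) (UNIV \<times> UNIV)"
    by (auto simp: summable_on_def)
  have hs: "((\<lambda>n. ?a n *\<^sub>R (X ^^ n) y) has_sum op_sqrt X y) UNIV" for y
    by (rule norm_summable_imp_has_sum[OF summable_norm_term sums_op_sqrt])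
  have "((\<lambda>j. ?T (i, j)) has_sum ?a i *\<^sub>R (X ^^ i) (op_sqrt X x)) UNIV" for i
  proof -
    interpret B: bounded_linear "\<lambda>y. ?a i *\<^sub>R (X ^^ i) y"
      by (intro bounded_linear_const_scaleR bounded_linear_pow)
    show ?thesis
      using has_sum_bounded_linear[OF B.bounded_linear_axioms hs[of x]]
      by (simp add: o_def linear_scale[OF bounded_linear.linear[OF bounded_linear_pow]] funpow_add)
  qed
  then have "((\<lambda>i. ?a i *\<^sub>R (X ^^ i) (op_sqrt X x)) has_sum L) UNIV"
    using has_sum_SigmaD[OF L] by simp
  then have 1: "L = op_sqrt X (op_sqrt X x)"
    using hs has_sum_unique by blast
  have "((\<lambda>(k, i). ?T (i, k - i)) has_sum L) (SIGMA k:UNIV. {..k}) \<longleftrightarrow> (?T has_sum L) (UNIV \<times> UNIV)"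
    by (rule has_sum_reindex_bij_witness[where i = "\<lambda>(i, j). (i + j, i)" and j = "\<lambda>(k, i). (i, k - i)"])
      auto
  with L have "((\<lambda>(k, i). ?T (i, k - i)) has_sum L) (SIGMA k:UNIV. {..k})"
    by simp
  then have "((\<lambda>k. \<Sum>i\<le>k. ?T (i, k - i)) has_sum L) UNIV"
    by (rule has_sum_SigmaD) (simp only: prod.case, rule has_sum_finite, simp)
  moreover have "(\<Sum>i\<le>k. ?T (i, k - i)) = (if k = 0 then x else if k = 1 then - X x else 0)" for k
  proof -
    have "(\<Sum>i\<le>k. ?T (i, k - i)) = (\<Sum>i\<le>k. ?a i * ?a (k - i)) *\<^sub>R (X ^^ k) x"
      unfolding scaleR_sum_left by (intro sum.cong) auto
    then show ?thesis by (simp add: sqrt_coeff_convolution)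
  qed
  ultimately have "((\<lambda>k::nat. if k = 0 then x else if k = 1 then - X x else 0) has_sum L) UNIV"
    by simp
  then have "((\<lambda>k::nat. if k = 0 then x else if k = 1 then - X x else 0) has_sum L) {0, 1::nat}"
    by (rule has_sum_cong_neutral[THEN iffD1, rotated -1]) auto
  then have "L = x - X x"
    using has_sum_unique[OF _ has_sum_finite[of "{0, 1::nat}"]] by fastforce
  with 1 show ?thesis by simp
qed

end

text \<open>Cauchy-Schwarz for a positive semidefinite form, read off the coefficients of t
  \<mapsto> q(x + t y). Such a form may vanish at y, hence the case c = 0.\<close>

lemma discriminant_nonpos:
  fixes a b c :: real
  assumes "0 \<le> c" "\<And>t. 0 \<le> a + 2 * t * b + t\<^sup>2 * c"
  shows "b\<^sup>2 \<le> a * c"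
proof (cases "c = 0")
  case True
  have "b = 0"
  proof (rule ccontr)
    assume "b \<noteq> 0"
    \<comment> \<open>At this t the value of a + 2 t b is -1.\<close>
    with assms(2)[of "- (a + 1) / (2 * b)"] True show False by (simp add: field_simps)
  qed
  with True show ?thesis by simp
next
  case False
  with assms(1) have "c > 0" by simp
  with assms(2)[of "- b / c"] show ?thesis
    by (simp add: field_simps power2_eq_square)
qed

text \<open>On the range of \<open>P\<close> the form of Z is that of -|Z|, on the complement that
  of |Z|. Since the kernel of Z goes into the range, the form is strictly positive at nonzero
  vectors of the complement. Commutation is stated for an adjoint pair \<open>T\<close>,
  \<open>T'\<close> so that it applies to resolvents, which are not symmetric.\<close>

lemma sign_projection_exists:
  fixes Z :: "'a::complex_hilbert_space \<Rightarrow> 'a"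
  assumes Z: "bounded_clinear Z" and symm: "\<And>x y. inner (Z x) y = inner x (Z y)"
    and contr: "\<And>x. norm (Z x) \<le> norm x"
  obtains P where "\<And>x. P \<cdot> x = x \<Longrightarrow> inner (Z x) x \<le> 0"
    and "\<And>x. P \<cdot> x = 0 \<Longrightarrow> 0 \<le> inner (Z x) x"
    and "\<And>x. P \<cdot> x = 0 \<Longrightarrow> inner (Z x) x = 0 \<Longrightarrow> x = 0"
    and "\<And>T T' x. bounded_linear T \<Longrightarrow> bounded_linear T' \<Longrightarrow>
      (\<And>x y. inner (T x) y = inner x (T' y)) \<Longrightarrow>
      (\<And>x. T (Z x) = Z (T x)) \<Longrightarrow> (\<And>x. T' (Z x) = Z (T' x)) \<Longrightarrow> T (P \<cdot> x) = P \<cdot> T x"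
proof -
  have blZ: "bounded_linear Z" and ZC: "Z (c *\<^sub>C x) = c *\<^sub>C Z x" for c x
    using Z by (auto simp: bounded_clinear_def)
  interpret Z: bounded_linear Z by (rule blZ)
  \<comment> \<open>Then 1 - X = Z^2, and \<open>op_sqrt X\<close> is the modulus of Z.\<close>
  define X where "X x = x - Z (Z x)" for x
  have blX: "bounded_linear X"
    unfolding X_def by (intro bounded_linear_sub bounded_linear_ident bounded_linear_compose[OF blZ blZ])
  have symmX: "inner (X x) y = inner x (X y)" for x y
    by (simp add: X_def inner_diff symm)
  have contrX: "norm (X x) \<le> norm x" for x
  proof -
    have "(norm (X x))\<^sup>2 = (norm x)\<^sup>2 - 2 * (norm (Z x))\<^sup>2 + (norm (Z (Z x)))\<^sup>2"
      by (simp add: X_def power2_norm_eq_inner inner_diff inner_commute symm)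
    also have "\<dots> \<le> (norm x)\<^sup>2"
      using power_mono[OF contr[of "Z x"] norm_ge_zero, of 2] zero_le_power2[of "norm (Z x)"] by linarith
    finally show ?thesis by (rule power2_le_imp_le) simp
  qed
  define S where "S = op_sqrt X"
  note facts = blX symmX contrX
  interpret S: bounded_linear S unfolding S_def by (rule bounded_linear_op_sqrt[OF facts])
  have SS: "S (S x) = Z (Z x)" for x
    unfolding S_def by (simp add: op_sqrt_square[OF facts]) (simp add: X_def)
  have S_symm: "inner (S x) y = inner x (S y)" for x y
    unfolding S_def by (rule op_sqrt_symm[OF facts])
  have S_nonneg: "0 \<le> inner (S x) x" for x
    unfolding S_def by (rule op_sqrt_nonneg[OF facts])
  have S_comm: "T (S x) = S (T x)" if "bounded_linear T" "\<And>x. T (Z x) = Z (T x)" for T x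
  proof -
    interpret T: bounded_linear T by (rule that)
    show ?thesis unfolding S_def
      by (rule op_sqrt_commute[OF facts that(1)]) (simp add: X_def T.diff that)
  qed
  have SZ: "S (Z x) = Z (S x)" for x
    using S_comm[OF blZ] by simp
  define M where "M = {x. S x + Z x = 0}"
  have "closed M"
    unfolding M_def
    by (intro closed_Collect_eq continuous_intros S.continuous_on Z.continuous_on)
  moreover have "csubspace M"
    unfolding csubspace_def M_def
  proof (safe)
    fix c x assume "S x + Z x = 0"
    moreover have "S (c *\<^sub>C x) = c *\<^sub>C S x"
      using S_comm[OF bounded_linear_scaleC[of c]] by (simp add: ZC)
    ultimately show "S (c *\<^sub>C x) + Z (c *\<^sub>C x) = 0"
      by (simp add: ZC scaleC_zero_right flip: scaleC_add_right)
  next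
    fix x y assume "S x + Z x = 0" "S y + Z y = 0"
    then have "(S x + Z x) + (S y + Z y) = 0" by simp
    then show "S (x + y) + Z (x + y) = 0"
      by (simp add: S.add Z.add algebra_simps)
  qed (simp add: S.zero Z.zero)
  ultimately obtain P where "proj_range P = M"
    using proj_exists by blast
  then have P: "P \<cdot> x = x \<longleftrightarrow> S x + Z x = 0" for x
    unfolding proj_range_iff[symmetric] by (simp add: M_def)
  show thesis
  proof
    show "inner (Z x) x \<le> 0" if "P \<cdot> x = x" for x
    proof -
      have "Z x = - S x" using that P by (simp add: eq_neg_iff_add_eq_0 add.commute)
      then show ?thesis using S_nonneg[of x] by simp
    qed
    have eq: "inner (Z x) x = inner (S x) x" if "P \<cdot> x = 0" for x
    proof -
      \<comment> \<open>\<open>(S + Z) (S - Z) = 0\<close>, so \<open>(S - Z) x\<close> lies in the range of \<open>P\<close>.\<close>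
      have "S (S x - Z x) + Z (S x - Z x) = 0"
        by (simp add: S.diff Z.diff SS SZ)
      then have "inner (S x - Z x) x = 0"
        by (metis P inner_zero_right proj_inner that)
      then show ?thesis by (simp add: inner_diff_left)
    qed
    show "0 \<le> inner (Z x) x" if "P \<cdot> x = 0" for x
      using eq[OF that] S_nonneg[of x] by simp
    show "x = 0" if x: "P \<cdot> x = 0" "inner (Z x) x = 0" for x
    proof -
      have S0: "inner (S x) x = 0" using eq[OF x(1)] x(2) by simp
      \<comment> \<open>Cauchy-Schwarz for the form of \<open>S\<close> at \<open>x\<close> and
        \<open>S x\<close>: where a nonnegative form vanishes, its operator vanishes too.\<close>
      have "(inner (S x) (S x))\<^sup>2 \<le> inner (S x) x * inner (S (S x)) (S x)"
      proof (rule discriminant_nonpos[OF S_nonneg])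
        fix t
        show "0 \<le> inner (S x) x + 2 * t * inner (S x) (S x) + t\<^sup>2 * inner (S (S x)) (S x)"
          using S_nonneg[of "x + t *\<^sub>R S x"]
          by (simp add: S.add S.scaleR inner_add inner_commute S_symm algebra_simps power2_eq_square)
      qed
      then have "S x = 0" using S0 by simp
      then have "inner (Z x) (Z x) = 0" using SS[of x] by (simp add: symm)
      with \<open>S x = 0\<close> have "P \<cdot> x = x" by (simp add: P)
      then show "x = 0" using x by simp
    qed
    show "T (P \<cdot> x) = P \<cdot> T x"
      if T: "bounded_linear T" "bounded_linear T'" "\<And>x y. inner (T x) y = inner x (T' y)"
        "\<And>x. T (Z x) = Z (T x)" "\<And>x. T' (Z x) = Z (T' x)" for T T' x
    proof (rule proj_commute_of_invariant[OF T(3) bounded_linear.linear[OF T(1)]])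
      have inv: "P \<cdot> U x = U x" if "bounded_linear U" "\<And>x. U (Z x) = Z (U x)" "P \<cdot> x = x" for U x
      proof -
        interpret U: bounded_linear U by (rule that)
        have "S (U x) + Z (U x) = U (S x + Z x)"
          by (simp add: S_comm[OF that(1,2)] that(2) U.add)
        then show ?thesis using that(3) by (simp add: P U.zero)
      qed
      show "P \<cdot> T x = T x" "P \<cdot> T' x = T' x" if "P \<cdot> x = x" for x
        using inv T that by blast+
    qed
  qed
qed

section \<open>Self-adjoint operators\<close>

lemma inner_scaleC_left: "inner (c *\<^sub>C x) y = inner x (cnj c *\<^sub>C (y::'a::complex_hilbert_space))"
  by (simp add: inner_eq_Re_cinner cinner_scaleC_left cinner_scaleC_right)

lemma inner_scaleC_i_self: "inner x (\<i> *\<^sub>C x) = 0" for x :: "'a::complex_hilbert_space"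
  using inner_scaleC_i[of x x] by (simp add: inner_commute)

lemma dense_orthogonal_eq_zero:
  fixes u :: "'a::real_inner"
  assumes "closure D = UNIV" "\<And>x. x \<in> D \<Longrightarrow> inner x u = 0"
  shows "u = 0"
proof -
  have "closure D \<subseteq> {x. inner x u = 0}"
    by (intro closure_minimal closed_Collect_eq continuous_intros) (use assms in auto)
  then have "inner u u = 0" using assms(1) by blast
  then show ?thesis by simp
qed

text \<open>The inclusion S A \<subseteq> A S, the usual sense of commuting for an everywhere
  defined S and an unbounded A: S maps the domain into itself.\<close>

definition op_commutes :: "('a \<rightharpoonup> 'a) \<Rightarrow> ('a \<Rightarrow> 'a) \<Rightarrow> bool" where
  "op_commutes A S \<longleftrightarrow> (\<forall>x y. A x = Some y \<longrightarrow> A (S x) = Some (S y))"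

lemma linear_operator_iff:
  "linear_operator A \<longleftrightarrow> A 0 = Some 0 \<and>
    (\<forall>x y u v. A x = Some y \<longrightarrow> A u = Some v \<longrightarrow> A (x + u) = Some (y + v)) \<and>
    (\<forall>c x y. A x = Some y \<longrightarrow> A (c *\<^sub>C x) = Some (c *\<^sub>C y))"
proof
  assume L: "linear_operator A"
  have add: "A (x + u) = Some (y + v)" if "A x = Some y" "A u = Some v" for x y u v
  proof -
    have "x + u \<in> dom A" "the (A (x + u)) = y + v"
      using L that unfolding linear_operator_def csubspace_def by (auto simp: domIff)
    then show ?thesis by auto
  qed
  moreover have "A (c *\<^sub>C x) = Some (c *\<^sub>C y)" if "A x = Some y" for c x y
  proof -
    have "c *\<^sub>C x \<in> dom A" "the (A (c *\<^sub>C x)) = c *\<^sub>C y"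
      using L that unfolding linear_operator_def csubspace_def by (auto simp: domIff)
    then show ?thesis by auto
  qed
  moreover have "A 0 = Some 0"
  proof -
    obtain y where y: "A 0 = Some y"
      using L unfolding linear_operator_def csubspace_def by auto
    with add[OF y y] show ?thesis by simp
  qed
  ultimately show "A 0 = Some 0 \<and>
    (\<forall>x y u v. A x = Some y \<longrightarrow> A u = Some v \<longrightarrow> A (x + u) = Some (y + v)) \<and>
    (\<forall>c x y. A x = Some y \<longrightarrow> A (c *\<^sub>C x) = Some (c *\<^sub>C y))"
    by blast
next
  assume "A 0 = Some 0 \<and>
    (\<forall>x y u v. A x = Some y \<longrightarrow> A u = Some v \<longrightarrow> A (x + u) = Some (y + v)) \<and>
    (\<forall>c x y. A x = Some y \<longrightarrow> A (c *\<^sub>C x) = Some (c *\<^sub>C y))"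
  then show "linear_operator A"
    unfolding linear_operator_def csubspace_def by (fastforce simp: dom_def)
qed

text \<open>Real parts suffice because the domain is closed under multiplication by i, which
  recovers the imaginary parts. Density makes \<open>z\<close> unique, so the description inside
  \<open>operator_adjoint\<close> denotes it.\<close>

lemma operator_adjoint_eq_Some_iff:
  assumes "linear_operator A" "densely_defined A"
  shows "operator_adjoint A w = Some z \<longleftrightarrow> (\<forall>x y. A x = Some y \<longrightarrow> inner y w = inner x z)"
proof -
  have eq: "(\<forall>x\<in>dom A. cinner (the (A x)) w = cinner x z) \<longleftrightarrow>
      (\<forall>x y. A x = Some y \<longrightarrow> inner y w = inner x z)" for w z
  proof
    assume "\<forall>x\<in>dom A. cinner (the (A x)) w = cinner x z"
    then have "A x = Some y \<Longrightarrow> cinner y w = cinner x z" for x y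
      by (force simp: dom_def)
    then show "\<forall>x y. A x = Some y \<longrightarrow> inner y w = inner x z"
      by (simp add: inner_eq_Re_cinner)
  next
    assume R: "\<forall>x y. A x = Some y \<longrightarrow> inner y w = inner x z"
    show "\<forall>x\<in>dom A. cinner (the (A x)) w = cinner x z"
    proof
      fix x assume "x \<in> dom A"
      then obtain y where y: "A x = Some y" by blast
      then have "A (\<i> *\<^sub>C x) = Some (\<i> *\<^sub>C y)"
        using assms(1) by (simp add: linear_operator_iff)
      then have "inner (\<i> *\<^sub>C y) w = inner (\<i> *\<^sub>C x) z" using R by blast
      with R y show "cinner (the (A x)) w = cinner x z"
        by (simp add: cinner_eq_inner inner_scaleC_i)
    qed
  qed
  have uniq: "z = z'" if "\<forall>x\<in>dom A. cinner (the (A x)) w = cinner x z"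
    "\<forall>x\<in>dom A. cinner (the (A x)) w = cinner x z'" for z z'
  proof -
    have "z - z' = 0"
    proof (rule dense_orthogonal_eq_zero[of "dom A"])
      show "closure (dom A) = UNIV" using assms(2) by (simp add: densely_defined_def)
      fix x assume "x \<in> dom A"
      then have "cinner x z = cinner x z'" using that by metis
      then show "inner x (z - z') = 0" by (simp add: inner_diff_right) (simp add: inner_eq_Re_cinner)
    qed
    then show ?thesis by simp
  qed
  show ?thesis
  proof (cases "\<exists>z. \<forall>x\<in>dom A. cinner (the (A x)) w = cinner x z")
    case True
    then obtain z0 where z0: "\<forall>x\<in>dom A. cinner (the (A x)) w = cinner x z0" by blast
    then have "(THE z. \<forall>x\<in>dom A. cinner (the (A x)) w = cinner x z) = z0"
      by (rule the_equality) (rule uniq[OF _ z0])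
    then have "operator_adjoint A w = Some z0"
      using True by (simp add: operator_adjoint_def)
    then show ?thesis
      unfolding eq[symmetric] using z0 uniq by (metis option.inject)
  next
    case False
    then have "operator_adjoint A w = None"
      unfolding operator_adjoint_def by (rule if_not_P)
    with False show ?thesis
      unfolding eq[symmetric] by force
  qed
qed

lemma self_adjoint_iff:
  "self_adjoint A \<longleftrightarrow> linear_operator A \<and> densely_defined A \<and>
     (\<forall>w z. A w = Some z \<longleftrightarrow> (\<forall>x y. A x = Some y \<longrightarrow> inner y w = inner x z))"
proof (cases "linear_operator A \<and> densely_defined A")
  case True
  have "operator_adjoint A = A \<longleftrightarrow> (\<forall>w z. A w = Some z \<longleftrightarrow> operator_adjoint A w = Some z)"
    by (metis ext not_Some_eq)
  with True show ?thesis
    by (simp add: self_adjoint_def operator_adjoint_eq_Some_iff)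
qed (auto simp: self_adjoint_def)

locale self_adjoint_op =
  fixes A :: "'a::complex_hilbert_space \<rightharpoonup> 'a"
  assumes sa: "self_adjoint A"
begin

lemma zero: "A 0 = Some 0"
  and add: "A x = Some y \<Longrightarrow> A u = Some v \<Longrightarrow> A (x + u) = Some (y + v)"
  and scaleC: "A x = Some y \<Longrightarrow> A (c *\<^sub>C x) = Some (c *\<^sub>C y)"
  using sa unfolding self_adjoint_iff linear_operator_iff by blast+

lemma scaleR: "A x = Some y \<Longrightarrow> A (r *\<^sub>R x) = Some (r *\<^sub>R y)"
  using scaleC[of x y "of_real r"] by (simp add: scaleC_of_real)

lemma diff: "A x = Some y \<Longrightarrow> A u = Some v \<Longrightarrow> A (x - u) = Some (y - v)"
  using add[of x y "- u" "- v"] scaleR[of u v "-1"] by simp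

lemma symm: "A x = Some y \<Longrightarrow> A u = Some v \<Longrightarrow> inner y u = inner x v"
  using sa unfolding self_adjoint_iff by blast

lemma maximal: "(\<And>x y. A x = Some y \<Longrightarrow> inner y w = inner x z) \<Longrightarrow> A w = Some z"
  using sa unfolding self_adjoint_iff by blast

lemma dense: "closure (dom A) = UNIV"
  using sa unfolding self_adjoint_iff densely_defined_def by blast

lemma dom_approx:
  obtains f g where "f \<longlonglongrightarrow> x" "\<And>n. A (f n) = Some (g n)"
proof -
  have "x \<in> closure (dom A)" by (simp add: dense)
  then obtain f where f: "\<And>n. f n \<in> dom A" "f \<longlonglongrightarrow> x"
    unfolding closure_sequential by blast
  then have "\<forall>n. \<exists>y. A (f n) = Some y" by blast
  with f(2) that show thesis by metis
qed

lemma closed_seq: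
  assumes "\<And>n. A (f n) = Some (g n)" "f \<longlonglongrightarrow> x" "g \<longlonglongrightarrow> y"
  shows "A x = Some y"
proof (rule maximal)
  fix u v assume "A u = Some v"
  then have "(\<lambda>n. inner v (f n)) = (\<lambda>n. inner u (g n))"
    using symm[OF _ assms(1)] by auto
  moreover have "(\<lambda>n. inner v (f n)) \<longlonglongrightarrow> inner v x" "(\<lambda>n. inner u (g n)) \<longlonglongrightarrow> inner u y"
    by (intro tendsto_intros assms)+
  ultimately show "inner v x = inner u y"
    by (metis LIMSEQ_unique)
qed

section \<open>Non-real shifts and resolvents\<close>

lemma symm_scaleC_i:
  assumes "A x = Some y"
  shows "inner y (\<i> *\<^sub>C x) = 0"
proof -
  have "inner y (\<i> *\<^sub>C x) = inner x (\<i> *\<^sub>C y)"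
    by (intro symm scaleC assms)
  moreover have "inner y (\<i> *\<^sub>C x) = - inner x (\<i> *\<^sub>C y)"
    by (subst inner_commute) (rule inner_scaleC_i)
  ultimately show ?thesis by linarith
qed

text \<open>Pythagoras: the form of a symmetric operator is real, so
  \<open>y - Re c *\<^sub>R x\<close> is orthogonal to i x.\<close>

lemma norm_shift:
  assumes "A x = Some y"
  shows "(norm (y - c *\<^sub>C x))\<^sup>2 = (norm (y - Re c *\<^sub>R x))\<^sup>2 + (Im c)\<^sup>2 * (norm x)\<^sup>2"
proof -
  let ?u = "y - Re c *\<^sub>R x" and ?v = "\<i> *\<^sub>C x"
  have o: "inner ?u ?v = 0"
    by (simp add: inner_diff_left symm_scaleC_i[OF assms] inner_scaleC_i_self)
  have "y - c *\<^sub>C x = ?u - Im c *\<^sub>R ?v"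
    by (subst scaleC_eq) simp
  then have "(norm (y - c *\<^sub>C x))\<^sup>2 = (norm ?u)\<^sup>2 + (norm (Im c *\<^sub>R ?v))\<^sup>2"
    using o by (simp only: power2_norm_eq_inner) (simp add: inner_diff inner_commute)
  then show ?thesis by (simp add: norm_scaleC power_mult_distrib)
qed

lemma norm_shift_ge: "A x = Some y \<Longrightarrow> \<bar>Im c\<bar> * norm x \<le> norm (y - c *\<^sub>C x)"
  by (rule power2_le_imp_le) (simp_all add: norm_shift power_mult_distrib)

text \<open>The lower bound \<open>norm_shift_ge\<close> makes the range of A - c closed. A vector
  orthogonal to it is, because A contains its adjoint, an eigenvector for \<open>cnj c\<close>, and
  the same bound excludes non-real eigenvalues.\<close>

lemma range_shift:
  assumes c: "Im c \<noteq> 0"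
  shows "\<exists>x y. A x = Some y \<and> w = y - c *\<^sub>C x"
proof -
  define D where "D = {y - c *\<^sub>C x | x y. A x = Some y}"
  have "closed D"
  unfolding closed_sequential_limits
  proof safe
    fix f l assume f: "\<forall>n. f n \<in> D" "f \<longlonglongrightarrow> l"
    then have "\<forall>n. \<exists>x y. A x = Some y \<and> f n = y - c *\<^sub>C x" unfolding D_def by blast
    then obtain x y where xy: "\<And>n. A (x n) = Some (y n)" "\<And>n. f n = y n - c *\<^sub>C x n" by metis
    have le: "\<bar>Im c\<bar> * norm (x m - x n) \<le> norm (f m - f n)" for m n
      using norm_shift_ge[OF diff[OF xy(1)[of m] xy(1)[of n]], of c]
      by (simp add: xy(2) scaleC_diff_right algebra_simps)
    have "Cauchy x"
    proof (rule CauchyI)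
      fix e :: real assume "e > 0"
      then have "\<bar>Im c\<bar> * e > 0" using c by simp
      then obtain M where M: "\<And>m n. m \<ge> M \<Longrightarrow> n \<ge> M \<Longrightarrow> norm (f m - f n) < \<bar>Im c\<bar> * e"
        using CauchyD[OF LIMSEQ_imp_Cauchy[OF f(2)]] by metis
      have "norm (x m - x n) < e" if "m \<ge> M" "n \<ge> M" for m n
        using le_less_trans[OF le M[OF that]] c by simp
      then show "\<exists>M. \<forall>m\<ge>M. \<forall>n\<ge>M. norm (x m - x n) < e" by blast
    qed
    then obtain x0 where x0: "x \<longlonglongrightarrow> x0" using Cauchy_convergent convergent_def by blast
    have cx: "(\<lambda>n. c *\<^sub>C x n) \<longlonglongrightarrow> c *\<^sub>C x0"
      by (rule bounded_linear.tendsto[OF bounded_linear_scaleC x0])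
    have "y = (\<lambda>n. f n + c *\<^sub>C x n)" by (simp add: xy(2))
    then have "y \<longlonglongrightarrow> l + c *\<^sub>C x0" using tendsto_add[OF f(2) cx] by simp
    from closed_seq[OF xy(1) x0 this] show "l \<in> D"
      unfolding D_def
      by (intro CollectI exI[of _ x0] exI[of _ "l + c *\<^sub>C x0"]) simp
  qed
  moreover have "subspace D"
    unfolding subspace_def
  proof (intro conjI ballI allI)
    show "0 \<in> D" unfolding D_def
      by (intro CollectI exI[of _ 0]) (simp add: zero scaleC_zero_right)
    fix a assume "a \<in> D"
    then obtain x y where x: "A x = Some y" "a = y - c *\<^sub>C x" by (auto simp: D_def)
    show "r *\<^sub>R a \<in> D" for r
      unfolding D_def using scaleR[OF x(1), of r] x(2)
      by (intro CollectI exI[of _ "r *\<^sub>R x"] exI[of _ "r *\<^sub>R y"])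
        (simp add: scaleC_diff_right scaleC_scaleC mult.commute flip: scaleC_of_real)
    fix b assume "b \<in> D"
    then obtain u v where "A u = Some v" "b = v - c *\<^sub>C u" by (auto simp: D_def)
    then show "a + b \<in> D"
      unfolding D_def using add[OF x(1), of u v] x(2)
      by (intro CollectI exI[of _ "x + u"] exI[of _ "y + v"]) (simp add: scaleC_add_right)
  qed
  ultimately obtain p where p: "p \<in> D" "\<And>z. z \<in> D \<Longrightarrow> inner (w - p) z = 0"
    using orthogonal_projection_exists by blast
  have "A (w - p) = Some (cnj c *\<^sub>C (w - p))"
  proof (rule maximal)
    fix x y assume xy: "A x = Some y"
    then have "inner (w - p) (y - c *\<^sub>C x) = 0" by (intro p) (auto simp: D_def)
    then show "inner y (w - p) = inner x (cnj c *\<^sub>C (w - p))"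
      by (simp add: inner_diff_right inner_commute flip: inner_scaleC_left)
  qed
  from norm_shift_ge[OF this, of "cnj c"] c have "w - p = 0"
    by (simp add: mult_le_0_iff)
  with p(1) show ?thesis by (auto simp: D_def)
qed

lemma shift_inject:
  assumes "Im c \<noteq> 0" "A x = Some y" "A u = Some v" "y - c *\<^sub>C x = v - c *\<^sub>C u"
  shows "x = u"
proof -
  have "(y - v) - c *\<^sub>C (x - u) = 0"
    using assms(4) by (simp add: scaleC_diff_right algebra_simps)
  with norm_shift_ge[OF diff[OF assms(2,3)], of c] assms(1) show ?thesis
    by (simp add: mult_le_0_iff)
qed

text \<open>The inverse of A - c for c off the real axis.\<close>

definition resolvent :: "complex \<Rightarrow> 'a \<Rightarrow> 'a" where
  "resolvent c w = (SOME x. A x = Some (w + c *\<^sub>C x))"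

context
  fixes c :: complex
  assumes c: "Im c \<noteq> 0"
begin

lemma resolvent_right: "A (resolvent c w) = Some (w + c *\<^sub>C resolvent c w)"
proof -
  obtain x y where "A x = Some y" "w = y - c *\<^sub>C x"
    using range_shift[OF c, of w] by blast
  then have "A x = Some (w + c *\<^sub>C x)" by simp
  then show ?thesis unfolding resolvent_def by (rule someI)
qed

lemma resolvent_eqI: "A x = Some (w + c *\<^sub>C x) \<Longrightarrow> resolvent c w = x"
  by (rule shift_inject[OF c resolvent_right[of w]]) (assumption, simp only: add_diff_cancel)

lemma resolvent_add: "resolvent c (x + y) = resolvent c x + resolvent c y"
  using add[OF resolvent_right[of x] resolvent_right[of y]]
  by (intro resolvent_eqI) (simp add: scaleC_add_right algebra_simps)

lemma resolvent_scaleC: "resolvent c (d *\<^sub>C x) = d *\<^sub>C resolvent c x"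
  using scaleC[OF resolvent_right[of x], of d]
  by (intro resolvent_eqI) (simp add: scaleC_add_right scaleC_scaleC mult.commute)

lemma norm_resolvent: "\<bar>Im c\<bar> * norm (resolvent c x) \<le> norm x"
  using norm_shift_ge[OF resolvent_right, of c x] by simp

lemma bounded_linear_resolvent: "bounded_linear (resolvent c)"
proof (rule bounded_linear_intro[where K = "1 / \<bar>Im c\<bar>"])
  show "resolvent c (r *\<^sub>R x) = r *\<^sub>R resolvent c x" for r x
    using resolvent_scaleC[of "of_real r" x] by (simp add: scaleC_of_real)
  show "norm (resolvent c x) \<le> norm x * (1 / \<bar>Im c\<bar>)" for x
    using norm_resolvent[of x] c by (simp add: field_simps)
qed (rule resolvent_add)

lemma resolvent_commute:
  assumes "op_commutes A S" "linear S" "\<And>x. S (c *\<^sub>C x) = c *\<^sub>C S x"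
  shows "resolvent c (S w) = S (resolvent c w)"
proof (rule resolvent_eqI)
  have "A (S (resolvent c w)) = Some (S (w + c *\<^sub>C resolvent c w))"
    using assms(1) resolvent_right by (simp add: op_commutes_def)
  then show "A (S (resolvent c w)) = Some (S w + c *\<^sub>C S (resolvent c w))"
    by (simp add: linear_add[OF assms(2)] assms(3))
qed

text \<open>One resolvent is enough: any x in the domain is \<open>resolvent c w\<close> with w = (A
  - c) x, so S x = \<open>resolvent c (S w)\<close> lies in the domain again.\<close>

lemma op_commutesI:
  assumes "\<And>w. resolvent c (S w) = S (resolvent c w)" "linear S" "\<And>x. S (c *\<^sub>C x) = c *\<^sub>C S x"
  shows "op_commutes A S"
  unfolding op_commutes_def
proof (intro allI impI)
  fix x y assume xy: "A x = Some y"
  let ?w = "y - c *\<^sub>C x"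
  have x: "resolvent c ?w = x" using xy by (intro resolvent_eqI) simp
  then have "resolvent c (S ?w) = S x" by (simp add: assms(1))
  with resolvent_right[of "S ?w"] have "A (S x) = Some (S ?w + c *\<^sub>C S x)" by simp
  then show "A (S x) = Some (S y)"
    by (simp add: linear_diff[OF assms(2)] assms(3))
qed

end

lemma resolvent_op_commutes:
  assumes "Im d \<noteq> 0"
  shows "op_commutes A (resolvent d)"
  unfolding op_commutes_def
proof (intro allI impI)
  fix x y assume xy: "A x = Some y"
  have "resolvent d (y - d *\<^sub>C x) = x"
    using xy by (intro resolvent_eqI assms) simp
  then have "resolvent d y = x + d *\<^sub>C resolvent d x"
    using resolvent_add[OF assms, of "y - d *\<^sub>C x" "d *\<^sub>C x"] by (simp add: resolvent_scaleC[OF assms])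
  with resolvent_right[OF assms, of x] show "A (resolvent d x) = Some (resolvent d y)"
    by simp
qed

lemma resolvent_adjoint:
  assumes "Im c \<noteq> 0"
  shows "inner (resolvent c w) v = inner w (resolvent (cnj c) v)"
proof -
  let ?x = "resolvent c w" and ?u = "resolvent (cnj c) v"
  have "Im (cnj c) \<noteq> 0" using assms by simp
  from symm[OF resolvent_right[OF assms, of w] resolvent_right[OF this, of v]]
  show ?thesis
    by (simp add: inner_add_left inner_add_right inner_scaleC_left)
qed

end

text \<open>Both inequalities are weak, so eigenvectors for t may go to either side and a single cut
  at t is not determined. In exchange, the projections of a spectral family satisfy them by a direct
  estimate (\<open>cut_family_op\<close>); right continuity of the family later removes the
  ambiguity.\<close>

definition spectral_cut :: "('a::complex_hilbert_space \<rightharpoonup> 'a) \<Rightarrow> real \<Rightarrow> 'a proj \<Rightarrow> bool" where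
  "spectral_cut A t P \<longleftrightarrow> op_commutes A (proj_apply P) \<and>
     (\<forall>x y. A x = Some y \<longrightarrow> P \<cdot> x = x \<longrightarrow> inner y x \<le> t * (norm x)\<^sup>2) \<and>
     (\<forall>x y. A x = Some y \<longrightarrow> P \<cdot> x = 0 \<longrightarrow> t * (norm x)\<^sup>2 \<le> inner y x)"

text \<open>For w = (A - c) x the form of Z at w equals the form of A - t at x, so a projection that
  separates the signs of Z separates those of A - t. A projection that commutes with A commutes with
  both resolvents, hence with Z and with P.\<close>

lemma (in self_adjoint_op) central_cut_exists:
  obtains P where "spectral_cut A t P"
    and "\<And>x y. A x = Some y \<Longrightarrow> P \<cdot> x = 0 \<Longrightarrow> inner y x = t * (norm x)\<^sup>2 \<Longrightarrow> x = 0"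
    and "\<And>S x. op_commutes A (proj_apply S) \<Longrightarrow> S \<cdot> P \<cdot> x = P \<cdot> S \<cdot> x"
proof -
  \<comment> \<open>A - c is then A - t + i. As the imaginary part has modulus 1, both resolvents
    are contractions, and so is their mean Z.\<close>
  define c where "c = Complex t (- 1)"
  have c: "Im c \<noteq> 0" "Im (cnj c) \<noteq> 0" by (auto simp: c_def)
  let ?R = "resolvent c" and ?R' = "resolvent (cnj c)"
  interpret R: bounded_linear ?R by (rule bounded_linear_resolvent[OF c(1)])
  interpret R': bounded_linear ?R' by (rule bounded_linear_resolvent[OF c(2)])
  define Z where "Z w = (1/2) *\<^sub>R (?R w + ?R' w)" for w
  have Z_bl: "bounded_linear Z"
    unfolding Z_def by (intro bounded_linear_const_scaleR bounded_linear_add R.bounded_linear_axioms R'.bounded_linear_axioms)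
  have Z_C: "Z (d *\<^sub>C x) = d *\<^sub>C Z x" for d x
    by (simp add: Z_def resolvent_scaleC[OF c(1)] resolvent_scaleC[OF c(2)] scaleC_add_right
        scaleC_scaleC mult.commute flip: scaleC_of_real)
  have Z: "bounded_clinear Z" using Z_bl Z_C by (simp add: bounded_clinear_def)
  have Z_symm: "inner (Z x) y = inner x (Z y)" for x y
    using resolvent_adjoint[OF c(1)] resolvent_adjoint[OF c(2)]
    by (simp add: Z_def inner_add algebra_simps)
  have Z_contr: "norm (Z x) \<le> norm x" for x
  proof -
    have "norm (?R x + ?R' x) \<le> norm x + norm x"
      using norm_resolvent[OF c(1), of x] norm_resolvent[OF c(2), of x]
      by (intro norm_triangle_le) (simp add: c_def)
    then show ?thesis by (simp add: Z_def)
  qed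
  obtain P where P: "\<And>x. P \<cdot> x = x \<Longrightarrow> inner (Z x) x \<le> 0"
    "\<And>x. P \<cdot> x = 0 \<Longrightarrow> 0 \<le> inner (Z x) x"
    "\<And>x. P \<cdot> x = 0 \<Longrightarrow> inner (Z x) x = 0 \<Longrightarrow> x = 0"
    "\<And>T T' x. bounded_linear T \<Longrightarrow> bounded_linear T' \<Longrightarrow>
      (\<And>x y. inner (T x) y = inner x (T' y)) \<Longrightarrow>
      (\<And>x. T (Z x) = Z (T x)) \<Longrightarrow> (\<And>x. T' (Z x) = Z (T' x)) \<Longrightarrow> T (P \<cdot> x) = P \<cdot> T x"
    using sign_projection_exists[OF Z Z_symm Z_contr] by blast
  have RR': "?R' (?R x) = ?R (?R' x)" for x
    using resolvent_commute[OF c(2) resolvent_op_commutes[OF c(1)] R.linear_axioms] resolvent_scaleC[OF c(1)]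
    by simp
  have "?R (P \<cdot> x) = P \<cdot> ?R x" for x
    by (rule P(4)[OF R.bounded_linear_axioms R'.bounded_linear_axioms resolvent_adjoint[OF c(1)]])
      (simp_all add: Z_def R.scaleR R.add R'.scaleR R'.add RR')
  then have RP: "op_commutes A (proj_apply P)"
    by (intro op_commutesI[OF c(1)] proj_linear proj_scaleC)
  have form: "inner y x - t * (norm x)\<^sup>2 = inner (Z w) w \<and> w = y - c *\<^sub>C x"
    if "A x = Some y" "w = y - c *\<^sub>C x" for x y w
  proof -
    have x: "?R w = x" using that by (intro resolvent_eqI c) simp
    have "inner w (?R w) = inner w (?R' w)"
      by (metis inner_commute resolvent_adjoint[OF c(1)])
    then have "inner (Z w) w = inner w x"
      using x by (simp add: Z_def inner_add inner_commute)
    also have "\<dots> = inner y x - t * (norm x)\<^sup>2"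
      using that(2) scaleC_eq[of c x]
      by (simp add: c_def inner_diff inner_add inner_commute inner_scaleC_i_self power2_norm_eq_inner)
    finally show ?thesis using that(2) by simp
  qed
  show thesis
  proof
    \<comment> \<open>As P commutes with A, it fixes or kills w = (A - c) x whenever it fixes or
      kills x; this carries the statements about Z at w over to A at x.\<close>
    have Pw: "P \<cdot> (y - c *\<^sub>C x) = z - c *\<^sub>C P \<cdot> x" if "A (P \<cdot> x) = Some z" "A x = Some y" for x y z
      using RP that by (auto simp: op_commutes_def proj_diff proj_scaleC)
    show "spectral_cut A t P"
      unfolding spectral_cut_def
    proof (intro conjI allI impI RP)
      fix x y assume xy: "A x = Some y" "P \<cdot> x = x"
      then show "inner y x \<le> t * (norm x)\<^sup>2"
        using form[OF xy(1) refl] P(1)[of "y - c *\<^sub>C x"] Pw[of x y y] by simp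
    next
      fix x y assume xy: "A x = Some y" "P \<cdot> x = 0"
      then show "t * (norm x)\<^sup>2 \<le> inner y x"
        using form[OF xy(1) refl] P(2)[of "y - c *\<^sub>C x"] Pw[of x 0 y]
        by (simp add: zero scaleC_zero_right)
    qed
    show "x = 0" if xy: "A x = Some y" "P \<cdot> x = 0" "inner y x = t * (norm x)\<^sup>2" for x y
    proof -
      have "y - c *\<^sub>C x = 0"
        using form[OF xy(1) refl] P(3)[of "y - c *\<^sub>C x"] Pw[of x 0 y] xy
        by (simp add: zero scaleC_zero_right)
      then show ?thesis
        using shift_inject[OF c(1) xy(1) zero] by (simp add: scaleC_zero_right)
    qed
    show "S \<cdot> P \<cdot> x = P \<cdot> S \<cdot> x" if S: "op_commutes A (proj_apply S)" for S x
    proof (rule P(4)[OF proj_bounded_linear proj_bounded_linear proj_inner])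
      show "S \<cdot> Z x = Z (S \<cdot> x)" for x
        using resolvent_commute[OF c(1) S proj_linear proj_scaleC]
          resolvent_commute[OF c(2) S proj_linear proj_scaleC]
        by (simp add: Z_def proj_scaleR proj_add)
      then show "S \<cdot> Z x = Z (S \<cdot> x)" for x .
    qed
  qed
qed

section \<open>Form bounds on reducing subspaces and the comparison of cuts\<close>

context self_adjoint_op
begin

lemma op_commutes_limit:
  assumes "\<And>n. op_commutes A (S n)" "\<And>x. (\<lambda>n. S n x) \<longlonglongrightarrow> T x"
  shows "op_commutes A T"
  unfolding op_commutes_def
proof (intro allI impI)
  fix x y assume "A x = Some y"
  then have "A (S n x) = Some (S n y)" for n
    using assms(1) by (simp add: op_commutes_def)
  then show "A (T x) = Some (T y)"
    by (rule closed_seq) (rule assms(2))+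
qed

lemma op_commutes_diff: "op_commutes A S \<Longrightarrow> op_commutes A T \<Longrightarrow> op_commutes A (\<lambda>x. S x - T x)"
  by (simp add: op_commutes_def diff)

lemma op_commutes_id: "op_commutes A (\<lambda>x. x)"
  by (simp add: op_commutes_def)

lemma bounded_linear_zero_on_dom:
  assumes "bounded_linear T" "\<And>x y. A x = Some y \<Longrightarrow> T x = 0"
  shows "T x = 0"
proof -
  obtain f g where f: "f \<longlonglongrightarrow> x" "\<And>n. A (f n) = Some (g n)"
    using dom_approx[of x] by blast
  have "(\<lambda>n. T (f n)) \<longlonglongrightarrow> T x"
    by (rule bounded_linear.tendsto[OF assms(1) f(1)])
  moreover have "T (f n) = 0" for n using assms(2) f(2) by blast
  ultimately show ?thesis by (simp add: LIMSEQ_const_iff)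
qed

text \<open>A bound on the form over a reducing subspace becomes a bound on the operator, as for
  bounded symmetric operators. \<open>K\<close> will be a spectral band, and on a short band A is
  nearly the scalar a.\<close>

lemma form_bounded_dom:
  assumes K: "op_commutes A K" "bounded_linear K" "K u = u" "A u = Some v"
    and idem: "\<And>x. K (K x) = K x"
    and bd: "\<And>x y. A x = Some y \<Longrightarrow> K x = x \<Longrightarrow> a * (norm x)\<^sup>2 \<le> inner y x \<and> inner y x \<le> b * (norm x)\<^sup>2"
    and ab: "a \<le> b"
  shows "norm (v - a *\<^sub>R u) \<le> (b - a) * norm u"
proof -
  interpret K: bounded_linear K by (rule K(2))
  define w where "w = v - a *\<^sub>R u"
  have "K v = v" using K by (metis op_commutes_def option.inject)
  then have Kw: "K w = w" using K(3) by (simp add: w_def K.diff K.scaleR)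
  have form: "0 \<le> inner (y - a *\<^sub>R x) x" "inner (y - a *\<^sub>R x) x \<le> (b - a) * (norm x)\<^sup>2"
    if "A x = Some y" "K x = x" for x y
    using bd[OF that] by (simp_all add: inner_diff_left power2_norm_eq_inner algebra_simps)
  \<comment> \<open>the Cauchy--Schwarz inequality of the form of \<open>A - a\<close>; it extends to \<open>z = w\<close> by density\<close>
  have CS: "(inner w z)\<^sup>2 \<le> ((b - a) * (norm u)\<^sup>2) * ((b - a) * (norm z)\<^sup>2)"
    if z: "A z = Some y" "K z = z" for z y
  proof -
    have "(inner w z)\<^sup>2 \<le> inner w u * inner (y - a *\<^sub>R z) z"
    proof (rule discriminant_nonpos)
      show "0 \<le> inner (y - a *\<^sub>R z) z" by (rule form[OF z])
      fix t
      have "A (u + t *\<^sub>R z) = Some (v + t *\<^sub>R y)"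
        by (intro add scaleR K z)
      moreover have "K (u + t *\<^sub>R z) = u + t *\<^sub>R z"
        by (simp add: K.add K.scaleR K(3) z)
      ultimately have "0 \<le> inner ((v + t *\<^sub>R y) - a *\<^sub>R (u + t *\<^sub>R z)) (u + t *\<^sub>R z)"
        by (rule form)
      also have "\<dots> = inner w u + t * (inner w z + inner (y - a *\<^sub>R z) u) + t\<^sup>2 * inner (y - a *\<^sub>R z) z"
        by (simp add: w_def inner_add inner_diff algebra_simps power2_eq_square)
      also have "inner (y - a *\<^sub>R z) u = inner w z"
        using symm[OF K(4) z(1)] by (simp add: w_def inner_diff inner_commute)
      finally show "0 \<le> inner w u + 2 * t * inner w z + t\<^sup>2 * inner (y - a *\<^sub>R z) z"
        by simp
    qed
    also have "\<dots> \<le> ((b - a) * (norm u)\<^sup>2) * ((b - a) * (norm z)\<^sup>2)"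
      using form[OF z] form[OF K(4,3)] ab unfolding w_def by (intro mult_mono) auto
    finally show ?thesis .
  qed
  obtain f g where f: "f \<longlonglongrightarrow> w" "\<And>n. A (f n) = Some (g n)"
    using dom_approx[of w] by blast
  have Kf: "(\<lambda>n. K (f n)) \<longlonglongrightarrow> w"
    using K.tendsto[OF f(1)] by (simp add: Kw)
  have "(\<lambda>n. (inner w (K (f n)))\<^sup>2) \<longlonglongrightarrow> (inner w w)\<^sup>2"
    by (intro tendsto_intros Kf)
  moreover have "(\<lambda>n. ((b - a) * (norm u)\<^sup>2) * ((b - a) * (norm (K (f n)))\<^sup>2))
      \<longlonglongrightarrow> ((b - a) * (norm u)\<^sup>2) * ((b - a) * (norm w)\<^sup>2)"
    by (intro tendsto_intros Kf)
  moreover have "(inner w (K (f n)))\<^sup>2 \<le> ((b - a) * (norm u)\<^sup>2) * ((b - a) * (norm (K (f n)))\<^sup>2)" for n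
    using f(2) K(1) by (intro CS[of _ "K (g n)"]) (auto simp: op_commutes_def idem)
  ultimately have "(inner w w)\<^sup>2 \<le> ((b - a) * (norm u)\<^sup>2) * ((b - a) * (norm w)\<^sup>2)"
    by (intro LIMSEQ_le) auto
  then have "(norm w * norm w)\<^sup>2 \<le> ((b - a) * norm u * norm w)\<^sup>2"
    by (simp add: power2_norm_eq_inner[symmetric] power_mult_distrib power2_eq_square algebra_simps)
  then have "norm w * norm w \<le> (b - a) * norm u * norm w"
    by (rule power2_le_imp_le) (use ab in simp)
  then show ?thesis
    unfolding w_def[symmetric] using ab by (cases "w = 0") auto
qed

text \<open>Approximating \<open>u\<close> from the domain and applying \<open>K\<close> stays in
  the domain and in the range of \<open>K\<close>. There \<open>form_bounded_dom\<close> makes the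
  images under A a Cauchy sequence, and A is closed.\<close>

lemma form_bounded_range:
  assumes K: "op_commutes A K" "bounded_linear K" "K u = u"
    and idem: "\<And>x. K (K x) = K x"
    and bd: "\<And>x y. A x = Some y \<Longrightarrow> K x = x \<Longrightarrow> a * (norm x)\<^sup>2 \<le> inner y x \<and> inner y x \<le> b * (norm x)\<^sup>2"
    and ab: "a \<le> b"
  obtains v where "A u = Some v"
proof -
  interpret K: bounded_linear K by (rule K(2))
  obtain f g where f: "f \<longlonglongrightarrow> u" "\<And>n. A (f n) = Some (g n)"
    using dom_approx[of u] by blast
  have Kf: "(\<lambda>n. K (f n)) \<longlonglongrightarrow> u"
    using K.tendsto[OF f(1)] by (simp add: K(3))
  have Af: "A (K (f n)) = Some (K (g n))" for n
    using f(2) K(1) by (simp add: op_commutes_def)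
  have le: "norm (K (g m) - K (g n)) \<le> (b - a + \<bar>a\<bar>) * norm (K (f m) - K (f n))" for m n
  proof -
    let ?x = "K (f m) - K (f n)" and ?y = "K (g m) - K (g n)"
    have "norm (?y - a *\<^sub>R ?x) \<le> (b - a) * norm ?x"
      by (rule form_bounded_dom[OF K(1,2) _ _ idem bd ab])
        (simp_all add: K.diff idem diff Af)
    then have "norm ((?y - a *\<^sub>R ?x) + a *\<^sub>R ?x) \<le> (b - a) * norm ?x + \<bar>a\<bar> * norm ?x"
      by (intro norm_triangle_le) simp
    then show ?thesis by (simp add: algebra_simps)
  qed
  have "Cauchy (\<lambda>n. K (g n))"
  proof (rule CauchyI)
    fix e :: real assume e: "e > 0"
    have pos: "b - a + \<bar>a\<bar> + 1 > 0" using ab by simp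
    then obtain M where M: "\<And>m n. m \<ge> M \<Longrightarrow> n \<ge> M \<Longrightarrow>
        norm (K (f m) - K (f n)) < e / (b - a + \<bar>a\<bar> + 1)"
      using CauchyD[OF LIMSEQ_imp_Cauchy[OF Kf]] e by (metis divide_pos_pos)
    have "norm (K (g m) - K (g n)) < e" if "m \<ge> M" "n \<ge> M" for m n
    proof -
      have "norm (K (g m) - K (g n)) \<le> (b - a + \<bar>a\<bar> + 1) * norm (K (f m) - K (f n))"
        by (rule order_trans[OF le]) (simp add: mult_right_mono)
      also have "\<dots> < e"
        using M[OF that] pos by (simp add: pos_less_divide_eq mult.commute)
      finally show ?thesis .
    qed
    then show "\<exists>M. \<forall>m\<ge>M. \<forall>n\<ge>M. norm (K (g m) - K (g n)) < e" by blast
  qed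
  then obtain v where "(\<lambda>n. K (g n)) \<longlonglongrightarrow> v" using Cauchy_convergent convergent_def by blast
  from closed_seq[OF Af Kf this] show thesis by (rule that)
qed

text \<open>A vector v in the range of P and in the kernel of R has its form between t |v|^2 and s
  |v|^2, which is impossible for s < t unless v = 0. Commutation places the part of
  \<open>P \<cdot> x\<close> outside R in both subspaces.\<close>

lemma cut_less_le:
  assumes P: "spectral_cut A s P" and R: "spectral_cut A t R" and st: "s < t"
    and comm: "\<And>x. P \<cdot> R \<cdot> x = R \<cdot> P \<cdot> x"
  shows "P \<le> R"
proof -
  have "P \<cdot> x - R \<cdot> P \<cdot> x = 0" for x
  proof (rule bounded_linear_zero_on_dom[where T = "\<lambda>x. P \<cdot> x - R \<cdot> P \<cdot> x"])
    show "bounded_linear (\<lambda>x. P \<cdot> x - R \<cdot> P \<cdot> x)"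
      by (intro bounded_linear_sub proj_bounded_linear bounded_linear_compose[OF proj_bounded_linear proj_bounded_linear])
    fix x y assume "A x = Some y"
    let ?v = "P \<cdot> x - R \<cdot> P \<cdot> x" and ?w = "P \<cdot> y - R \<cdot> P \<cdot> y"
    have v: "A ?v = Some ?w"
      using P R \<open>A x = Some y\<close> by (auto simp: spectral_cut_def op_commutes_def intro!: diff)
    have "P \<cdot> ?v = ?v" "R \<cdot> ?v = 0"
      by (simp_all add: proj_diff comm proj_idem)
    then have "inner ?w ?v \<le> s * (norm ?v)\<^sup>2" "t * (norm ?v)\<^sup>2 \<le> inner ?w ?v"
      using P R v unfolding spectral_cut_def by blast+
    then have "(t - s) * (norm ?v)\<^sup>2 \<le> 0" by (simp add: algebra_simps)
    then show "?v = 0" using st by (simp add: mult_le_0_iff)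
  qed
  then show ?thesis by (rule proj_leI)
qed

definition central_cut :: "real \<Rightarrow> 'a proj" where
  "central_cut t = (SOME P. spectral_cut A t P \<and>
    (\<forall>x y. A x = Some y \<longrightarrow> P \<cdot> x = 0 \<longrightarrow> inner y x = t * (norm x)\<^sup>2 \<longrightarrow> x = 0) \<and>
    (\<forall>S x. op_commutes A (proj_apply S) \<longrightarrow> S \<cdot> P \<cdot> x = P \<cdot> S \<cdot> x))"

lemma central_cut:
  shows cut_central_cut: "spectral_cut A t (central_cut t)"
    and central_cut_strict: "A x = Some y \<Longrightarrow> central_cut t \<cdot> x = 0 \<Longrightarrow> inner y x = t * (norm x)\<^sup>2 \<Longrightarrow> x = 0"
    and central_cut_commute: "op_commutes A (proj_apply S) \<Longrightarrow> S \<cdot> central_cut t \<cdot> x = central_cut t \<cdot> S \<cdot> x"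
proof -
  have "\<exists>P. spectral_cut A t P \<and>
    (\<forall>x y. A x = Some y \<longrightarrow> P \<cdot> x = 0 \<longrightarrow> inner y x = t * (norm x)\<^sup>2 \<longrightarrow> x = 0) \<and>
    (\<forall>S x. op_commutes A (proj_apply S) \<longrightarrow> S \<cdot> P \<cdot> x = P \<cdot> S \<cdot> x)"
    using central_cut_exists[of t] by metis
  from someI_ex[OF this, folded central_cut_def]
  show "spectral_cut A t (central_cut t)"
    "A x = Some y \<Longrightarrow> central_cut t \<cdot> x = 0 \<Longrightarrow> inner y x = t * (norm x)\<^sup>2 \<Longrightarrow> x = 0"
    "op_commutes A (proj_apply S) \<Longrightarrow> S \<cdot> central_cut t \<cdot> x = central_cut t \<cdot> S \<cdot> x"
    by blast+
qed

lemma central_cut_op_commutes: "op_commutes A (proj_apply (central_cut t))"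
  using cut_central_cut by (simp add: spectral_cut_def)

lemma central_cut_le: "A x = Some y \<Longrightarrow> central_cut t \<cdot> x = x \<Longrightarrow> inner y x \<le> t * (norm x)\<^sup>2"
  and central_cut_ge: "A x = Some y \<Longrightarrow> central_cut t \<cdot> x = 0 \<Longrightarrow> t * (norm x)\<^sup>2 \<le> inner y x"
  using cut_central_cut[of t] by (auto simp: spectral_cut_def)

lemma central_cut_mono: "s \<le> t \<Longrightarrow> central_cut s \<le> central_cut t"
  using cut_less_le[OF cut_central_cut cut_central_cut _ central_cut_commute[OF central_cut_op_commutes], of s t]
  by (cases "s = t") auto

lemma spectral_family_central_cut: "spectral_family central_cut"
  unfolding spectral_family_def
proof (intro conjI allI)
  let ?E = central_cut
  show "mono ?E" by (rule monoI) (rule central_cut_mono)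
  show "?E t = (\<Sqinter>s\<in>{t<..}. ?E s)" for t
  proof (rule antisym)
    show "?E t \<le> (\<Sqinter>s\<in>{t<..}. ?E s)"
      by (intro INF_greatest central_cut_mono) auto
    define s where "s n = t + inverse (real (Suc n))" for n
    define G where "G = (\<Sqinter>n. ?E (s n))"
    have "decseq (\<lambda>n. ?E (s n))"
      by (rule decseq_SucI, rule central_cut_mono) (simp add: s_def)
    from decreasing_proj_tendsto[OF this] have lim: "(\<lambda>n. ?E (s n) \<cdot> x) \<longlonglongrightarrow> G \<cdot> x" for x
      by (simp add: G_def)
    have G: "op_commutes A (proj_apply G)"
      by (rule op_commutes_limit[OF central_cut_op_commutes lim])
    have GE: "?E (s n) \<cdot> G \<cdot> x = G \<cdot> x" for n x
      by (rule proj_le_absorb) (auto simp: G_def intro: INF_lower)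
    have "G \<cdot> x - ?E t \<cdot> G \<cdot> x = 0" for x
    proof (rule bounded_linear_zero_on_dom[where T = "\<lambda>x. G \<cdot> x - ?E t \<cdot> G \<cdot> x"])
      show "bounded_linear (\<lambda>x. G \<cdot> x - ?E t \<cdot> G \<cdot> x)"
        by (intro bounded_linear_sub proj_bounded_linear bounded_linear_compose[OF proj_bounded_linear proj_bounded_linear])
      fix x y assume "A x = Some y"
      let ?v = "G \<cdot> x - ?E t \<cdot> G \<cdot> x" and ?w = "G \<cdot> y - ?E t \<cdot> G \<cdot> y"
      have v: "A ?v = Some ?w"
        using G central_cut_op_commutes \<open>A x = Some y\<close> by (auto simp: op_commutes_def intro!: diff)
      have Etv: "?E t \<cdot> ?v = 0" by (simp add: proj_diff proj_idem)
      have "?E (s n) \<cdot> ?v = ?v" for n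
        using central_cut_mono[of t "s n"] GE[of n x] by (simp add: proj_diff proj_le_absorb s_def)
      then have "inner ?w ?v \<le> s n * (norm ?v)\<^sup>2" for n
        using central_cut_le[OF v] by blast
      moreover have "s \<longlonglongrightarrow> t"
        unfolding s_def using tendsto_add[OF tendsto_const LIMSEQ_inverse_real_of_nat, of t] by simp
      then have "(\<lambda>n. s n * (norm ?v)\<^sup>2) \<longlonglongrightarrow> t * (norm ?v)\<^sup>2"
        by (intro tendsto_intros)
      ultimately have "inner ?w ?v \<le> t * (norm ?v)\<^sup>2"
        by (intro LIMSEQ_le_const) auto
      then have "inner ?w ?v = t * (norm ?v)\<^sup>2"
        using central_cut_ge[OF v Etv] by simp
      \<comment> \<open>The upper and lower form bounds meet at t; the strict part of the central
        cut excludes the remaining eigenvector.\<close>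
      then show "?v = 0" by (rule central_cut_strict[OF v Etv])
    qed
    then have "G \<le> ?E t" by (rule proj_leI)
    moreover have "(\<Sqinter>s\<in>{t<..}. ?E s) \<le> G"
      unfolding G_def by (rule INF_greatest, rule INF_lower) (simp add: s_def)
    ultimately show "(\<Sqinter>s\<in>{t<..}. ?E s) \<le> ?E t" by (rule order_trans[rotated])
  qed
  show "(\<Sqinter>t. ?E t) = \<bottom>"
  proof -
    define G where "G = (\<Sqinter>n. ?E (- real n))"
    have "decseq (\<lambda>n. ?E (- real n))"
      by (rule decseq_SucI, rule central_cut_mono) simp
    from decreasing_proj_tendsto[OF this] have lim: "(\<lambda>n. ?E (- real n) \<cdot> x) \<longlonglongrightarrow> G \<cdot> x" for x
      by (simp add: G_def)
    have G: "op_commutes A (proj_apply G)"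
      by (rule op_commutes_limit[OF central_cut_op_commutes lim])
    have "G \<cdot> x = 0" for x
    proof (rule bounded_linear_zero_on_dom[where T = "proj_apply G", OF proj_bounded_linear])
      fix x y assume "A x = Some y"
      then have v: "A (G \<cdot> x) = Some (G \<cdot> y)" using G by (simp add: op_commutes_def)
      \<comment> \<open>On the range of G the form lies below -n for every n, which only the zero
        vector allows.\<close>
      have "inner (G \<cdot> y) (G \<cdot> x) \<le> - real n * (norm (G \<cdot> x))\<^sup>2" for n
        by (rule central_cut_le[OF v], rule proj_le_absorb) (auto simp: G_def intro: INF_lower)
      then have "real n * (norm (G \<cdot> x))\<^sup>2 \<le> - inner (G \<cdot> y) (G \<cdot> x)" for n
        by (simp add: le_minus_iff[of "real n * _"])
      then have "\<not> 0 < (norm (G \<cdot> x))\<^sup>2"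
        using reals_Archimedean3 by (meson not_le)
      then show "G \<cdot> x = 0" by simp
    qed
    then have "G = \<bottom>" by (intro proj_eqI) (simp add: proj_bot)
    moreover have "(\<Sqinter>t. ?E t) \<le> G"
      unfolding G_def by (intro INF_greatest INF_lower) auto
    ultimately show ?thesis by (simp add: bot_unique)
  qed
  show "(\<Squnion>t. ?E t) = \<top>"
  proof -
    define H where "H = (\<Squnion>n. ?E (real n))"
    have "incseq (\<lambda>n. ?E (real n))"
      by (rule incseq_SucI, rule central_cut_mono) simp
    from increasing_proj_tendsto[OF this] have lim: "(\<lambda>n. ?E (real n) \<cdot> x) \<longlonglongrightarrow> H \<cdot> x" for x
      by (simp add: H_def)
    have H: "op_commutes A (\<lambda>x. x - H \<cdot> x)"
      by (rule op_commutes_diff[OF op_commutes_id op_commutes_limit[OF central_cut_op_commutes lim]])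
    have "x - H \<cdot> x = 0" for x
    proof (rule bounded_linear_zero_on_dom[where T = "\<lambda>x. x - H \<cdot> x"])
      show "bounded_linear (\<lambda>x. x - H \<cdot> x)"
        by (intro bounded_linear_sub proj_bounded_linear bounded_linear_ident)
      fix x y assume "A x = Some y"
      let ?v = "x - H \<cdot> x" and ?w = "y - H \<cdot> y"
      have v: "A ?v = Some ?w" using H \<open>A x = Some y\<close> by (simp add: op_commutes_def)
      have "?E (real n) \<le> H" for n by (auto simp: H_def intro: SUP_upper)
      then have "?E (real n) \<cdot> ?v = 0" for n
        by (simp add: proj_diff proj_le_absorb)
      then have "real n * (norm ?v)\<^sup>2 \<le> inner ?w ?v" for n
        using central_cut_ge[OF v] by blast
      then have "\<not> 0 < (norm ?v)\<^sup>2"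
        using reals_Archimedean3 by (meson not_le)
      then show "?v = 0" by simp
    qed
    then have "H = \<top>" by (intro proj_eqI) (simp add: proj_top)
    moreover have "H \<le> (\<Squnion>t. ?E t)"
      unfolding H_def by (intro SUP_least SUP_upper) auto
    ultimately show ?thesis by (simp add: top_unique)
  qed
qed

text \<open>Every \<open>E s\<close> commutes with A, hence with the central cuts, so
  \<open>cut_less_le\<close> compares the two families at distinct parameters in both directions.
  Right continuity of each family closes the gap at equal parameters.\<close>

lemma spectral_family_cuts_unique:
  assumes E: "spectral_family E" "\<And>t. spectral_cut A t (E t)"
  shows "E = central_cut"
proof
  fix t
  have comm: "E s \<cdot> central_cut r \<cdot> x = central_cut r \<cdot> E s \<cdot> x" for s r x
    using E(2)[of s] by (intro central_cut_commute) (simp add: spectral_cut_def)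
  show "E t = central_cut t"
  proof (rule antisym)
    have "E t \<le> (\<Sqinter>s\<in>{t<..}. central_cut s)"
      by (intro INF_greatest cut_less_le[OF E(2) cut_central_cut]) (auto simp: comm)
    then show "E t \<le> central_cut t"
      by (simp flip: spectral_family_right[OF spectral_family_central_cut])
    have "central_cut t \<le> (\<Sqinter>s\<in>{t<..}. E s)"
      by (intro INF_greatest cut_less_le[OF cut_central_cut E(2)]) (auto simp: comm)
    then show "central_cut t \<le> E t"
      by (simp flip: spectral_family_right[OF E(1)])
  qed
qed

end

section \<open>The resolution of the identity\<close>

text \<open>On N equal pieces each term is at most C (U - L) / N times the increment of F. The
  increments telescope, so the total is of order 1/N. This replaces passing to the limit of Riemann
  sums: F is the distribution function of the measure, d the error of an integral formula.\<close>

lemma interval_function_eq_zero: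
  fixes d :: "real \<Rightarrow> real \<Rightarrow> real"
  assumes add: "\<And>a b c. L \<le> a \<Longrightarrow> a \<le> b \<Longrightarrow> b \<le> c \<Longrightarrow> c \<le> U \<Longrightarrow> d a c = d a b + d b c"
    and bd: "\<And>a b. L \<le> a \<Longrightarrow> a \<le> b \<Longrightarrow> b \<le> U \<Longrightarrow> \<bar>d a b\<bar> \<le> C * (b - a) * (F b - F a)"
    and LU: "L \<le> U"
  shows "d L U = 0"
proof -
  have le: "\<bar>d L U\<bar> * real (Suc N) \<le> C * (U - L) * (F U - F L)" for N
  proof -
    define h where "h = (U - L) / real (Suc N)"
    define t where "t k = L + real k * h" for k
    have h: "h \<ge> 0" "real (Suc N) * h = U - L"
      using LU by (simp_all add: h_def)
    have t_mono: "t j \<le> t k" if "j \<le> k" for j k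
      using h(1) that by (simp add: t_def mult_right_mono)
    have t_ends: "t 0 = L" "t (Suc N) = U"
      using h(2) by (simp_all add: t_def)
    have "\<bar>d L (t k)\<bar> \<le> C * h * (F (t k) - F L)" if "k \<le> Suc N" for k
      using that
    proof (induction k)
      case 0
      show ?case using add[of L L L] LU by (simp add: t_ends)
    next
      case (Suc k)
      have "d L (t (Suc k)) = d L (t k) + d (t k) (t (Suc k))"
        using Suc.prems t_ends t_mono[of 0 k] t_mono[of k "Suc k"] t_mono[of "Suc k" "Suc N"]
        by (intro add) auto
      moreover have "\<bar>d (t k) (t (Suc k))\<bar> \<le> C * (t (Suc k) - t k) * (F (t (Suc k)) - F (t k))"
        using Suc.prems t_ends t_mono[of 0 k] t_mono[of k "Suc k"] t_mono[of "Suc k" "Suc N"]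
        by (intro bd) auto
      moreover have "t (Suc k) - t k = h" by (simp add: t_def algebra_simps)
      ultimately show ?case using Suc by (simp add: algebra_simps)
    qed
    from this[of "Suc N"] have "\<bar>d L U\<bar> * real (Suc N) \<le> C * h * (F U - F L) * real (Suc N)"
      by (intro mult_right_mono) (simp_all add: t_ends)
    also have "\<dots> = C * (real (Suc N) * h) * (F U - F L)" by simp
    finally show ?thesis unfolding h(2) .
  qed
  have "\<not> 0 < \<bar>d L U\<bar>"
  proof
    assume "0 < \<bar>d L U\<bar>"
    then obtain N where "C * (U - L) * (F U - F L) < real N * \<bar>d L U\<bar>"
      using reals_Archimedean3 by blast
    also have "\<dots> \<le> \<bar>d L U\<bar> * real (Suc N)" by (simp add: algebra_simps)
    finally show False using le[of N] by simp
  qed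
  then show ?thesis by simp
qed

lemma (in finite_measure) set_integral_near_const:
  fixes f :: "'a \<Rightarrow> real"
  assumes S: "S \<in> sets M" and f: "f \<in> borel_measurable M"
    and near: "\<And>t. t \<in> S \<Longrightarrow> \<bar>f t - c\<bar> \<le> e"
  shows "set_integrable M S f"
    and "\<bar>(LINT t:S|M. f t) - c * measure M S\<bar> \<le> e * measure M S"
proof -
  have int: "set_integrable M S g" if "g \<in> borel_measurable M" "\<And>t. t \<in> S \<Longrightarrow> \<bar>g t\<bar> \<le> B"
    for g :: "'a \<Rightarrow> real" and B
    unfolding set_integrable_def using S that
    by (intro integrable_const_bound[where B = "\<bar>B\<bar>"])
      (auto simp: indicator_def intro!: AE_I2 order_trans[OF that(2)])
  show "set_integrable M S f"
  proof (rule int[OF f])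
    show "\<bar>f t\<bar> \<le> \<bar>c\<bar> + e" if "t \<in> S" for t using near[OF that] by linarith
  qed
  have const: "set_integrable M S (\<lambda>t. a)" for a :: real
    by (rule int[of _ "\<bar>a\<bar>"]) auto
  have const_eq: "(LINT t:S|M. a) = a * measure M S" for a :: real
    using S by (simp add: set_lebesgue_integral_def)
  have "(LINT t:S|M. f t) - c * measure M S = (LINT t:S|M. f t - c)"
    by (subst set_integral_diff(2)[OF \<open>set_integrable M S f\<close> const]) (simp add: const_eq)
  also have "\<bar>\<dots>\<bar> \<le> (LINT t:S|M. \<bar>f t - c\<bar>)"
  proof -
    have "set_integrable M S (\<lambda>t. f t - c)"
      by (rule set_integral_diff(1)[OF \<open>set_integrable M S f\<close> const])
    from set_integral_norm_bound[OF this] show ?thesis by simp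
  qed
  also have "\<dots> \<le> (LINT t:S|M. e)"
    using near S f by (intro set_integral_mono const int[of _ e]) auto
  finally show "\<bar>(LINT t:S|M. f t) - c * measure M S\<bar> \<le> e * measure M S"
    by (simp add: const_eq)
qed

section \<open>The finite measures attached to a spectral family\<close>

context
  fixes E :: "real \<Rightarrow> 'a::complex_hilbert_space proj" and x :: 'a
  assumes E: "spectral_family E"
begin

lemma spectral_distribution_mono: "s \<le> t \<Longrightarrow> (norm (E s \<cdot> x))\<^sup>2 \<le> (norm (E t \<cdot> x))\<^sup>2"
  by (intro power_mono norm_proj_mono spectral_family_mono[OF E]) auto

lemma spectral_distribution_right_cont: "continuous (at_right t) (\<lambda>t. (norm (E t \<cdot> x))\<^sup>2)"
  unfolding continuous_within
  by (intro tendsto_intros spectral_family_tendsto_right[OF E])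

lemma finite_measure_spectral_measure: "finite_measure (spectral_measure E x)"
  and measure_spectral_measure_Ioc:
    "a \<le> b \<Longrightarrow> measure (spectral_measure E x) {a<..b} = (norm (E b \<cdot> x))\<^sup>2 - (norm (E a \<cdot> x))\<^sup>2"
proof -
  have "((\<lambda>t. (norm (E t \<cdot> x))\<^sup>2) \<longlongrightarrow> (norm (0::'a))\<^sup>2) at_bot"
    by (intro tendsto_intros spectral_family_tendsto_bot[OF E])
  moreover have "((\<lambda>t. (norm (E t \<cdot> x))\<^sup>2) \<longlongrightarrow> (norm x)\<^sup>2) at_top"
    by (intro tendsto_intros spectral_family_tendsto_top[OF E])
  ultimately have "finite_borel_measure (spectral_measure E x)"
    unfolding spectral_measure_def
    by (intro finite_borel_measure_interval_measure[where m = "(norm x)\<^sup>2"]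
        spectral_distribution_mono spectral_distribution_right_cont) auto
  then show "finite_measure (spectral_measure E x)"
    by (simp add: finite_borel_measure_def)
  show "measure (spectral_measure E x) {a<..b} = (norm (E b \<cdot> x))\<^sup>2 - (norm (E a \<cdot> x))\<^sup>2" if "a \<le> b"
    unfolding spectral_measure_def
    by (rule measure_interval_measure_Ioc[OF that spectral_distribution_mono spectral_distribution_right_cont])
qed

end

lemma sets_spectral_measure [simp, measurable_cong]: "sets (spectral_measure E x) = sets borel"
  and space_spectral_measure [simp]: "space (spectral_measure E x) = UNIV"
  by (simp_all add: spectral_measure_def)

lemma measurable_spectral_measure:
  "(\<lambda>t. t) \<in> borel_measurable (spectral_measure E x)"
  "(\<lambda>t. t\<^sup>2) \<in> borel_measurable (spectral_measure E x)"
  by measurable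

section \<open>Spectral bands\<close>

locale projection_family =
  fixes E :: "real \<Rightarrow> 'a::complex_hilbert_space proj"
  assumes family: "spectral_family E"
begin

lemmas E_mono = spectral_family_mono[OF family]

lemma E_E: "E s \<cdot> E t \<cdot> x = E (min s t) \<cdot> x"
  by (cases "s \<le> t") (simp_all add: proj_le_absorb E_mono min_def)

text \<open>For a \<le> b this is the spectral projection of the half-open interval {a<..b}.\<close>

definition band :: "real \<Rightarrow> real \<Rightarrow> 'a \<Rightarrow> 'a" where
  "band a b x = E b \<cdot> x - E a \<cdot> x"

lemma bounded_linear_band: "bounded_linear (band a b)"
  unfolding band_def[abs_def] by (intro bounded_linear_sub proj_bounded_linear)

lemma band_idem: "a \<le> b \<Longrightarrow> band a b (band a b x) = band a b x"
  by (simp add: band_def proj_diff E_E proj_idem)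

lemma band_inner: "inner (band a b x) y = inner x (band a b y)"
  by (simp add: band_def inner_diff proj_inner)

lemma band_fixed:
  assumes "a \<le> b" "band a b x = x"
  shows "E b \<cdot> x = x" "E a \<cdot> x = 0"
proof -
  have "E b \<cdot> band a b x = band a b x" "E a \<cdot> band a b x = 0"
    using assms(1) by (simp_all add: band_def proj_diff E_E min_def proj_idem)
  then show "E b \<cdot> x = x" "E a \<cdot> x = 0" unfolding assms(2) by auto
qed

lemma norm_band: "a \<le> b \<Longrightarrow> (norm (band a b x))\<^sup>2 = (norm (E b \<cdot> x))\<^sup>2 - (norm (E a \<cdot> x))\<^sup>2"
  by (simp add: band_def norm_proj_diff E_mono)

lemma norm_band_le: "a \<le> b \<Longrightarrow> norm (band a b y) \<le> norm y"
proof (rule power2_le_imp_le)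
  assume "a \<le> b"
  then have "(norm (band a b y))\<^sup>2 \<le> (norm (E b \<cdot> y))\<^sup>2" by (simp add: norm_band)
  also have "\<dots> \<le> (norm y)\<^sup>2" by (intro power_mono norm_proj_le) simp
  finally show "(norm (band a b y))\<^sup>2 \<le> (norm y)\<^sup>2" .
qed simp

lemma band_tendsto: "(\<lambda>n. band (- real n) (real n) x) \<longlonglongrightarrow> x"
proof -
  have "(\<lambda>n. E (real n) \<cdot> x) \<longlonglongrightarrow> x"
    by (rule filterlim_compose[OF spectral_family_tendsto_top[OF family] filterlim_real_sequentially])
  moreover have "(\<lambda>n. E (- real n) \<cdot> x) \<longlonglongrightarrow> 0"
    by (rule filterlim_compose[OF spectral_family_tendsto_bot[OF family]
          filterlim_compose[OF filterlim_uminus_at_bot_at_top filterlim_real_sequentially]])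
  ultimately show ?thesis unfolding band_def using tendsto_diff by fastforce
qed

end

section \<open>The operator on its bands, compared with Stieltjes integrals\<close>

locale self_adjoint_family = self_adjoint_op A + projection_family E
  for A :: "'a::complex_hilbert_space \<rightharpoonup> 'a" and E :: "real \<Rightarrow> 'a proj" +
  assumes cuts: "spectral_cut A t (E t)"
begin

lemma op_commutes_E: "op_commutes A (proj_apply (E t))"
  using cuts by (simp add: spectral_cut_def)

lemma op_commutes_band: "op_commutes A (band a b)"
  unfolding band_def[abs_def] by (intro op_commutes_diff op_commutes_E)

lemma band_form:
  assumes "a \<le> b" "A x = Some y" "band a b x = x"
  shows "a * (norm x)\<^sup>2 \<le> inner y x \<and> inner y x \<le> b * (norm x)\<^sup>2"
  using band_fixed[OF assms(1,3)] cuts[of a] cuts[of b] assms(2) unfolding spectral_cut_def by blast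

text \<open>For a \<le> b the range of the band lies in the domain of A, by
  \<open>form_bounded_range\<close>, so \<open>the\<close> meets a defined value and this is
  everywhere defined.\<close>

definition band_op :: "real \<Rightarrow> real \<Rightarrow> 'a \<Rightarrow> 'a" where
  "band_op a b x = the (A (band a b x))"

context
  fixes a b :: real
  assumes ab: "a \<le> b"
begin

lemma band_op: "A (band a b x) = Some (band_op a b x)"
proof -
  obtain v where "A (band a b x) = Some v"
    by (rule form_bounded_range[where K = "band a b" and u = "band a b x" and a = a and b = b,
          OF op_commutes_band bounded_linear_band band_idem[OF ab]
          band_idem[OF ab] band_form[OF ab] ab])
  then show ?thesis by (simp add: band_op_def)
qed

lemma band_op_near: "norm (band_op a b x - a *\<^sub>R band a b x) \<le> (b - a) * norm (band a b x)"
  by (rule form_bounded_dom[where K = "band a b" and u = "band a b x" and a = a and b = b,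
        OF op_commutes_band bounded_linear_band band_idem[OF ab]
        band_op band_idem[OF ab] band_form[OF ab] ab])

lemma band_band_op: "band a b (band_op a b x) = band_op a b x"
proof -
  have "A (band a b (band a b x)) = Some (band a b (band_op a b x))"
    using op_commutes_band band_op unfolding op_commutes_def by blast
  then show ?thesis by (simp add: band_idem[OF ab] band_op)
qed

lemma inner_band_op: "inner (band_op a b x) (band a b x) = inner (band_op a b x) x"
  using band_inner[of a b "band_op a b x" x] by (simp add: band_band_op)

end

lemma band_op_add:
  assumes "a \<le> b" "b \<le> c"
  shows "band_op a c x = band_op a b x + band_op b c x"
proof -
  have "band a b x + band b c x = band a c x" by (simp add: band_def)
  with add[OF band_op[OF assms(1), of x] band_op[OF assms(2), of x]] band_op[of a c x] assms
  show ?thesis by simp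
qed

lemma band_op_orthogonal:
  assumes "a \<le> b" "b \<le> c"
  shows "inner (band_op a b x) (band_op b c x) = 0"
proof -
  have "inner (band_op a b x) (band_op b c x) =
      inner (band a b (band_op a b x)) (band b c (band_op b c x))"
    by (simp only: band_band_op assms)
  also have "\<dots> = inner (band_op a b x) (band a b (band b c (band_op b c x)))"
    by (simp only: band_inner)
  also have "band a b (band b c z) = 0" for z
    using assms by (simp add: band_def proj_diff E_E min_def)
  finally show ?thesis by simp
qed

lemma band_op_band:
  assumes "a' \<le> a" "a \<le> b" "b \<le> b'"
  shows "band a b (band_op a' b' x) = band_op a b x"
proof -
  have "band a b (band a' b' x) = band a b x"
    using assms by (cases "a = b") (simp_all add: band_def proj_diff E_E min_def)
  then have "A (band a b x) = Some (band a b (band_op a' b' x))"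
    using op_commutes_band[of a b] band_op[of a' b' x] assms unfolding op_commutes_def by fastforce
  then show ?thesis using band_op[of a b x] assms by simp
qed

context
  fixes x :: 'a
begin

interpretation finite_measure "spectral_measure E x"
  by (rule finite_measure_spectral_measure[OF family])

lemma set_integrable_Ioc:
  assumes "a \<le> b"
  shows "set_integrable (spectral_measure E x) {a<..b} (\<lambda>t. t)"
    and "set_integrable (spectral_measure E x) {a<..b} (\<lambda>t. t\<^sup>2)"
proof -
  show "set_integrable (spectral_measure E x) {a<..b} (\<lambda>t. t)"
    by (rule set_integral_near_const(1)[of _ _ a "b - a"]) (auto simp: measurable_spectral_measure)
  show "set_integrable (spectral_measure E x) {a<..b} (\<lambda>t. t\<^sup>2)"
  proof (rule set_integral_near_const(1)[of _ _ 0 "(\<bar>a\<bar> + \<bar>b\<bar>)\<^sup>2"])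
    fix t assume "t \<in> {a<..b}"
    then have "\<bar>t\<bar> \<le> \<bar>a\<bar> + \<bar>b\<bar>" by auto
    then have "\<bar>t\<bar>\<^sup>2 \<le> (\<bar>a\<bar> + \<bar>b\<bar>)\<^sup>2" by (rule power_mono) simp
    then show "\<bar>t\<^sup>2 - 0\<bar> \<le> (\<bar>a\<bar> + \<bar>b\<bar>)\<^sup>2" by simp
  qed (auto simp: measurable_spectral_measure)
qed

lemma set_integral_Ioc_add:
  fixes f :: "real \<Rightarrow> real"
  assumes "a \<le> b" "b \<le> c" "set_integrable (spectral_measure E x) {a<..b} f"
    "set_integrable (spectral_measure E x) {b<..c} f"
  shows "(LINT t:{a<..c}|spectral_measure E x. f t) =
    (LINT t:{a<..b}|spectral_measure E x. f t) + (LINT t:{b<..c}|spectral_measure E x. f t)"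
proof -
  have "{a<..c} = {a<..b} \<union> {b<..c}" using assms by auto
  then show ?thesis
    using assms(3,4) by (simp only:) (rule set_integral_Un, auto)
qed

text \<open>On a piece {a<..b} of mass k both sides differ from a k by at most (b - a) k: the left
  by the form bounds of the band, the right because the integrand is near a. Hence the constant 2 in
  the bound for d.\<close>

lemma inner_band_op_eq_integral:
  assumes "L \<le> U"
  shows "inner (band_op L U x) x = (LINT t:{L<..U}|spectral_measure E x. t)"
proof -
  define d where "d a b = inner (band_op a b x) x - (LINT t:{a<..b}|spectral_measure E x. t)" for a b
  have "d L U = 0"
  proof (rule interval_function_eq_zero[where d = d and C = 2 and F = "\<lambda>t. (norm (E t \<cdot> x))\<^sup>2"])
    show "d a c = d a b + d b c" if "a \<le> b" "b \<le> c" for a b c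
      using that by (simp add: d_def band_op_add[OF that] inner_add_left
          set_integral_Ioc_add[OF that] set_integrable_Ioc)
    fix a b :: real assume ab: "a \<le> b"
    let ?k = "(norm (E b \<cdot> x))\<^sup>2 - (norm (E a \<cdot> x))\<^sup>2"
    have "\<bar>(LINT t:{a<..b}|spectral_measure E x. t) - a * measure (spectral_measure E x) {a<..b}\<bar>
        \<le> (b - a) * measure (spectral_measure E x) {a<..b}"
      by (rule set_integral_near_const(2)) (auto simp: measurable_spectral_measure)
    then have "\<bar>(LINT t:{a<..b}|spectral_measure E x. t) - a * ?k\<bar> \<le> (b - a) * ?k"
      by (simp only: measure_spectral_measure_Ioc[OF family ab])
    moreover have "\<bar>inner (band_op a b x) x - a * ?k\<bar> \<le> (b - a) * ?k"
      using band_form[OF ab band_op[OF ab, of x] band_idem[OF ab]]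
      unfolding inner_band_op[OF ab] norm_band[OF ab] left_diff_distrib[of b a] by linarith
    ultimately show "\<bar>d a b\<bar> \<le> 2 * (b - a) * ?k"
      unfolding d_def by (simp add: algebra_simps)
  qed (rule assms)
  then show ?thesis by (simp add: d_def)
qed

text \<open>The same comparison with a^2 k on a piece of mass k. The left side is additive because
  values on adjacent bands are orthogonal.\<close>

lemma norm_band_op_eq_integral:
  assumes "L \<le> U"
  shows "(norm (band_op L U x))\<^sup>2 = (LINT t:{L<..U}|spectral_measure E x. t\<^sup>2)"
proof -
  define B where "B = \<bar>L\<bar> + \<bar>U\<bar>"
  define d where "d a b = (norm (band_op a b x))\<^sup>2 - (LINT t:{a<..b}|spectral_measure E x. t\<^sup>2)" for a b
  have "d L U = 0"
  \<comment> \<open>The constant splits as 2 B + 4 B. The integral contributes |t + a| \<le> 2 B.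
    The operator contributes the sum of \<open>?h\<close> and \<open>\<bar>a\<bar> * ?n\<close>,
    where \<open>?h\<close> is at most 3 B \<open>?n\<close> and the other at most B
    \<open>?n\<close>.\<close>
  proof (rule interval_function_eq_zero[where d = d and C = "6 * B" and F = "\<lambda>t. (norm (E t \<cdot> x))\<^sup>2"])
    show "d a c = d a b + d b c" if "a \<le> b" "b \<le> c" for a b c
      using that band_op_orthogonal[OF that, of x]
      by (simp add: d_def band_op_add[OF that] power2_norm_eq_inner inner_add inner_commute
          set_integral_Ioc_add[OF that] set_integrable_Ioc)
    fix a b :: real assume ab: "a \<le> b" and L: "L \<le> a" and U: "b \<le> U"
    have B: "\<bar>a\<bar> \<le> B" "\<bar>b\<bar> \<le> B" "b - a \<le> 2 * B" using ab L U by (auto simp: B_def)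
    let ?k = "(norm (E b \<cdot> x))\<^sup>2 - (norm (E a \<cdot> x))\<^sup>2"
    have "\<bar>(LINT t:{a<..b}|spectral_measure E x. t\<^sup>2) - a\<^sup>2 * measure (spectral_measure E x) {a<..b}\<bar>
        \<le> ((b - a) * (2 * B)) * measure (spectral_measure E x) {a<..b}"
    proof (rule set_integral_near_const(2))
      fix t assume t: "t \<in> {a<..b}"
      have "\<bar>t\<^sup>2 - a\<^sup>2\<bar> = \<bar>t - a\<bar> * \<bar>t + a\<bar>"
        by (simp add: power2_eq_square algebra_simps flip: abs_mult)
      also have "\<dots> \<le> (b - a) * (2 * B)"
        using t B by (intro mult_mono) auto
      finally show "\<bar>t\<^sup>2 - a\<^sup>2\<bar> \<le> (b - a) * (2 * B)" .
    qed (auto simp: measurable_spectral_measure)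
    then have 1: "\<bar>(LINT t:{a<..b}|spectral_measure E x. t\<^sup>2) - a\<^sup>2 * ?k\<bar> \<le> ((b - a) * (2 * B)) * ?k"
      by (simp only: measure_spectral_measure_Ioc[OF family ab])
    let ?h = "norm (band_op a b x)" and ?n = "norm (band a b x)"
    have near: "\<bar>?h - \<bar>a\<bar> * ?n\<bar> \<le> (b - a) * ?n"
      using norm_triangle_ineq3[of "band_op a b x" "a *\<^sub>R band a b x"] band_op_near[OF ab, of x] by simp
    have "\<bar>a\<bar> * ?n \<le> B * ?n" "(b - a) * ?n \<le> (2 * B) * ?n"
      using B by (auto intro: mult_right_mono)
    with near have "?h + \<bar>a\<bar> * ?n \<le> 4 * B * ?n" by linarith
    then have "\<bar>?h - \<bar>a\<bar> * ?n\<bar> * (?h + \<bar>a\<bar> * ?n) \<le> ((b - a) * ?n) * (4 * B * ?n)"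
      using ab by (intro mult_mono near) auto
    moreover have "\<bar>?h\<^sup>2 - a\<^sup>2 * ?n\<^sup>2\<bar> = \<bar>?h - \<bar>a\<bar> * ?n\<bar> * (?h + \<bar>a\<bar> * ?n)"
    proof -
      have "?h\<^sup>2 - a\<^sup>2 * ?n\<^sup>2 = (?h - \<bar>a\<bar> * ?n) * (?h + \<bar>a\<bar> * ?n)"
        by (simp add: power2_eq_square algebra_simps)
      then show ?thesis by (simp add: abs_mult)
    qed
    ultimately have "\<bar>?h\<^sup>2 - a\<^sup>2 * ?n\<^sup>2\<bar> \<le> ((b - a) * (4 * B)) * ?n\<^sup>2"
      by (simp add: power2_eq_square algebra_simps)
    then have 2: "\<bar>?h\<^sup>2 - a\<^sup>2 * ?k\<bar> \<le> ((b - a) * (4 * B)) * ?k"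
      by (simp only: norm_band[OF ab])
    have "6 * B * (b - a) * ?k = ((b - a) * (2 * B)) * ?k + ((b - a) * (4 * B)) * ?k"
      by (simp add: algebra_simps)
    with 1 2 show "\<bar>d a b\<bar> \<le> 6 * B * (b - a) * ?k"
      unfolding d_def by linarith
  qed (rule assms)
  then show ?thesis by (simp add: d_def)
qed

end

lemma band_op_of_dom:
  assumes "A x = Some y"
  shows "band_op (- real n) (real n) x = band (- real n) (real n) y"
  using op_commutes_band assms by (simp add: op_commutes_def band_op_def)

text \<open>Over {-n<..n} the integral of t^2 is the squared norm of the band of \<open>y\<close>,
  hence at most that of \<open>y\<close>; monotone convergence does the rest.\<close>

lemma integrable_of_dom:
  assumes "A x = Some y"
  shows "integrable (spectral_measure E x) (\<lambda>t. t\<^sup>2)"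
proof (rule integrableI_nonneg)
  let ?M = "spectral_measure E x"
  define f where "f n t = ennreal (indicator {- real n<..real n} t * t\<^sup>2)" for n t
  have "(\<integral>\<^sup>+ t. ennreal (t\<^sup>2) \<partial>?M) = (\<integral>\<^sup>+ t. (SUP n. f n t) \<partial>?M)"
  proof (rule nn_integral_cong)
    fix t :: real
    obtain n where "\<bar>t\<bar> < real n" using reals_Archimedean2 by blast
    then have "t \<in> {- real n<..real n}" by auto
    then have "f n t = ennreal (t\<^sup>2)" by (simp add: f_def)
    moreover have "f m t \<le> ennreal (t\<^sup>2)" for m
      by (auto simp: f_def indicator_def intro: ennreal_leI)
    ultimately show "ennreal (t\<^sup>2) = (SUP n. f n t)"
      using SUP_upper[of n UNIV "\<lambda>n. f n t"] by (intro antisym SUP_least) auto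
  qed
  also have "\<dots> = (SUP n. \<integral>\<^sup>+ t. f n t \<partial>?M)"
  proof (rule nn_integral_monotone_convergence_SUP)
    show "incseq f"
      by (auto simp: incseq_def le_fun_def f_def indicator_def intro!: ennreal_leI)
    show "f n \<in> borel_measurable ?M" for n
      unfolding f_def by measurable
  qed
  also have "\<dots> \<le> ennreal ((norm y)\<^sup>2)"
  proof (rule SUP_least)
    fix n
    have "(\<integral>\<^sup>+ t. f n t \<partial>?M) = ennreal (LINT t:{- real n<..real n}|?M. t\<^sup>2)"
      unfolding f_def set_lebesgue_integral_def real_scaleR_def
      using set_integrable_Ioc(2)[of "- real n" "real n" x]
      by (intro nn_integral_eq_integral) (auto simp: set_integrable_def)
    also have "\<dots> = ennreal ((norm (band_op (- real n) (real n) x))\<^sup>2)"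
      by (simp add: norm_band_op_eq_integral)
    also have "\<dots> \<le> ennreal ((norm y)\<^sup>2)"
      unfolding band_op_of_dom[OF assms] by (intro ennreal_leI power_mono norm_band_le) auto
    finally show "(\<integral>\<^sup>+ t. f n t \<partial>?M) \<le> ennreal ((norm y)\<^sup>2)" .
  qed
  finally show "(\<integral>\<^sup>+ t. ennreal (t\<^sup>2) \<partial>?M) < \<infinity>"
    by (simp add: order_le_less_trans)
qed (auto simp: measurable_spectral_measure)

lemma set_integral_exhaust:
  fixes f :: "real \<Rightarrow> real"
  assumes "integrable (spectral_measure E x) f"
  shows "(\<lambda>n. LINT t:{- real n<..real n}|spectral_measure E x. f t) \<longlonglongrightarrow> (LINT t|spectral_measure E x. f t)"
  unfolding set_lebesgue_integral_def
proof (rule integral_dominated_convergence[where w = "\<lambda>t. \<bar>f t\<bar>"])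
  let ?M = "spectral_measure E x"
  show "integrable ?M (\<lambda>t. \<bar>f t\<bar>)" using assms by simp
  show "AE t in ?M. (\<lambda>n. indicat_real {- real n<..real n} t *\<^sub>R f t) \<longlonglongrightarrow> f t"
  proof (rule AE_I2)
    fix t :: real
    obtain N where N: "\<bar>t\<bar> < real N" using reals_Archimedean2 by blast
    have "indicat_real {- real n<..real n} t *\<^sub>R f t = f t" if "n \<ge> N" for n
      using N that by (simp add: indicator_def abs_less_iff)
    then show "(\<lambda>n. indicat_real {- real n<..real n} t *\<^sub>R f t) \<longlonglongrightarrow> f t"
      by (intro tendsto_eventually eventually_sequentiallyI[of N])
  qed
  have [measurable]: "f \<in> borel_measurable ?M" using assms by (rule borel_measurable_integrable)
  show "f \<in> borel_measurable ?M" by measurable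
  show "(\<lambda>t. indicat_real {- real n<..real n} t *\<^sub>R f t) \<in> borel_measurable ?M" for n
    by measurable
qed (auto simp: indicator_def)

text \<open>The values of A on the growing bands of x have orthogonal increments, so convergence of
  their squared norms, which are integrals of t^2, makes them Cauchy. A is closed.\<close>

lemma dom_of_integrable:
  assumes int: "integrable (spectral_measure E x) (\<lambda>t. t\<^sup>2)"
  obtains y where "A x = Some y"
proof -
  define h where "h n = band_op (- real n) (real n) x" for n
  have hn: "(norm (h n))\<^sup>2 = (LINT t:{- real n<..real n}|spectral_measure E x. t\<^sup>2)" for n
    by (simp add: h_def norm_band_op_eq_integral)
  have "(\<lambda>n. (norm (h n))\<^sup>2) \<longlonglongrightarrow> (LINT t|spectral_measure E x. t\<^sup>2)"
    unfolding hn by (rule set_integral_exhaust[OF int])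
  then have C: "Cauchy (\<lambda>n. (norm (h n))\<^sup>2)" by (rule LIMSEQ_imp_Cauchy)
  have dist: "(norm (h m - h n))\<^sup>2 = (norm (h n))\<^sup>2 - (norm (h m))\<^sup>2" if "m \<le> n" for m n
  proof -
    have "h m = band (- real m) (real m) (h n)"
      unfolding h_def using that by (intro band_op_band[symmetric]) auto
    moreover have "band (- real m) (real m) (h m) = h m"
      by (simp add: h_def band_band_op)
    ultimately have "inner (h m) (h n) = inner (h m) (h m)"
      using band_inner[of "- real m" "real m" "h m" "h n"] by metis
    then show ?thesis by (simp add: power2_norm_eq_inner inner_diff inner_commute)
  qed
  have "Cauchy h"
  proof (rule CauchyI')
    fix e :: real assume "e > 0"
    then obtain N where N: "\<And>m n. N \<le> m \<Longrightarrow> N \<le> n \<Longrightarrow> norm ((norm (h m))\<^sup>2 - (norm (h n))\<^sup>2) < e\<^sup>2"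
      using CauchyD[OF C, of "e\<^sup>2"] by auto
    have "dist (h m) (h n) < e" if "N \<le> m" "m < n" for m n
    proof -
      have "(norm (h m - h n))\<^sup>2 < e\<^sup>2"
        using N[of m n] that by (simp add: dist)
      then show ?thesis unfolding dist_norm using \<open>e > 0\<close> by (intro power2_less_imp_less[of _ e]) auto
    qed
    then show "\<exists>M. \<forall>m\<ge>M. \<forall>n>m. dist (h m) (h n) < e" by blast
  qed
  then obtain y where y: "h \<longlonglongrightarrow> y" using Cauchy_convergent convergent_def by blast
  have "A (band (- real n) (real n) x) = Some (h n)" for n
    unfolding h_def by (rule band_op) simp
  from closed_seq[OF this band_tendsto y] show thesis by (rule that)
qed

lemma form_eq_integral:
  assumes xy: "A x = Some y"
  shows "inner y x = (LINT t|spectral_measure E x. t)"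
proof -
  interpret finite_measure "spectral_measure E x"
    by (rule finite_measure_spectral_measure[OF family])
  have "integrable (spectral_measure E x) (\<lambda>t. t)"
  proof (rule Bochner_Integration.integrable_bound)
    show "integrable (spectral_measure E x) (\<lambda>t. 1 + t\<^sup>2)"
      using integrable_of_dom[OF xy] by simp
    have "\<bar>t\<bar> \<le> 1 + t\<^sup>2" for t :: real
      using zero_le_power2[of "\<bar>t\<bar> - 1"] by (simp add: power2_eq_square algebra_simps)
    then show "AE t in spectral_measure E x. norm t \<le> norm (1 + t\<^sup>2)"
      by (simp add: order_trans[OF _ abs_ge_self])
  qed (rule measurable_spectral_measure)
  then have "(\<lambda>n. inner (band_op (- real n) (real n) x) x) \<longlonglongrightarrow> (LINT t|spectral_measure E x. t)"
    using set_integral_exhaust[of x "\<lambda>t. t"] by (simp add: inner_band_op_eq_integral)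
  moreover have "(\<lambda>n. inner (band_op (- real n) (real n) x) x) \<longlonglongrightarrow> inner y x"
    unfolding band_op_of_dom[OF xy] by (intro tendsto_intros band_tendsto)
  ultimately show ?thesis by (metis LIMSEQ_unique)
qed

theorem resolution_of_identity: "resolution_of_identity A E"
  unfolding resolution_of_identity_def
proof (intro conjI ballI)
  show "spectral_family E" by (rule family)
  show "dom A = {x. integrable (spectral_measure E x) (\<lambda>t. t\<^sup>2)}"
    using integrable_of_dom dom_of_integrable by blast
  fix x assume "x \<in> dom A"
  then obtain y where y: "A x = Some y" by blast
  then show "cinner (the (A x)) x = complex_of_real (LINT t|spectral_measure E x. t)"
    by (simp add: cinner_eq_inner symm_scaleC_i[OF y] form_eq_integral[OF y] complex_of_real_def)
qed

end

section \<open>The self-adjoint operator of a spectral family\<close>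

lemma riesz_representation_exists:
  fixes f :: "'a::{real_inner,complete_space} \<Rightarrow> real"
  assumes "bounded_linear f"
  shows "\<exists>z. \<forall>x. f x = inner z x"
proof (cases "\<forall>x. f x = 0")
  case True
  then show ?thesis by (intro exI[of _ 0]) simp
next
  case False
  then obtain x0 where x0: "f x0 \<noteq> 0" by blast
  interpret f: bounded_linear f by (rule assms)
  have "closed {x. f x = 0}"
    by (intro closed_Collect_eq continuous_intros f.continuous_on)
  moreover have "subspace {x. f x = 0}"
    by (auto simp: subspace_def f.zero f.add f.scaleR)
  ultimately obtain y where y: "f y = 0" "\<And>z. f z = 0 \<Longrightarrow> inner (x0 - y) z = 0"
    using orthogonal_projection_exists[of "{x. f x = 0}" x0] by blast
  define w where "w = x0 - y"
  have fw: "f w \<noteq> 0" using x0 y(1) by (simp add: w_def f.diff)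
  then have ww: "inner w w \<noteq> 0" by (metis f.zero inner_eq_zero_iff)
  have "f x = inner ((f w / inner w w) *\<^sub>R w) x" for x
  proof -
    have "inner w (x - (f x / f w) *\<^sub>R w) = 0"
      unfolding w_def[symmetric] using y(2)[of "x - (f x / f w) *\<^sub>R w"] fw
      by (simp add: w_def[symmetric] f.diff f.scaleR)
    then have "inner w x = (f x / f w) * inner w w"
      by (simp add: inner_diff_right)
    then show ?thesis using fw ww by simp
  qed
  then show ?thesis by blast
qed

lemma inner_eqI: "(\<And>y. inner x y = inner z y) \<Longrightarrow> x = (z::'a::real_inner)"
  by (metis eq_iff_diff_eq_0 inner_diff_left inner_eq_zero_iff)

lemma mono_integrable_on:
  fixes g :: "real \<Rightarrow> real"
  assumes "mono g"
  shows "g integrable_on {a..b}"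
proof -
  have [measurable]: "g \<in> borel_measurable borel" by (rule borel_measurable_mono[OF assms])
  have "set_integrable lborel {a..b} g"
    unfolding set_integrable_def
  proof (rule Bochner_Integration.integrable_bound)
    show "integrable lborel (\<lambda>t. indicat_real {a..b} t *\<^sub>R (\<bar>g a\<bar> + \<bar>g b\<bar>))"
      by (cases "a \<le> b") auto
    show "AE t in lborel. norm (indicat_real {a..b} t *\<^sub>R g t) \<le> norm (indicat_real {a..b} t *\<^sub>R (\<bar>g a\<bar> + \<bar>g b\<bar>))"
    proof (rule AE_I2)
      fix t show "norm (indicat_real {a..b} t *\<^sub>R g t) \<le> norm (indicat_real {a..b} t *\<^sub>R (\<bar>g a\<bar> + \<bar>g b\<bar>))"
        using monoD[OF assms, of a t] monoD[OF assms, of t b] by (auto simp: indicator_def)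
    qed
  qed measurable
  then show ?thesis by (rule set_borel_integral_eq_integral(1))
qed

section \<open>Weak integrals of a spectral family and the truncated operators\<close>

context projection_family
begin

lemma E_form_commute: "inner (E s \<cdot> x) y = inner (E s \<cdot> y) x"
  by (subst proj_inner) (rule inner_commute)

text \<open>Polarization writes the form as a difference of two monotone functions of s.\<close>

lemma E_form_integrable: "(\<lambda>s. inner (E s \<cdot> x) y) integrable_on {a..b}"
proof -
  have eq: "inner (E s \<cdot> x) y = (1/4) *\<^sub>R ((norm (E s \<cdot> (x + y)))\<^sup>2 - (norm (E s \<cdot> (x - y)))\<^sup>2)" for s
    unfolding inner_proj_self[symmetric]
    using E_form_commute[of s x y] by (simp add: proj_add proj_diff inner_add inner_diff)
  have "mono (\<lambda>s. (norm (E s \<cdot> z))\<^sup>2)" for z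
    by (intro monoI power_mono norm_proj_mono E_mono) auto
  then show ?thesis
    unfolding eq
    by (intro integrable_cmul[OF integrable_diff] mono_integrable_on)
qed

lemma E_form_bound: "\<bar>inner (E s \<cdot> x) y\<bar> \<le> norm x * norm y"
  by (rule order_trans[OF Cauchy_Schwarz_ineq2]) (simp add: mult_right_mono norm_proj_le)

text \<open>The integral of \<open>E(s) x\<close> over \<open>[-n, n]\<close>, taken weakly; it exists by the Riesz representation
  theorem.\<close>

definition mean_op :: "nat \<Rightarrow> 'a \<Rightarrow> 'a" where
  "mean_op n x = (SOME z. \<forall>y. integral {- real n..real n} (\<lambda>s. inner (E s \<cdot> x) y) = inner z y)"

lemma inner_mean_op:
  "inner (mean_op n x) y = integral {- real n..real n} (\<lambda>s. inner (E s \<cdot> x) y)"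
proof -
  have "bounded_linear (\<lambda>y. integral {- real n..real n} (\<lambda>s. inner (E s \<cdot> x) y))"
  proof (rule bounded_linear_intro[where K = "norm x * (2 * real n)"])
    show "norm (integral {- real n..real n} (\<lambda>s. inner (E s \<cdot> x) y)) \<le> norm y * (norm x * (2 * real n))" for y
    proof -
      have "norm (integral {- real n..real n} (\<lambda>s. inner (E s \<cdot> x) y)) \<le>
          integral {- real n..real n} (\<lambda>s. norm x * norm y)"
        by (rule integral_norm_bound_integral) (auto simp: E_form_integrable E_form_bound)
      then show ?thesis by (simp add: algebra_simps)
    qed
  qed (simp_all add: inner_add_right integral_add E_form_integrable)
  from riesz_representation_exists[OF this]
  have "\<exists>z. \<forall>y. integral {- real n..real n} (\<lambda>s. inner (E s \<cdot> x) y) = inner z y" .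
  from someI_ex[OF this, folded mean_op_def] show ?thesis by (simp only:)
qed

lemma mean_op_add: "mean_op n (x + y) = mean_op n x + mean_op n y"
  by (rule inner_eqI)
    (simp add: inner_add_left inner_mean_op proj_add integral_add E_form_integrable)

lemma mean_op_scaleC: "mean_op n (c *\<^sub>C x) = c *\<^sub>C mean_op n x"
  by (rule inner_eqI) (simp add: inner_mean_op proj_scaleC inner_scaleC_left)

lemma mean_op_symm: "inner (mean_op n x) y = inner x (mean_op n y)"
  by (subst inner_commute[of x]) (simp only: inner_mean_op E_form_commute[of _ x y])

lemma mean_op_E: "mean_op n (E t \<cdot> x) = E t \<cdot> mean_op n x"
proof (rule inner_eqI)
  fix y
  have "inner (E t \<cdot> mean_op n x) y = inner (mean_op n x) (E t \<cdot> y)"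
    by (rule proj_inner)
  moreover have "inner (E s \<cdot> E t \<cdot> x) y = inner (E s \<cdot> x) (E t \<cdot> y)" for s
    by (metis E_E min.commute proj_inner)
  ultimately show "inner (mean_op n (E t \<cdot> x)) y = inner (E t \<cdot> mean_op n x) y"
    by (simp add: inner_mean_op)
qed

abbreviation window :: "nat \<Rightarrow> 'a \<Rightarrow> 'a" where
  "window n \<equiv> band (- real n) (real n)"

lemma window_window: "window m (window n x) = window (min m n) x"
  by (cases "m \<le> n") (simp_all add: band_def proj_diff E_E min_def)

lemma window_add: "window n (x + y) = window n x + window n y"
  and window_scaleC: "window n (c *\<^sub>C x) = c *\<^sub>C window n x"
  by (simp_all add: band_def proj_add proj_scaleC scaleC_diff_right)

lemma window_zero: "window n 0 = 0"
  by (simp add: band_def proj_zero)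

lemma window_E: "window n (E t \<cdot> x) = E t \<cdot> window n x"
  by (simp add: band_def proj_diff E_E min.commute)

text \<open>The integral of t dE(t) over {-n<..n}, integrated by parts: a vector of the window is
  fixed by \<open>E (real n)\<close> and killed by \<open>E (- real n)\<close>, so the boundary term
  is n times the vector. Only an ordinary integral in s remains.\<close>

definition truncation :: "nat \<Rightarrow> 'a \<Rightarrow> 'a" where
  "truncation n x = real n *\<^sub>R window n x - mean_op n (window n x)"

lemma truncation_add: "truncation n (x + y) = truncation n x + truncation n y"
  by (simp add: truncation_def window_add mean_op_add scaleR_add_right)

lemma truncation_scaleC: "truncation n (c *\<^sub>C x) = c *\<^sub>C truncation n x"
  by (simp add: truncation_def window_scaleC mean_op_scaleC scaleC_diff_right scaleC_scaleC mult.commute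
      flip: scaleC_of_real)

lemma truncation_E: "truncation n (E t \<cdot> x) = E t \<cdot> truncation n x"
  by (simp add: truncation_def window_E mean_op_E proj_diff proj_scaleR)

lemma truncation_window_comm: "window m (truncation n x) = truncation n (window m x)"
proof -
  have "truncation n (u - v) = truncation n u - truncation n v" for u v
    using truncation_add[of n "u - v" v] by (simp add: algebra_simps)
  then show ?thesis by (simp add: band_def truncation_E)
qed

lemma truncation_symm: "inner (truncation n x) y = inner x (truncation n y)"
proof -
  have "mean_op n (u - v) = mean_op n u - mean_op n v" for u v
    using mean_op_add[of n "u - v" v] by (simp add: algebra_simps)
  then have "mean_op n (window n x) = window n (mean_op n x)" for x
    by (simp add: band_def mean_op_E)
  then show ?thesis
    by (simp add: truncation_def inner_diff band_inner mean_op_symm)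
qed

text \<open>For w in the window of m, \<open>E s \<cdot> w\<close> is 0 below -m and w above m.
  Enlarging the range to [-n, n] thus adds (n - m) w to the mean, which the growth of the boundary
  term from m to n offsets. Hence truncations are eventually constant on windows.\<close>

lemma truncation_window:
  assumes "m \<le> n"
  shows "truncation n (window m x) = truncation m x"
proof (rule inner_eqI)
  fix y
  let ?w = "window m x"
  let ?f = "\<lambda>s. inner (E s \<cdot> ?w) y"
  have E_low: "E s \<cdot> ?w = 0" if "s \<le> - real m" for s
    using that by (simp add: band_def proj_diff E_E min_def)
  have E_high: "E s \<cdot> ?w = ?w" if "real m \<le> s" for s
    using that by (simp add: band_def proj_diff E_E min_def)
  have "integral {- real n..real n} ?f =
      integral {- real n..- real m} ?f + (integral {- real m..real m} ?f + integral {real m..real n} ?f)"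
    using assms Henstock_Kurzweil_Integration.integral_combine[of "- real n" "- real m" "real n" ?f]
      Henstock_Kurzweil_Integration.integral_combine[of "- real m" "real m" "real n" ?f] by (simp add: E_form_integrable)
  moreover have "integral {- real n..- real m} ?f = integral {- real n..- real m} (\<lambda>s. 0)"
    by (rule integral_cong) (simp add: E_low)
  moreover have "integral {real m..real n} ?f = integral {real m..real n} (\<lambda>s. inner ?w y)"
    by (rule integral_cong) (simp add: E_high)
  ultimately have "integral {- real n..real n} ?f =
      integral {- real m..real m} ?f + (real n - real m) * inner ?w y"
    using assms by simp
  then show "inner (truncation n ?w) y = inner (truncation m x) y"
    using assms by (simp add: truncation_def window_window min_def inner_diff_left inner_mean_op algebra_simps)
qed

text \<open>Beyond t the integrand has its full value |x|^2 and below t it is nonnegative, so the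
  mean is at least (n - t) |x|^2.\<close>

lemma truncation_form_le:
  assumes t: "\<bar>t\<bar> \<le> real n" and x: "window n x = x" "E t \<cdot> x = x"
  shows "inner (truncation n x) x \<le> t * (norm x)\<^sup>2"
proof -
  let ?f = "\<lambda>s. inner (E s \<cdot> x) x"
  have "integral {- real n..real n} ?f = integral {- real n..t} ?f + integral {t..real n} ?f"
    by (rule Henstock_Kurzweil_Integration.integral_combine[symmetric]) (use t in \<open>auto simp: E_form_integrable abs_le_iff\<close>)
  moreover have "integral {t..real n} ?f = integral {t..real n} (\<lambda>s. (norm x)\<^sup>2)"
  proof (rule integral_cong)
    fix s assume "s \<in> {t..real n}"
    then have "E s \<cdot> E t \<cdot> x = E t \<cdot> x" by (intro proj_le_absorb E_mono) simp
    then have "E s \<cdot> x = x" by (simp only: x(2))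
    then show "?f s = (norm x)\<^sup>2" by (simp add: power2_norm_eq_inner)
  qed
  moreover have "integral {- real n..t} ?f \<ge> 0"
    by (rule integral_nonneg[OF E_form_integrable]) (simp add: inner_proj_self)
  moreover have "integral {t..real n} (\<lambda>s. (norm x)\<^sup>2) = (real n - t) * (norm x)\<^sup>2"
    using abs_le_D1[OF t] by simp
  ultimately have "integral {- real n..real n} ?f \<ge> (real n - t) * (norm x)\<^sup>2"
    by linarith
  then show ?thesis
    by (simp add: truncation_def x(1) inner_diff_left inner_mean_op algebra_simps power2_norm_eq_inner)
qed

text \<open>Dual estimate: below t the integrand vanishes, and beyond t it is at most |x|^2.\<close>

lemma truncation_form_ge:
  assumes t: "\<bar>t\<bar> \<le> real n" and x: "window n x = x" "E t \<cdot> x = 0"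
  shows "t * (norm x)\<^sup>2 \<le> inner (truncation n x) x"
proof -
  let ?f = "\<lambda>s. inner (E s \<cdot> x) x"
  have "integral {- real n..real n} ?f = integral {- real n..t} ?f + integral {t..real n} ?f"
    by (rule Henstock_Kurzweil_Integration.integral_combine[symmetric]) (use t in \<open>auto simp: E_form_integrable abs_le_iff\<close>)
  moreover have "integral {- real n..t} ?f = integral {- real n..t} (\<lambda>s. 0)"
  proof (rule integral_cong)
    fix s assume "s \<in> {- real n..t}"
    then have "E s \<cdot> x = E s \<cdot> E t \<cdot> x" by (simp add: E_E min_def)
    then show "?f s = 0" by (simp add: x(2) proj_zero)
  qed
  moreover have "integral {t..real n} ?f \<le> integral {t..real n} (\<lambda>s. (norm x)\<^sup>2)"
    by (rule integral_le[OF E_form_integrable]) (auto simp: inner_proj_self intro!: power_mono norm_proj_le)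
  moreover have "integral {t..real n} (\<lambda>s. (norm x)\<^sup>2) = (real n - t) * (norm x)\<^sup>2"
    using abs_le_D1[OF t] by simp
  ultimately have "integral {- real n..real n} ?f \<le> (real n - t) * (norm x)\<^sup>2"
    by (simp only: integral_0)
  then show ?thesis
    by (simp add: truncation_def x(1) inner_diff_left inner_mean_op algebra_simps power2_norm_eq_inner)
qed

text \<open>The domain is every vector at which the truncations converge; it must be this large for
  the operator to contain its adjoint.\<close>

definition family_op :: "'a \<rightharpoonup> 'a" where
  "family_op x = (if convergent (\<lambda>n. truncation n x) then Some (lim (\<lambda>n. truncation n x)) else None)"

lemma family_op_iff: "family_op x = Some y \<longleftrightarrow> (\<lambda>n. truncation n x) \<longlonglongrightarrow> y"
proof (cases "convergent (\<lambda>n. truncation n x)")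
  case True
  then have "(\<lambda>n. truncation n x) \<longlonglongrightarrow> lim (\<lambda>n. truncation n x)"
    unfolding convergent_LIMSEQ_iff .
  with True show ?thesis unfolding family_op_def by (auto dest: LIMSEQ_unique)
next
  case False
  then show ?thesis unfolding family_op_def by (auto dest: convergentI)
qed

lemma family_op_window: "family_op (window m x) = Some (truncation m x)"
  unfolding family_op_iff
  by (intro tendsto_eventually eventually_sequentiallyI[of m]) (rule truncation_window)

lemma self_adjoint_family_op: "self_adjoint family_op"
  unfolding self_adjoint_iff
proof (intro conjI allI)
  show "linear_operator family_op"
    unfolding linear_operator_iff family_op_iff
  proof (intro conjI allI impI)
    show "(\<lambda>n. truncation n 0) \<longlonglongrightarrow> 0"
      using truncation_add[of _ 0 0] by simp
    show "(\<lambda>n. truncation n (x + u)) \<longlonglongrightarrow> y + v"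
      if "(\<lambda>n. truncation n x) \<longlonglongrightarrow> y" "(\<lambda>n. truncation n u) \<longlonglongrightarrow> v" for x y u v
      unfolding truncation_add by (intro tendsto_intros that)
    show "(\<lambda>n. truncation n (c *\<^sub>C x)) \<longlonglongrightarrow> c *\<^sub>C y" if "(\<lambda>n. truncation n x) \<longlonglongrightarrow> y" for c x y
      unfolding truncation_scaleC by (rule bounded_linear.tendsto[OF bounded_linear_scaleC that])
  qed
  have "x \<in> closure (dom family_op)" for x
    unfolding closure_sequential
    using band_tendsto family_op_window by (intro exI[of _ "\<lambda>n. window n x"]) blast
  then show "densely_defined family_op" by (auto simp: densely_defined_def)
  fix w z
  show "family_op w = Some z \<longleftrightarrow> (\<forall>x y. family_op x = Some y \<longrightarrow> inner y w = inner x z)"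
  proof (intro iffI allI impI)
    fix x y assume w: "family_op w = Some z" and x: "family_op x = Some y"
    have "(\<lambda>n. inner (truncation n x) w) \<longlonglongrightarrow> inner y w"
      by (intro tendsto_intros x[unfolded family_op_iff])
    moreover have "(\<lambda>n. inner x (truncation n w)) \<longlonglongrightarrow> inner x z"
      by (intro tendsto_intros w[unfolded family_op_iff])
    ultimately show "inner y w = inner x z"
      unfolding truncation_symm by (rule LIMSEQ_unique)
  next
    assume adj: "\<forall>x y. family_op x = Some y \<longrightarrow> inner y w = inner x z"
    \<comment> \<open>Testing the adjoint relation on window vectors alone computes the truncations
      of w; as the windows of z tend to z, w lies in the domain.\<close>
    have "truncation m w = window m z" for m
    proof (rule inner_eqI)
      fix u
      have "inner (truncation m u) w = inner (window m u) z"
        using adj family_op_window by blast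
      then show "inner (truncation m w) u = inner (window m z) u"
        by (metis inner_commute truncation_symm band_inner)
    qed
    then show "family_op w = Some z"
      unfolding family_op_iff using band_tendsto by simp
  qed
qed

lemma cut_family_op: "spectral_cut family_op t (E t)"
  unfolding spectral_cut_def
proof (intro conjI allI impI)
  show "op_commutes family_op (proj_apply (E t))"
    unfolding op_commutes_def family_op_iff truncation_E
    by (intro allI impI bounded_linear.tendsto[OF proj_bounded_linear])
  obtain N where N: "\<bar>t\<bar> \<le> real N" using real_arch_simple by blast
  fix x y assume "family_op x = Some y"
  then have "(\<lambda>n. truncation n x) \<longlonglongrightarrow> y" by (simp add: family_op_iff)
  then have lim: "(\<lambda>n. inner (truncation n x) x) \<longlonglongrightarrow> inner y x"
    by (intro tendsto_intros)
  have lim': "(\<lambda>n. t * (norm (window n x))\<^sup>2) \<longlonglongrightarrow> t * (norm x)\<^sup>2"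
    by (intro tendsto_intros band_tendsto)
  \<comment> \<open>The truncation sees only the window part of x, where the form estimates are
    available.\<close>
  have form: "inner (truncation n x) x = inner (truncation n (window n x)) (window n x)" for n
  proof -
    have "truncation n x = window n (truncation n x)"
      by (simp add: truncation_window_comm truncation_window)
    then have "inner (truncation n x) x = inner (truncation n x) (window n x)"
      by (metis band_inner)
    then show ?thesis by (simp add: truncation_window)
  qed
  { assume x: "E t \<cdot> x = x"
    have "inner (truncation n x) x \<le> t * (norm (window n x))\<^sup>2" if "N \<le> n" for n
      unfolding form using N that x
      by (intro truncation_form_le) (auto simp: window_window simp flip: window_E)
    then show "inner y x \<le> t * (norm x)\<^sup>2"
      by (intro LIMSEQ_le[OF lim lim']) blast }
  { assume x: "E t \<cdot> x = 0"
    have "t * (norm (window n x))\<^sup>2 \<le> inner (truncation n x) x" if "N \<le> n" for n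
      unfolding form using N that x
      by (intro truncation_form_ge) (auto simp: window_window window_zero simp flip: window_E)
    then show "t * (norm x)\<^sup>2 \<le> inner y x"
      by (intro LIMSEQ_le[OF lim' lim]) blast }
qed

end

text \<open>Complex polarization: a sesquilinear form that vanishes on the diagonal vanishes, and
  density of the domain turns this into equality of values.\<close>

lemma linear_operator_eqI:
  assumes L: "linear_operator A" "linear_operator B" "densely_defined A"
    and dom: "dom A = dom B"
    and form: "\<And>x. x \<in> dom A \<Longrightarrow> cinner (the (A x)) x = cinner (the (B x)) x"
  shows "A = B"
proof
  fix x
  define D where "D x = the (A x) - the (B x)" for x
  have sub: "csubspace (dom A)" using L(1) by (simp add: linear_operator_def)
  have D_add: "D (x + y) = D x + D y" if "x \<in> dom A" "y \<in> dom A" for x y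
    using L(1,2) that dom unfolding D_def linear_operator_def by (simp add: algebra_simps)
  have D_C: "D (c *\<^sub>C x) = c *\<^sub>C D x" if "x \<in> dom A" for c x
    using L(1,2) that dom unfolding D_def linear_operator_def by (simp add: scaleC_diff_right)
  have D0: "cinner (D x) x = 0" if "x \<in> dom A" for x
    using form[OF that] by (simp add: D_def cinner_diff_left)
  have polar: "cinner (D x) y = 0" if xy: "x \<in> dom A" "y \<in> dom A" for x y
  proof -
    have sum0: "cinner (D x) y + cinner (D y) x = 0" if "y \<in> dom A" for y
    proof -
      have "x + y \<in> dom A" using sub xy(1) that by (simp add: csubspace_def)
      from D0[OF this] show ?thesis
        using D0[OF xy(1)] D0[OF that]
        by (simp add: D_add[OF xy(1) that] cinner_add_left cinner_add_right add.commute)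
    qed
    \<comment> \<open>Replacing y by i y reverses the relative sign of the two terms in
      \<open>sum0\<close>, so each is zero. This needs complex scalars.\<close>
    have "\<i> *\<^sub>C y \<in> dom A" using sub xy(2) by (simp add: csubspace_def)
    from sum0[OF this] have "\<i> * (cinner (D y) x - cinner (D x) y) = 0"
      by (simp add: D_C[OF xy(2)] cinner_scaleC_left cinner_scaleC_right algebra_simps)
    then have "cinner (D y) x = cinner (D x) y" by simp
    with sum0[OF xy(2)] show ?thesis by simp
  qed
  show "A x = B x"
  proof (cases "x \<in> dom A")
    case True
    have "D x = 0"
    proof (rule dense_orthogonal_eq_zero[of "dom A"])
      show "closure (dom A) = UNIV" using L(3) by (simp add: densely_defined_def)
      show "inner y (D x) = 0" if "y \<in> dom A" for y
        using polar[OF True that] by (subst inner_commute) (simp add: inner_eq_Re_cinner)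
    qed
    moreover obtain y z where "A x = Some y" "B x = Some z" using True dom by blast
    ultimately show ?thesis by (simp add: D_def)
  next
    case False
    with dom show ?thesis by (metis domIff)
  qed
qed

lemma resolution_determines_operator:
  assumes "linear_operator A" "linear_operator B" "densely_defined A"
    and R: "resolution_of_identity A E" "resolution_of_identity B E"
  shows "A = B"
  using assms by (intro linear_operator_eqI) (auto simp: resolution_of_identity_def)

context self_adjoint_op
begin

lemma linear_operator: "linear_operator A" and densely_defined: "densely_defined A"
  using sa unfolding self_adjoint_iff by blast+

text \<open>Nothing in the notion of resolution says directly that E commutes with A. Identifying A
  with \<open>family_op\<close> of E supplies this, because E is a family of cuts of the latter by
  construction.\<close>

theorem resolution_of_identity_iff: "resolution_of_identity A E \<longleftrightarrow> E = central_cut"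
proof
  assume R: "resolution_of_identity A E"
  then have fam: "spectral_family E" by (simp only: resolution_of_identity_def)
  interpret F: projection_family E by unfold_locales (rule fam)
  interpret B: self_adjoint_family F.family_op E
    by unfold_locales (rule F.self_adjoint_family_op fam F.cut_family_op)+
  have "A = F.family_op"
    by (rule resolution_determines_operator[OF linear_operator B.linear_operator densely_defined R
          B.resolution_of_identity])
  then show "E = central_cut"
    using spectral_family_cuts_unique[OF fam] F.cut_family_op by simp
next
  interpret C: self_adjoint_family A central_cut
    by unfold_locales (rule spectral_family_central_cut cut_central_cut)+
  assume "E = central_cut"
  then show "resolution_of_identity A E" by (simp add: C.resolution_of_identity)
qed

lemma spectral_projection_eq: "spectral_projection A = central_cut"
  unfolding spectral_projection_def resolution_of_identity_iff by (rule the_equality) auto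

lemma resolution_of_identity_central_cut: "resolution_of_identity A central_cut"
  by (simp add: resolution_of_identity_iff)

lemma closed_operator: "closed_operator A"
  unfolding closed_operator_def closed_sequential_limits
proof (intro allI impI)
  fix f l assume f: "(\<forall>n. f n \<in> Map.graph A) \<and> f \<longlonglongrightarrow> l"
  have "A (fst l) = Some (snd l)"
  proof (rule closed_seq)
    show "A (fst (f n)) = Some (snd (f n))" for n
      using f by (metis in_graphD prod.collapse)
    show "(\<lambda>n. fst (f n)) \<longlonglongrightarrow> fst l" "(\<lambda>n. snd (f n)) \<longlonglongrightarrow> snd l"
      using f by (auto intro: tendsto_intros)
  qed
  then show "l \<in> Map.graph A" by (metis in_graphI prod.collapse)
qed

end

section \<open>Affiliated operators\<close>

text \<open>The Riesz vector is taken for the real inner product; complex linearity of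
  \<open>T\<close> gives the same relation with y and z multiplied by i, hence the complex identity.
  So the description in \<open>cadjoint\<close> denotes.\<close>

lemma cinner_cadjoint:
  assumes T: "bounded_clinear T"
  shows "cinner (T x) y = cinner x (cadjoint T y)"
proof -
  have bl: "bounded_linear T" and TC: "\<And>c x. T (c *\<^sub>C x) = c *\<^sub>C T x"
    using T by (auto simp: bounded_clinear_def)
  have "\<exists>z. \<forall>x. cinner (T x) y = cinner x z" for y
  proof -
    have "bounded_linear (\<lambda>x. inner (T x) y)"
      by (rule bounded_linear_compose[OF bounded_linear_inner_left bl])
    then obtain z where z: "inner (T x) y = inner z x" for x
      using riesz_representation_exists by blast
    have "inner (T x) (\<i> *\<^sub>C y) = inner x (\<i> *\<^sub>C z)" for x
    proof -
      have "inner (T x) (\<i> *\<^sub>C y) = - inner (T (\<i> *\<^sub>C x)) y"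
        by (simp add: TC inner_scaleC_i)
      also have "\<dots> = - inner (\<i> *\<^sub>C x) z" by (subst inner_commute[of _ z]) (simp only: z)
      finally show ?thesis by (simp add: inner_scaleC_i)
    qed
    then have "cinner (T x) y = cinner x z" for x
      using z[of x] by (simp add: cinner_eq_inner inner_commute[of z])
    then show ?thesis by blast
  qed
  then obtain S where S: "\<forall>x y. cinner (T x) y = cinner x (S y)" by metis
  have "cadjoint T = S"
    unfolding cadjoint_def
  proof (rule the_equality)
    show "\<forall>x y. cinner (T x) y = cinner x (S y)" by (rule S)
    fix S' assume S': "\<forall>x y. cinner (T x) y = cinner x (S' y)"
    have "S' y - S y = 0" for y
    proof (rule cinner_eq_zero)
      fix x
      have "cinner x (S' y - S y) = 0" using S S' by (simp add: cinner_diff_right)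
      then show "cinner (S' y - S y) x = 0" by (metis cinner_commute complex_cnj_zero)
    qed
    then show "S' = S" by auto
  qed
  with S show ?thesis by simp
qed

lemma unitary_norm:
  assumes "unitary U"
  shows "norm (U x) = norm x"
proof -
  have "cinner (U x) (U x) = cinner x x"
    using assms by (simp add: cinner_cadjoint unitary_def fun_eq_iff)
  then show ?thesis
    by (simp add: norm_eq_sqrt_inner inner_eq_Re_cinner)
qed

lemma unitary_reflection:
  shows "bounded_clinear (\<lambda>x. x - 2 *\<^sub>R P \<cdot> x)"
    and "cadjoint (\<lambda>x. x - 2 *\<^sub>R P \<cdot> x) = (\<lambda>x. x - 2 *\<^sub>R P \<cdot> x)"
    and "unitary (\<lambda>x. x - 2 *\<^sub>R P \<cdot> x)"
proof -
  let ?U = "\<lambda>x. x - 2 *\<^sub>R P \<cdot> x"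
  show bcl: "bounded_clinear ?U"
    unfolding bounded_clinear_def
  proof (intro conjI allI)
    show "bounded_linear ?U"
      by (intro bounded_linear_sub bounded_linear_const_scaleR proj_bounded_linear bounded_linear_ident)
    show "?U (c *\<^sub>C x) = c *\<^sub>C ?U x" for c x
      by (simp add: proj_scaleC scaleC_diff_right scaleC_scaleC mult.commute flip: scaleC_of_real)
  qed
  have symm: "cinner (?U x) y = cinner x (?U y)" for x y
    by (simp add: cinner_diff_left cinner_diff_right cinner_scaleC_left cinner_scaleC_right proj_cinner
        flip: scaleC_of_real)
  show adj: "cadjoint ?U = ?U"
  proof
    fix y
    have "cadjoint ?U y - ?U y = 0"
    proof (rule cinner_eq_zero)
      fix x
      have "cinner x (cadjoint ?U y - ?U y) = 0"
        using cinner_cadjoint[OF bcl, of x y] symm[of x y] by (simp add: cinner_diff_right)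
      then show "cinner (cadjoint ?U y - ?U y) x = 0" by (metis cinner_commute complex_cnj_zero)
    qed
    then show "cadjoint ?U y = ?U y" by simp
  qed
  have "?U \<circ> ?U = id"
    by (auto simp: fun_eq_iff proj_diff proj_add proj_idem scaleR_2)
  then show "unitary ?U" using bcl adj by (simp add: unitary_def)
qed

text \<open>The triple commutant is the commutant, so affiliation is a condition on the unitaries
  that commute with Q.\<close>

lemma commutant_vN_algebra: "commutant (vN_algebra Q) = commutant (proj_apply ` Q)"
proof
  have "proj_apply ` Q \<subseteq> vN_algebra Q"
    unfolding vN_algebra_def commutant_def
    using proj_bounded_linear proj_scaleC by (auto simp: bounded_clinear_def)
  then show "commutant (vN_algebra Q) \<subseteq> commutant (proj_apply ` Q)"
    by (auto simp: commutant_def)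
  show "commutant (proj_apply ` Q) \<subseteq> commutant (vN_algebra Q)"
    unfolding vN_algebra_def by (subst (2) commutant_def) (auto simp: commutant_def)
qed

lemma (in self_adjoint_op) op_commutes_of_affiliated:
  assumes "affiliated A (vN_algebra Q)" "P \<in> Q\<^sup>!"
  shows "op_commutes A (proj_apply P)"
proof -
  let ?U = "\<lambda>x. x - 2 *\<^sub>R P \<cdot> x"
  have PR: "P \<cdot> R \<cdot> x = R \<cdot> P \<cdot> x" if "R \<in> Q" for R x
    using assms(2) that by (auto simp: proj_commutant_def fun_eq_iff)
  then have "?U \<in> commutant (proj_apply ` Q)"
    unfolding commutant_def
    by (auto simp: unitary_reflection(1) fun_eq_iff proj_diff proj_scaleR)
  then have "?U \<in> commutant (vN_algebra Q)" by (simp only: commutant_vN_algebra)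
  then have "(\<lambda>x. map_option ?U (A (?U x))) = A"
    using assms(1) unitary_reflection(2,3)[of P] unfolding affiliated_def by metis
  then have inv: "map_option ?U (A (?U x)) = A x" for x by (rule fun_cong)
  have UU: "?U (?U x) = x" for x
    by (simp add: proj_diff proj_add proj_idem scaleR_2)
  have AU: "A (?U x) = Some (?U y)" if "A x = Some y" for x y
  proof -
    have "map_option ?U (A (?U x)) = Some y" using inv that by simp
    then obtain v where "A (?U x) = Some v" "?U v = y" by (auto simp only: map_option_eq_Some)
    then show ?thesis using UU[of v] by (simp only:)
  qed
  show ?thesis
    unfolding op_commutes_def
  proof (intro allI impI)
    fix x y assume xy: "A x = Some y"
    \<comment> \<open>The projection is recovered from the reflection as P = (1 - U) / 2.\<close>
    from scaleR[OF diff[OF xy AU[OF xy]], of "1/2"] show "A (P \<cdot> x) = Some (P \<cdot> y)"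
      by simp
  qed
qed

text \<open>If A is affiliated, every projection in \<open>Q\<^sup>!\<close> commutes with A, hence
  with the central cuts, which therefore lie in the bicommutant. Conversely, a unitary U that
  commutes with the cuts leaves all spectral measures unchanged, so U* A U has the domain and the
  form of A.\<close>

theorem (in self_adjoint_op) affiliated_iff:
  assumes "logic Q"
  shows "affiliated A (vN_algebra Q) \<longleftrightarrow> (\<forall>t. central_cut t \<in> Q)"
proof (intro iffI allI)
  fix t assume aff: "affiliated A (vN_algebra Q)"
  have "central_cut t \<in> Q\<^sup>!\<^sup>!"
    using central_cut_commute[OF op_commutes_of_affiliated[OF aff]]
    by (auto simp: proj_commutant_def[of "Q\<^sup>!"] fun_eq_iff)
  then show "central_cut t \<in> Q" using assms by (simp add: logic_def)
next
  assume Q: "\<forall>t. central_cut t \<in> Q"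
  have "(\<lambda>x. map_option (cadjoint U) (A (U x))) = A"
    if U: "U \<in> commutant (vN_algebra Q)" "unitary U" for U
  proof -
    let ?B = "\<lambda>x. map_option (cadjoint U) (A (U x))"
    have bcl: "bounded_clinear U" and inv: "cadjoint U (U x) = x" "U (cadjoint U x) = x" for x
      using U(2) by (auto simp: unitary_def fun_eq_iff)
    then have U_C: "U (c *\<^sub>C x) = c *\<^sub>C U x" and U_add: "U (x + y) = U x + U y" and U_zero: "U 0 = 0" for c x y
      by (auto simp: bounded_clinear_def bounded_linear.linear linear_add linear_0)
    have V_C: "cadjoint U (c *\<^sub>C x) = c *\<^sub>C cadjoint U x" for c x
      by (metis U_C inv)
    have V_add: "cadjoint U (x + y) = cadjoint U x + cadjoint U y" for x y
      by (metis U_add inv)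
    have UE: "U (central_cut t \<cdot> x) = central_cut t \<cdot> U x" for t x
      using U(1)[unfolded commutant_vN_algebra] Q by (auto simp: commutant_def fun_eq_iff)
    have mu: "spectral_measure central_cut (U x) = spectral_measure central_cut x" for x
      by (simp add: spectral_measure_def unitary_norm[OF U(2)] flip: UE)
    note res = resolution_of_identity_central_cut[unfolded resolution_of_identity_def]
    have domU: "U x \<in> dom A \<longleftrightarrow> x \<in> dom A" for x
      using res mu by auto
    show ?thesis
    proof (rule linear_operator_eqI[symmetric])
      show "linear_operator ?B"
        unfolding linear_operator_iff
        using zero add scaleC by (auto simp: U_zero U_add U_C V_add V_C inv(1)[of 0, unfolded U_zero])
      show "dom A = dom ?B"
        using domU by (auto simp: dom_def)
      fix x assume x: "x \<in> dom A"
      then obtain v where v: "A (U x) = Some v" using domU by blast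
      have "cinner (the (?B x)) x = cinner (cadjoint U v) x" by (simp add: v)
      also have "\<dots> = cinner v (U x)"
        by (metis cinner_cadjoint[OF bcl] cinner_commute)
      also have "\<dots> = cinner (the (A (U x))) (U x)" by (simp add: v)
      also have "\<dots> = cinner (the (A x)) x"
        using res x domU[of x] mu[of x] by metis
      finally show "cinner (the (A x)) x = cinner (the (?B x)) x" by simp
    qed (rule linear_operator densely_defined)+
  qed
  then show "affiliated A (vN_algebra Q)"
    by (simp add: affiliated_def linear_operator densely_defined closed_operator)
qed

section \<open>Truth values\<close>

lemma sasaki_top_left [simp]: "\<top> \<leadsto> q = q"
  and sasaki_top_right [simp]: "q \<leadsto> \<top> = \<top>"
  and sasaki_bot_left [simp]: "\<bottom> \<leadsto> q = \<top>"
  by (simp_all add: sasaki_def)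

text \<open>If the arrow is \<top>, the part of p orthogonal to p \<sqinter> q is \<bottom>, and by
  the orthomodular law p is the join of p \<sqinter> q with that part.\<close>

lemma sasaki_eq_top_iff: "p \<leadsto> q = \<top> \<longleftrightarrow> p \<le> q"
proof
  assume "p \<leadsto> q = \<top>"
  moreover have "- (p \<sqinter> q) \<sqinter> p = - (p \<leadsto> q)"
    by (simp add: sasaki_def inf_commute)
  ultimately have "- (p \<sqinter> q) \<sqinter> p = \<bottom>"
    by (simp only: compl_top_eq)
  then have "p \<sqinter> q = p"
    by (metis inf_le1 orthomodular sup_bot_right)
  then show "p \<le> q" by (metis inf.cobounded2)
qed (simp add: sasaki_def inf_absorb1)

lemma sasaki_iff_eq_top_iff: "sasaki_iff p q = \<top> \<longleftrightarrow> p = q"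
  unfolding sasaki_iff_def inf_eq_top_iff sasaki_eq_top_iff by auto

section \<open>Standard names and their truth values\<close>

lemma hset_induct [case_names HSet]:
  assumes "\<And>X. (\<And>w. w \<in> rcset X \<Longrightarrow> P w) \<Longrightarrow> P (HSet X)"
  shows "P x"
  by (induction x) (metis assms cin.rep_eq)

lemma graph_check:
  "rcset (name_graph (check (HSet X))) = (\<lambda>w. (check w, \<top>)) ` rcset X"
  by (simp add: cimage.rep_eq image_image)

declare check.simps [simp del]

lemma name_dom_check: "name_dom (check (HSet X)) = check ` rcset X"
  by (simp add: name_dom_def graph_check image_image)

lemma name_app_check: "w \<in> rcset X \<Longrightarrow> name_app (check (HSet X)) (check w) = \<top>"
  unfolding name_app_def graph_check by (rule the_equality) auto

text \<open>Distinct rationals get distinct names, so a name over the rationals is a function of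
  r.\<close>

lemma check_inject: "(check x :: 'q::top name) = check y \<Longrightarrow> x = y"
proof (induction x arbitrary: y rule: hset_induct)
  case (HSet X)
  obtain Y where Y: "y = HSet Y" by (cases y)
  have eq: "(check :: hset \<Rightarrow> 'q name) ` rcset X = check ` rcset Y"
    using arg_cong[OF HSet.prems, of name_dom] by (simp only: Y name_dom_check)
  have "w \<in> rcset X \<longleftrightarrow> w \<in> rcset Y" for w
  proof
    assume w: "w \<in> rcset X"
    then have "(check w :: 'q name) \<in> check ` rcset Y" using eq by blast
    then show "w \<in> rcset Y" using HSet.IH[OF w] by blast
  next
    assume w: "w \<in> rcset Y"
    then have "(check w :: 'q name) \<in> check ` rcset X" using eq by blast
    then obtain v where "v \<in> rcset X" "(check v :: 'q name) = check w" by (metis imageE)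
    then show "w \<in> rcset X" using HSet.IH by blast
  qed
  then have "rcset X = rcset Y" by blast
  then show ?case by (simp add: Y rcset_inject)
qed

lemma check_universe: "\<top> \<in> Q \<Longrightarrow> check x \<in> name_universe Q"
proof (induction x rule: hset_induct)
  case (HSet X)
  show ?case
    by (rule name_universe.intros)
      (use HSet in \<open>auto simp: single_valued_def graph_check name_dom_check\<close>)
qed

lemma eq_val_commute: "eq_val u v = eq_val v u"
  by (subst (1 2) eq_val.simps) (rule inf_commute)

lemma mem_val_check: "mem_val u (check (HSet Y)) = (\<Squnion>w\<in>rcset Y. eq_val u (check w))"
  unfolding mem_val.simps[of u] name_dom_check image_image
  by (simp add: name_app_check cong: SUP_cong)

lemma SUP_delta: "(\<Squnion>i\<in>I. if i = a then c else \<bottom>) = (if a \<in> I then c else (\<bottom>::'q::complete_lattice))"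
proof (cases "a \<in> I")
  case True
  then show ?thesis
    by (auto intro!: antisym SUP_least intro: SUP_upper2[of a])
qed (auto intro!: SUP_eq_const simp: bot_unique[symmetric] intro: SUP_least)

text \<open>Equality of standard names is decided as in the ground universe, since only the truth
  values \<top> and \<bottom> occur throughout the recursion.\<close>

lemma eq_val_check:
  "eq_val (check x) (check y) = (if x = y then \<top> else (\<bottom>::'q::complete_orthomodular_lattice))"
proof (induction x arbitrary: y rule: hset_induct)
  case (HSet X)
  obtain Y where Y: "y = HSet Y" by (cases y)
  have mem1: "mem_val (check w) (check (HSet Y)) = (if w \<in> rcset Y then \<top> else (\<bottom>::'q))"
    if "w \<in> rcset X" for w
    unfolding mem_val_check HSet.IH[OF that] using SUP_delta[of w \<top> "rcset Y"] by (simp add: eq_commute[of w])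
  \<comment> \<open>The induction hypothesis has an element of X on the left, so equality is turned
    around before it applies.\<close>
  have mem2: "mem_val (check w) (check (HSet X)) = (if w \<in> rcset X then \<top> else (\<bottom>::'q))" for w
    unfolding mem_val_check eq_val_commute[of "check w"]
    using SUP_delta[of w \<top> "rcset X"] by (simp add: HSet.IH cong: SUP_cong)
  have "eq_val (check (HSet X)) (check (HSet Y)) =
      (\<Sqinter>w\<in>rcset X. if w \<in> rcset Y then \<top> else (\<bottom>::'q)) \<sqinter> (\<Sqinter>w\<in>rcset Y. if w \<in> rcset X then \<top> else \<bottom>)"
    unfolding eq_val.simps[of "check (HSet X)"] name_dom_check image_image
    by (simp add: name_app_check mem1 mem2 cong: INF_cong)
  also have "\<dots> = (if rcset X = rcset Y then \<top> else \<bottom>)"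
  proof (cases "rcset X = rcset Y")
    case False
    then obtain w where "w \<in> rcset X \<and> w \<notin> rcset Y \<or> w \<in> rcset Y \<and> w \<notin> rcset X" by blast
    then have "(\<Sqinter>w\<in>rcset X. if w \<in> rcset Y then \<top> else (\<bottom>::'q)) = \<bottom> \<or>
        (\<Sqinter>w\<in>rcset Y. if w \<in> rcset X then \<top> else (\<bottom>::'q)) = \<bottom>"
      by (metis (mono_tags, lifting) INF_lower bot_unique)
    with False show ?thesis by auto
  qed simp
  finally show ?case by (simp add: Y rcset_inject)
qed

lemma mem_val_check_check:
  "mem_val (check w) (check (HSet X)) = (if w \<in> rcset X then \<top> else (\<bottom>::'q::complete_orthomodular_lattice))"
  unfolding mem_val_check eq_val_check using SUP_delta[of w \<top> "rcset X"] by (simp add: eq_commute[of w])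

section \<open>Names over the rationals\<close>

lemma name_app_in_graph:
  assumes "u \<in> name_universe Q" "x \<in> name_dom u"
  shows "(x, name_app u x) \<in> rcset (name_graph u)"
proof -
  have sv: "single_valued (rcset (name_graph u))"
    using assms(1) by cases auto
  obtain p where p: "(x, p) \<in> rcset (name_graph u)"
    using assms(2) by (auto simp: name_dom_def)
  then have "name_app u x = p"
    unfolding name_app_def using sv by (auto simp: single_valued_def)
  with p show ?thesis by simp
qed

lemma name_app_in_logic: "u \<in> name_universe Q \<Longrightarrow> x \<in> name_dom u \<Longrightarrow> name_app u x \<in> Q"
  using name_app_in_graph[of u Q x] by (auto elim!: name_universe.cases)

lemma rcset_rationals: "rcset (acset (range \<iota>)) = range (\<iota> :: rat \<Rightarrow> hset)"
  by (simp add: acset_inverse)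

context
  fixes \<iota> :: "rat \<Rightarrow> hset"
  assumes inj: "inj \<iota>"
begin

lemma check_rat_eq_iff: "check (\<iota> r) = check (\<iota> s) \<longleftrightarrow> r = s"
  using check_inject injD[OF inj] by blast

lemma forall_in_rationals: "forall_in (check (rationals \<iota>)) \<phi> = (\<Sqinter>r. \<phi> (check (\<iota> r)))"
  unfolding forall_in_def rationals_def name_dom_check rcset_rationals image_image
  by (simp add: name_app_check rcset_rationals)

lemma exists_in_rationals: "exists_in (check (rationals \<iota>)) \<phi> = (\<Squnion>r. \<phi> (check (\<iota> r)))"
  unfolding exists_in_def rationals_def name_dom_check rcset_rationals image_image
  by (simp add: name_app_check rcset_rationals)

lemma less_val_rat: "less_val \<iota> (check (\<iota> r)) (check (\<iota> s)) = (if r < s then \<top> else \<bottom>)"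
  by (auto simp: less_val_def check_rat_eq_iff)

text \<open>Equality between standard rationals is a Kronecker delta, so the join collapses to one
  term.\<close>

lemma mem_val_rat:
  assumes "name_dom u = (\<lambda>r. check (\<iota> r)) ` UNIV"
  shows "mem_val (check (\<iota> r)) u = name_app u (check (\<iota> r))"
proof -
  have "mem_val (check (\<iota> r)) u = (\<Squnion>s. name_app u (check (\<iota> s)) \<sqinter> eq_val (check (\<iota> r)) (check (\<iota> s)))"
    by (simp add: mem_val.simps[of _ u] assms image_image)
  also have "\<dots> = (\<Squnion>s. if s = r then name_app u (check (\<iota> r)) else \<bottom>)"
    using inj by (intro SUP_cong) (auto simp: eq_val_check dest: injD)
  finally show ?thesis by (simp add: SUP_delta)
qed

text \<open>A meet is \<top> only if each conjunct is. The inclusion in the rationals holds by the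
  choice of domain, and the biconditional at \<top> is equality of truth values; the three
  conditions are what is left.\<close>

lemma real_val_eq_top_iff:
  assumes u: "name_dom u = (\<lambda>r. check (\<iota> r)) ` UNIV"
  defines "f \<equiv> \<lambda>r. name_app u (check (\<iota> r))"
  shows "real_val \<iota> u = \<top> \<longleftrightarrow>
    (\<Squnion>r. f r) = \<top> \<and> (\<Squnion>r. - f r) = \<top> \<and> (\<forall>r. f r = (\<Sqinter>s\<in>{r<..}. f s))"
proof -
  have mem: "mem_val (check (\<iota> r)) u = f r" for r
    by (simp add: mem_val_rat[OF u] f_def)
  have "subset_val u (check (rationals \<iota>)) = \<top>"
    unfolding subset_val_def forall_in_def u image_image rationals_def
    by (simp add: mem_val_check_check rcset_rationals)
  \<comment> \<open>The antecedent is \<top> or \<bottom>, so the Sasaki arrow merely restricts the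
    range of the infimum to s > r.\<close>
  moreover have "(\<Sqinter>s. (if r < s then \<top> else \<bottom>) \<leadsto> f s) = (\<Sqinter>s\<in>{r<..}. f s)" for r
  proof (rule antisym)
    show "(\<Sqinter>s. (if r < s then \<top> else \<bottom>) \<leadsto> f s) \<le> (\<Sqinter>s\<in>{r<..}. f s)"
    proof (rule INF_greatest)
      fix s assume "s \<in> {r<..}"
      then show "(\<Sqinter>s. (if r < s then \<top> else \<bottom>) \<leadsto> f s) \<le> f s"
        by (intro INF_lower2[of s]) auto
    qed
    show "(\<Sqinter>s\<in>{r<..}. f s) \<le> (\<Sqinter>s. (if r < s then \<top> else \<bottom>) \<leadsto> f s)"
      by (auto intro!: INF_greatest intro: INF_lower)
  qed
  ultimately show ?thesis
    unfolding real_val_def Let_def forall_in_rationals exists_in_rationals mem less_val_rat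
    by (simp add: INF_top_conv sasaki_iff_eq_top_iff)
qed

definition rat_name :: "(rat \<Rightarrow> 'q) \<Rightarrow> 'q::complete_orthomodular_lattice name" where
  "rat_name f = Name (acset (range (\<lambda>r. (check (\<iota> r), f r))))"

lemma graph_rat_name: "rcset (name_graph (rat_name f)) = range (\<lambda>r. (check (\<iota> r), f r))"
  by (simp add: rat_name_def acset_inverse)

lemma name_dom_rat_name: "name_dom (rat_name f) = (\<lambda>r. check (\<iota> r)) ` UNIV"
  by (simp add: name_dom_def graph_rat_name image_image)

lemma name_app_rat_name: "name_app (rat_name f) (check (\<iota> r)) = f r"
  unfolding name_app_def graph_rat_name by (rule the_equality) (auto simp: check_rat_eq_iff)

lemma rat_name_universe:
  assumes "\<top> \<in> Q" "\<And>r. f r \<in> Q"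
  shows "rat_name f \<in> name_universe Q"
proof (rule name_universe.intros)
  show "single_valued (rcset (name_graph (rat_name f)))"
    by (auto simp: single_valued_def graph_rat_name check_rat_eq_iff)
qed (use assms in \<open>auto simp: graph_rat_name name_dom_rat_name intro: check_universe\<close>)

text \<open>Names are compared as graphs. Single-valuedness lets the values at the rationals fix the
  whole graph, which gives uniqueness of the name belonging to an operator.\<close>

lemma eq_rat_name:
  assumes u: "u \<in> name_universe Q" "name_dom u = (\<lambda>r. check (\<iota> r)) ` UNIV"
  shows "u = rat_name (\<lambda>r. name_app u (check (\<iota> r)))"
proof -
  have sv: "single_valued (rcset (name_graph u))"
    using u(1) by cases auto
  have mem: "(check (\<iota> r), name_app u (check (\<iota> r))) \<in> rcset (name_graph u)" for r
    using u(2) by (intro name_app_in_graph[OF u(1)]) auto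
  have "rcset (name_graph u) = range (\<lambda>r. (check (\<iota> r), name_app u (check (\<iota> r))))"
  proof (intro subset_antisym subsetI)
    fix z assume z: "z \<in> rcset (name_graph u)"
    then have "fst z \<in> name_dom u" by (auto simp: name_dom_def)
    then obtain r where r: "fst z = check (\<iota> r)" using u(2) by auto
    have "snd z = name_app u (check (\<iota> r))"
      using sv mem[of r] z r by (metis prod.collapse single_valuedD)
    with r have "z = (check (\<iota> r), name_app u (check (\<iota> r)))" by (simp add: prod_eq_iff)
    then show "z \<in> range (\<lambda>r. (check (\<iota> r), name_app u (check (\<iota> r))))" by (rule image_eqI) simp
  qed (use mem in auto)
  then have "name_graph u = acset (range (\<lambda>r. (check (\<iota> r), name_app u (check (\<iota> r)))))"
    by (metis rcset_inverse)
  then show ?thesis by (metis name.collapse rat_name_def)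
qed

end

section \<open>The correspondence\<close>

text \<open>A projection that commutes with all members of F preserves each of their ranges, hence
  the intersection. So the infimum lies in the bicommutant.\<close>

lemma logic_Inf_closed:
  assumes "logic Q" "F \<subseteq> Q"
  shows "\<Sqinter>F \<in> Q"
proof -
  have "\<Sqinter>F \<in> Q\<^sup>!\<^sup>!"
    unfolding proj_commutant_def[of "Q\<^sup>!"]
  proof (intro CollectI ballI)
    fix P assume P: "P \<in> Q\<^sup>!"
    have comm: "P \<cdot> R \<cdot> x = R \<cdot> P \<cdot> x" if "R \<in> F" for R x
      using P assms(2) that by (auto simp: proj_commutant_def fun_eq_iff)
    have inv: "\<Sqinter>F \<cdot> P \<cdot> x = P \<cdot> x" if "\<Sqinter>F \<cdot> x = x" for x
    proof -
      have "R \<cdot> x = x" if "R \<in> F" for R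
        using \<open>\<Sqinter>F \<cdot> x = x\<close> proj_le_absorb(1)[OF Inf_lower[OF that], of x] by simp
      then have "P \<cdot> x \<in> proj_range (\<Sqinter>F)"
        unfolding range_Inf by (auto simp: proj_range_iff comm[symmetric])
      then show ?thesis by (simp add: proj_range_iff)
    qed
    have "P \<cdot> \<Sqinter>F \<cdot> x = \<Sqinter>F \<cdot> P \<cdot> x" for x
      by (rule proj_commute_of_invariant[OF proj_inner proj_linear inv inv])
    then show "proj_apply (\<Sqinter>F) \<circ> proj_apply P = proj_apply P \<circ> proj_apply (\<Sqinter>F)"
      by (simp add: fun_eq_iff)
  qed
  then show ?thesis using assms(1) by (simp add: logic_def)
qed

lemma logic_top: "logic Q \<Longrightarrow> \<top> \<in> Q"
  using logic_Inf_closed[of Q "{}"] by simp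

lemma spectral_family_eq_INF_rat:
  assumes "spectral_family E"
  shows "E t = (\<Sqinter>r\<in>{r. t < of_rat r}. E (of_rat r))"
proof (rule antisym)
  show "E t \<le> (\<Sqinter>r\<in>{r. t < of_rat r}. E (of_rat r))"
    by (intro INF_greatest spectral_family_mono[OF assms]) simp
  have "(\<Sqinter>r\<in>{r. t < of_rat r}. E (of_rat r)) \<le> E s" if s: "s \<in> {t<..}" for s
  proof -
    obtain r where r: "t < of_rat r" "of_rat r < s" using of_rat_dense[of t s] s by auto
    then have "(\<Sqinter>r\<in>{r. t < of_rat r}. E (of_rat r)) \<le> E (of_rat r)" by (intro INF_lower) simp
    also have "\<dots> \<le> E s" using r by (intro spectral_family_mono[OF assms]) simp
    finally show ?thesis .
  qed
  then have "(\<Sqinter>r\<in>{r. t < of_rat r}. E (of_rat r)) \<le> (\<Sqinter>s\<in>{t<..}. E s)" by (rule INF_greatest)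
  then show "(\<Sqinter>r\<in>{r. t < of_rat r}. E (of_rat r)) \<le> E t"
    by (simp flip: spectral_family_right[OF assms])
qed

text \<open>The strict inequality defines E by right limits, so E is right continuous for any f; the
  hypothesis \<open>right\<close> is what makes E agree with f at rational parameters.\<close>

lemma rat_spectral_family:
  fixes f :: "rat \<Rightarrow> 'a::complex_hilbert_space proj"
  assumes top: "(\<Squnion>r. f r) = \<top>" and bot: "(\<Squnion>r. - f r) = \<top>"
    and right: "\<And>r. f r = (\<Sqinter>s\<in>{r<..}. f s)"
  defines "E \<equiv> \<lambda>t::real. \<Sqinter>r\<in>{r. t < of_rat r}. f r"
  shows "spectral_family E" "E (of_rat r) = f r"
proof -
  show E_rat: "E (of_rat r) = f r" for r
    using right[of r] by (simp add: E_def of_rat_less greaterThan_def)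
  have mono: "E s \<le> E t" if "s \<le> t" for s t
    unfolding E_def by (rule INF_superset_mono) (use that in auto)
  show "spectral_family E"
    unfolding spectral_family_def
  proof (intro conjI allI)
    show "mono E" using mono by (rule monoI)
    show "E t = (\<Sqinter>s\<in>{t<..}. E s)" for t
    proof (rule antisym)
      show "E t \<le> (\<Sqinter>s\<in>{t<..}. E s)" by (intro INF_greatest mono) simp
      have "(\<Sqinter>s\<in>{t<..}. E s) \<le> f r" if r: "t < of_rat r" for r
      proof -
        obtain s where s: "t < s" "s < of_rat r" using dense r by blast
        then have "(\<Sqinter>s\<in>{t<..}. E s) \<le> E s" by (intro INF_lower) simp
        also have "\<dots> \<le> f r" unfolding E_def using s by (intro INF_lower) simp
        finally show ?thesis .
      qed
      then have "(\<Sqinter>s\<in>{t<..}. E s) \<le> (\<Sqinter>r\<in>{r. t < of_rat r}. f r)"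
        by (intro INF_greatest) simp
      then show "(\<Sqinter>s\<in>{t<..}. E s) \<le> E t" by (simp only: E_def)
    qed
    have "(\<Sqinter>t. E t) \<le> f r" for r
      by (subst E_rat[symmetric]) (intro INF_lower UNIV_I)
    then have "(\<Squnion>r. - f r) \<le> - (\<Sqinter>t. E t)"
      by (intro SUP_least ortho_antimono)
    then have "- (\<Sqinter>t. E t) = \<top>" by (simp add: bot top_unique)
    then show "(\<Sqinter>t. E t) = \<bottom>" by (metis compl_top_eq ortho_involution)
    have "(\<Squnion>r. f r) \<le> (\<Squnion>t. E t)"
      by (intro SUP_least) (subst E_rat[symmetric], intro SUP_upper UNIV_I)
    then show "(\<Squnion>t. E t) = \<top>" by (simp add: top top_unique)
  qed
qed

lemma spectral_family_restrict_rat: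
  assumes E: "spectral_family E"
  shows "(\<Squnion>r. E (of_rat r)) = \<top>" "(\<Squnion>r. - E (of_rat r)) = \<top>"
    and "E (of_rat r) = (\<Sqinter>s\<in>{r<..}. E (of_rat s))"
proof -
  note mono = spectral_family_mono[OF E]
  have "E t \<le> (\<Squnion>r. E (of_rat r))" for t
  proof -
    obtain r where "t < of_rat r" using of_rat_dense[of t "t + 1"] by auto
    then have "E t \<le> E (of_rat r)" by (intro mono) simp
    then show ?thesis by (meson SUP_upper UNIV_I order_trans)
  qed
  then have "(\<Squnion>t. E t) \<le> (\<Squnion>r. E (of_rat r))" by (rule SUP_least)
  then show "(\<Squnion>r. E (of_rat r)) = \<top>"
    by (simp only: spectral_family_Sup[OF E] top_unique)
  have "- (\<Squnion>r. - E (of_rat r)) \<le> E t" for t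
  proof -
    obtain r where "of_rat r < t" using of_rat_dense[of "t - 1" t] by auto
    then have "E (of_rat r) \<le> E t" by (intro mono) simp
    moreover have "- (\<Squnion>r. - E (of_rat r)) \<le> E (of_rat r)"
      by (rule compl_le_swap2) (intro SUP_upper UNIV_I)
    ultimately show ?thesis by (rule order_trans[rotated])
  qed
  then have "- (\<Squnion>r. - E (of_rat r)) \<le> (\<Sqinter>t. E t)" by (rule INF_greatest)
  then have "- (\<Squnion>r. - E (of_rat r)) = \<bottom>"
    by (simp only: spectral_family_Inf[OF E] bot_unique)
  then show "(\<Squnion>r. - E (of_rat r)) = \<top>" by (metis compl_bot_eq ortho_involution)
  show "E (of_rat r) = (\<Sqinter>s\<in>{r<..}. E (of_rat s))"
    using spectral_family_eq_INF_rat[OF E, of "of_rat r"] by (simp add: of_rat_less greaterThan_def)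
qed

lemma affiliated_self_adjoint_iff:
  assumes "logic Q"
  shows "A \<in> affiliated_self_adjoint Q \<longleftrightarrow> self_adjoint A \<and> (\<forall>t. spectral_projection A t \<in> Q)"
proof (cases "self_adjoint A")
  case True
  then interpret self_adjoint_op A by unfold_locales
  show ?thesis
    using True affiliated_iff[OF assms] by (simp add: affiliated_self_adjoint_def spectral_projection_eq)
qed (simp add: affiliated_self_adjoint_def)

lemma spectral_projection_self_adjoint:
  assumes "self_adjoint A"
  shows "spectral_family (spectral_projection A)"
    and "resolution_of_identity A (spectral_projection A)"
proof -
  interpret self_adjoint_op A using assms by unfold_locales
  show "spectral_family (spectral_projection A)" "resolution_of_identity A (spectral_projection A)"
    unfolding spectral_projection_eq
    by (rule spectral_family_central_cut resolution_of_identity_central_cut)+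
qed

lemma operator_of_spectral_family_exists:
  assumes "spectral_family E"
  shows "\<exists>A. self_adjoint A \<and> spectral_projection A = E"
proof -
  interpret F: projection_family E by unfold_locales (rule assms)
  interpret B: self_adjoint_op F.family_op by unfold_locales (rule F.self_adjoint_family_op)
  have "spectral_projection F.family_op = E"
    unfolding B.spectral_projection_eq
    by (rule B.spectral_family_cuts_unique[OF assms F.cut_family_op, symmetric])
  with F.self_adjoint_family_op show ?thesis by blast
qed

text \<open>Right continuity carries agreement from the rationals to the reals, and the resolution
  determines the operator.\<close>

lemma spectral_projection_inject:
  assumes "self_adjoint A" "self_adjoint B"
    and "\<And>r::rat. spectral_projection A (of_rat r) = spectral_projection B (of_rat r)"
  shows "A = B"
proof -
  have eq: "spectral_projection A = spectral_projection B"
  proof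
    fix t
    have "spectral_projection A t = (\<Sqinter>r\<in>{r. t < of_rat r}. spectral_projection A (of_rat r))"
      by (rule spectral_family_eq_INF_rat[OF spectral_projection_self_adjoint(1)[OF assms(1)]])
    also have "\<dots> = (\<Sqinter>r\<in>{r. t < of_rat r}. spectral_projection B (of_rat r))"
      by (simp only: assms(3))
    also have "\<dots> = spectral_projection B t"
      by (rule spectral_family_eq_INF_rat[OF spectral_projection_self_adjoint(1)[OF assms(2)], symmetric])
    finally show "spectral_projection A t = spectral_projection B t" .
  qed
  show ?thesis
  proof (rule resolution_determines_operator)
    show "resolution_of_identity A (spectral_projection A)" "resolution_of_identity B (spectral_projection A)"
      using spectral_projection_self_adjoint(2)[OF assms(1)] spectral_projection_self_adjoint(2)[OF assms(2)]
      by (simp_all only: eq)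
  qed (use assms(1,2) in \<open>auto simp only: self_adjoint_def\<close>)
qed

lemma bij_betw_of_unique_relation:
  assumes "\<And>x. x \<in> X \<Longrightarrow> \<exists>!y. y \<in> Y \<and> R x y" "\<And>y. y \<in> Y \<Longrightarrow> \<exists>!x. x \<in> X \<and> R x y"
  shows "bij_betw (\<lambda>x. THE y. y \<in> Y \<and> R x y) X Y"
proof -
  let ?f = "\<lambda>x. THE y. y \<in> Y \<and> R x y"
  have f: "?f x \<in> Y \<and> R x (?f x)" if "x \<in> X" for x
    by (rule theI'[OF assms(1)[OF that]])
  have eq: "?f x = y" if "x \<in> X" "y \<in> Y" "R x y" for x y
    using f[OF that(1)] assms(1)[OF that(1)] that by blast
  show ?thesis
    unfolding bij_betw_def
  proof (intro conjI inj_onI subset_antisym subsetI)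
    show "x = x'" if "x \<in> X" "x' \<in> X" "?f x = ?f x'" for x x'
      using f[OF that(1)] f[OF that(2)] assms(2)[of "?f x"] that by metis
    show "y \<in> Y" if "y \<in> ?f ` X" for y using f that by blast
    show "y \<in> ?f ` X" if "y \<in> Y" for y
      using assms(2)[OF that] eq that by blast
  qed
qed

theorem theorem6p1:
  fixes Q :: "'a::complex_hilbert_space proj set" and \<iota> :: "rat \<Rightarrow> hset"
  assumes "logic Q" and "inj \<iota>"
  shows "(\<forall>u\<in>real_names \<iota> Q. \<exists>!A. A \<in> affiliated_self_adjoint Q \<and> corresponds \<iota> u A) \<and>
    (\<forall>A\<in>affiliated_self_adjoint Q. \<exists>!u. u \<in> real_names \<iota> Q \<and> corresponds \<iota> u A) \<and>
    bij_betw (\<lambda>u. THE A. A \<in> affiliated_self_adjoint Q \<and> corresponds \<iota> u A)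
      (real_names \<iota> Q) (affiliated_self_adjoint Q)"
proof -
  note asa_iff = affiliated_self_adjoint_iff[OF assms(1)]
  have 1: "\<exists>!A. A \<in> affiliated_self_adjoint Q \<and> corresponds \<iota> u A" if u: "u \<in> real_names \<iota> Q" for u
  proof -
    define f where "f r = name_app u (check (\<iota> r))" for r
    have dom: "name_dom u = (\<lambda>r. check (\<iota> r)) ` UNIV" and univ: "u \<in> name_universe Q"
      using u by (auto simp: real_names_def)
    have fQ: "f r \<in> Q" for r
      unfolding f_def by (rule name_app_in_logic[OF univ]) (simp add: dom)
    have f: "(\<Squnion>r. f r) = \<top>" "(\<Squnion>r. - f r) = \<top>" "f r = (\<Sqinter>s\<in>{r<..}. f s)" for r
      using u real_val_eq_top_iff[OF assms(2) dom] unfolding real_names_def f_def by blast+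
    obtain A where A: "self_adjoint A" "spectral_projection A = (\<lambda>t. \<Sqinter>r\<in>{r. t < of_rat r}. f r)"
      using operator_of_spectral_family_exists[OF rat_spectral_family(1)[OF f]] by blast
    have A_rat: "spectral_projection A (of_rat r) = f r" for r
      using rat_spectral_family(2)[OF f] by (simp add: A(2))
    show ?thesis
    proof (rule ex1I[of _ A])
      \<comment> \<open>At irrational parameters the spectral projections are infima of values of u,
        so completeness of the logic keeps them in Q.\<close>
      have "A \<in> affiliated_self_adjoint Q"
        unfolding asa_iff A(2) using A(1) fQ by (auto intro: logic_Inf_closed[OF assms(1)])
      \<comment> \<open>Relation (i) is the right continuity of the values of u, relation (ii) is
        \<open>A_rat\<close>.\<close>
      moreover have "corresponds \<iota> u A"
        unfolding corresponds_def f_def[symmetric] A_rat using f(3) by blast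
      ultimately show "A \<in> affiliated_self_adjoint Q \<and> corresponds \<iota> u A" ..
      fix B assume B: "B \<in> affiliated_self_adjoint Q \<and> corresponds \<iota> u B"
      then have "self_adjoint B" by (simp add: asa_iff)
      moreover have "f r = spectral_projection B (of_rat r)" for r
        using B unfolding corresponds_def f_def by blast
      ultimately show "B = A"
        by (intro spectral_projection_inject[OF _ A(1)]) (simp_all only: A_rat)
    qed
  qed
  have 2: "\<exists>!u. u \<in> real_names \<iota> Q \<and> corresponds \<iota> u A" if A: "A \<in> affiliated_self_adjoint Q" for A
  proof -
    have sa: "self_adjoint A" and AQ: "spectral_projection A t \<in> Q" for t
      using A by (auto simp: asa_iff)
    note R = spectral_family_restrict_rat[OF spectral_projection_self_adjoint(1)[OF sa]]
    let ?u = "rat_name \<iota> (\<lambda>r. spectral_projection A (of_rat r))"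
    note app = name_app_rat_name[OF assms(2)] and dom = name_dom_rat_name[OF assms(2)]
    show ?thesis
    proof (rule ex1I[of _ ?u])
      have "?u \<in> real_names \<iota> Q"
        unfolding real_names_def mem_Collect_eq real_val_eq_top_iff[OF assms(2) dom] app
        by (intro conjI allI R dom rat_name_universe[OF assms(2)] logic_top[OF assms(1)] AQ)
      moreover have "corresponds \<iota> ?u A"
        unfolding corresponds_def app using R(3) by blast
      ultimately show "?u \<in> real_names \<iota> Q \<and> corresponds \<iota> ?u A" ..
      fix v assume v: "v \<in> real_names \<iota> Q \<and> corresponds \<iota> v A"
      then have "v = rat_name \<iota> (\<lambda>r. name_app v (check (\<iota> r)))"
        by (intro eq_rat_name[OF assms(2)]) (auto simp: real_names_def)
      moreover have "name_app v (check (\<iota> r)) = spectral_projection A (of_rat r)" for r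
        using v unfolding corresponds_def by blast
      ultimately show "v = ?u" by (simp only:)
    qed
  qed
  show ?thesis
    using 1 2 bij_betw_of_unique_relation[of "real_names \<iota> Q" "affiliated_self_adjoint Q" "corresponds \<iota>"]
    by blast
qed

end
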